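(* Let $G:\mathbb{B}\to\mathbb{C}$ be a functor that has a left adjoint. The functor $G$ is monadic if and only if there is a pseudofunctor $(\mathcal{A},\mathfrak{a}):\Delta_3\to\mathrm{Cat}$ such that $G=\mathsf{d}^{\mathcal{A}}\circ\mathcal{K}$ for some equivalence of categories $\mathcal{K}:\mathbb{B}\to\mathrm{lax}\text{-}\mathrm{Desc}(\mathcal{A})$, where $\mathsf{d}^{\mathcal{A}}:\mathrm{lax}\text{-}\mathrm{Desc}(\mathcal{A})\to\mathcal{A}(\mathsf{1})$ is the forgetful functor of the lax descent category of $\mathcal{A}$.
   Context: $\mathrm{Cat}$ is the $2$-category of categories in some universe. A right adjoint functor is monadic if its comparison functor to the Eilenberg-Moore category of the induced monad is an equivalence of categories. The category $\Delta_3$: the subcategory of the category of finite nonempty ordinals and order-preserving maps with objects $\mathsf{1},\mathsf{2},\mathsf{3}$ generated by the maps $d^0,d^1:\mathsf{1}\to\mathsf{2}$, $s^0:\mathsf{2}\to\mathsf{1}$, $D^0,D^1,D^2:\mathsf{2}\to\mathsf{3}$ (the usual cofaces, $d^i$ and $D^i$ omitting $i$ from the image, and codegeneracy), subject to $s^0d^1=\mathrm{id}_{\mathsf{1}}=s^0d^0$ and $D^td^k=D^kd^{t-1}$ for $t>k$. A pseudofunctor $(\mathcal{A},\mathfrak{a}):\Delta_3\to\mathrm{Cat}$ has invertible natural transformations $\mathfrak{a}_{hg}:\mathcal{A}(h)\mathcal{A}(g)\Rightarrow\mathcal{A}(hg)$ and $\mathfrak{a}_x:\mathrm{id}_{\mathcal{A}(x)}\Rightarrow\mathcal{A}(\mathrm{id}_x)$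 satisfying the usual coherence equations. Put $\mathcal{A}(\sigma_{01})=\mathfrak{a}_{D^0d^0}^{-1}\cdot\mathfrak{a}_{D^1d^0}$, $\mathcal{A}(\sigma_{02})=\mathfrak{a}_{D^0d^1}^{-1}\cdot\mathfrak{a}_{D^2d^0}$, $\mathcal{A}(\sigma_{12})=\mathfrak{a}_{D^1d^1}^{-1}\cdot\mathfrak{a}_{D^2d^1}$, $\mathcal{A}(\mathfrak{n}_0)=\mathfrak{a}_{\mathsf{1}}^{-1}\cdot\mathfrak{a}_{s^0d^0}$, $\mathcal{A}(\mathfrak{n}_1)=\mathfrak{a}_{\mathsf{1}}^{-1}\cdot\mathfrak{a}_{s^0d^1}$. Lax descent category $\mathrm{lax}\text{-}\mathrm{Desc}(\mathcal{A})$: objects are pairs $(w,\varphi)$ with $w$ an object of $\mathcal{A}(\mathsf{1})$ and $\varphi:\mathcal{A}(d^1)(w)\to\mathcal{A}(d^0)(w)$ a morphism of $\mathcal{A}(\mathsf{2})$ such that $\mathcal{A}(D^0)(\varphi)\cdot\mathcal{A}(\sigma_{02})_w\cdot\mathcal{A}(D^2)(\varphi)=\mathcal{A}(\sigma_{01})_w\cdot\mathcal{A}(D^1)(\varphi)\cdot\mathcal{A}(\sigma_{12})_w$ and $\mathcal{A}(\mathfrak{n}_0)_w\cdot\mathcal{A}(s^0)(\varphi)=\mathcal{A}(\mathfrak{n}_1)_w$. A morphism $(w,\varphi)\to(w',\varphi')$ is a morphism $m:w\to w'$ of $\mathcal{A}(\mathsf{1})$ with $\mathcal{A}(d^0)(m)\cdot\varphi=\varphi'\cdot\mathcal{A}(d^1)(m)$;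 composition is that of $\mathcal{A}(\mathsf{1})$. The forgetful functor $\mathsf{d}^{\mathcal{A}}$ sends $(w,\varphi)\mapsto w$ and $m\mapsto m$. *)

theory Defs
  imports Main
begin

section \<open>Categories, functors, natural transformations\<close>

text \<open>Composition is written in applicative order: \<open>Comp C g f\<close> is \<open>g\<close> after \<open>f\<close>.
  The fields are only meaningful on \<open>Obj\<close>, \<open>Arr\<close> and composable pairs.\<close>

record ('o, 'a) cat =
  Obj :: "'o set"
  Arr :: "'a set"
  Dom :: "'a \<Rightarrow> 'o"
  Cod :: "'a \<Rightarrow> 'o"
  Idt :: "'o \<Rightarrow> 'a"
  Comp :: "'a \<Rightarrow> 'a \<Rightarrow> 'a"

definition hom :: "('o, 'a) cat \<Rightarrow> 'o \<Rightarrow> 'o \<Rightarrow> 'a set" where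
  "hom C x y = {f \<in> Arr C. Dom C f = x \<and> Cod C f = y}"

definition category :: "('o, 'a) cat \<Rightarrow> bool" where
  "category C \<longleftrightarrow>
     (\<forall>f \<in> Arr C. Dom C f \<in> Obj C \<and> Cod C f \<in> Obj C) \<and>
     (\<forall>x \<in> Obj C. Idt C x \<in> hom C x x) \<and>
     (\<forall>f \<in> Arr C. \<forall>g \<in> Arr C. Dom C g = Cod C f \<longrightarrow>
        Comp C g f \<in> hom C (Dom C f) (Cod C g)) \<and>
     (\<forall>f \<in> Arr C. Comp C (Idt C (Cod C f)) f = f \<and> Comp C f (Idt C (Dom C f)) = f) \<and>
     (\<forall>f \<in> Arr C. \<forall>g \<in> Arr C. \<forall>h \<in> Arr C. Dom C g = Cod C f \<longrightarrow> Dom C h = Cod C g \<longrightarrow>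
        Comp C h (Comp C g f) = Comp C (Comp C h g) f)"

definition is_inverse :: "('o, 'a) cat \<Rightarrow> 'a \<Rightarrow> 'a \<Rightarrow> bool" where
  "is_inverse C f g \<longleftrightarrow> g \<in> hom C (Cod C f) (Dom C f) \<and>
     Comp C g f = Idt C (Dom C f) \<and> Comp C f g = Idt C (Cod C f)"

definition is_iso :: "('o, 'a) cat \<Rightarrow> 'a \<Rightarrow> bool" where
  "is_iso C f \<longleftrightarrow> f \<in> Arr C \<and> (\<exists>g. is_inverse C f g)"

definition inv_arr :: "('o, 'a) cat \<Rightarrow> 'a \<Rightarrow> 'a" where
  "inv_arr C f = (THE g. is_inverse C f g)"

record ('o, 'a, 'p, 'b) fctr =
  omap :: "'o \<Rightarrow> 'p"
  amap :: "'a \<Rightarrow> 'b"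

definition is_functor :: "('o, 'a) cat \<Rightarrow> ('p, 'b) cat \<Rightarrow> ('o, 'a, 'p, 'b) fctr \<Rightarrow> bool" where
  "is_functor C D F \<longleftrightarrow> category C \<and> category D \<and>
     (\<forall>x \<in> Obj C. omap F x \<in> Obj D) \<and>
     (\<forall>f \<in> Arr C. amap F f \<in> hom D (omap F (Dom C f)) (omap F (Cod C f))) \<and>
     (\<forall>x \<in> Obj C. amap F (Idt C x) = Idt D (omap F x)) \<and>
     (\<forall>f \<in> Arr C. \<forall>g \<in> Arr C. Dom C g = Cod C f \<longrightarrow>
        amap F (Comp C g f) = Comp D (amap F g) (amap F f))"

definition id_functor :: "('o, 'a, 'o, 'a) fctr" where
  "id_functor = \<lparr>omap = (\<lambda>x. x), amap = (\<lambda>f. f)\<rparr>"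

definition comp_functor ::
  "('p, 'b, 'q, 'c) fctr \<Rightarrow> ('o, 'a, 'p, 'b) fctr \<Rightarrow> ('o, 'a, 'q, 'c) fctr" (infixr "\<circ>\<^sub>F" 75) where
  "G \<circ>\<^sub>F F = \<lparr>omap = omap G \<circ> omap F, amap = amap G \<circ> amap F\<rparr>"

text \<open>Strict equality of functors with domain \<open>C\<close> (values outside \<open>C\<close> are irrelevant).\<close>

definition functor_eq ::
  "('o, 'a) cat \<Rightarrow> ('o, 'a, 'p, 'b) fctr \<Rightarrow> ('o, 'a, 'p, 'b) fctr \<Rightarrow> bool" where
  "functor_eq C F G \<longleftrightarrow>
     (\<forall>x \<in> Obj C. omap F x = omap G x) \<and> (\<forall>f \<in> Arr C. amap F f = amap G f)"

definition nat_trans :: "('o, 'a) cat \<Rightarrow> ('p, 'b) cat \<Rightarrow>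
    ('o, 'a, 'p, 'b) fctr \<Rightarrow> ('o, 'a, 'p, 'b) fctr \<Rightarrow> ('o \<Rightarrow> 'b) \<Rightarrow> bool" where
  "nat_trans C D F G \<tau> \<longleftrightarrow> is_functor C D F \<and> is_functor C D G \<and>
     (\<forall>x \<in> Obj C. \<tau> x \<in> hom D (omap F x) (omap G x)) \<and>
     (\<forall>f \<in> Arr C. Comp D (\<tau> (Cod C f)) (amap F f) = Comp D (amap G f) (\<tau> (Dom C f)))"

definition nat_iso :: "('o, 'a) cat \<Rightarrow> ('p, 'b) cat \<Rightarrow>
    ('o, 'a, 'p, 'b) fctr \<Rightarrow> ('o, 'a, 'p, 'b) fctr \<Rightarrow> ('o \<Rightarrow> 'b) \<Rightarrow> bool" where
  "nat_iso C D F G \<tau> \<longleftrightarrow> nat_trans C D F G \<tau> \<and> (\<forall>x \<in> Obj C. is_iso D (\<tau> x))"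

definition is_equivalence :: "('o, 'a) cat \<Rightarrow> ('p, 'b) cat \<Rightarrow> ('o, 'a, 'p, 'b) fctr \<Rightarrow> bool" where
  "is_equivalence C D K \<longleftrightarrow> is_functor C D K \<and>
     (\<exists>L \<alpha> \<beta>. is_functor D C L \<and>
        nat_iso C C id_functor (L \<circ>\<^sub>F K) \<alpha> \<and> nat_iso D D (K \<circ>\<^sub>F L) id_functor \<beta>)"


section \<open>Adjunctions and monadicity\<close>

text \<open>\<open>F : C \<rightarrow> B\<close> is left adjoint to \<open>G : B \<rightarrow> C\<close> with unit \<open>\<eta>\<close> and counit \<open>\<epsilon>\<close>.\<close>

definition adjunction :: "('o, 'a) cat \<Rightarrow> ('p, 'b) cat \<Rightarrow>
    ('p, 'b, 'o, 'a) fctr \<Rightarrow> ('o, 'a, 'p, 'b) fctr \<Rightarrow> ('p \<Rightarrow> 'b) \<Rightarrow> ('o \<Rightarrow> 'a) \<Rightarrow> bool" where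
  "adjunction B C F G \<eta> \<epsilon> \<longleftrightarrow> is_functor B C G \<and> is_functor C B F \<and>
     nat_trans C C id_functor (G \<circ>\<^sub>F F) \<eta> \<and> nat_trans B B (F \<circ>\<^sub>F G) id_functor \<epsilon> \<and>
     (\<forall>b \<in> Obj B. Comp C (amap G (\<epsilon> b)) (\<eta> (omap G b)) = Idt C (omap G b)) \<and>
     (\<forall>c \<in> Obj C. Comp B (\<epsilon> (omap F c)) (amap F (\<eta> c)) = Idt B (omap F c))"

definition has_left_adjoint :: "('o, 'a) cat \<Rightarrow> ('p, 'b) cat \<Rightarrow> ('o, 'a, 'p, 'b) fctr \<Rightarrow> bool" where
  "has_left_adjoint B C G \<longleftrightarrow> (\<exists>F \<eta> \<epsilon>. adjunction B C F G \<eta> \<epsilon>)"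

definition EM_algebras ::
  "('p, 'b) cat \<Rightarrow> ('p, 'b, 'p, 'b) fctr \<Rightarrow> ('p \<Rightarrow> 'b) \<Rightarrow> ('p \<Rightarrow> 'b) \<Rightarrow> ('p \<times> 'b) set" where
  "EM_algebras C T \<eta> \<mu> = {(c, a). c \<in> Obj C \<and> a \<in> hom C (omap T c) c \<and>
     Comp C a (\<eta> c) = Idt C c \<and> Comp C a (\<mu> c) = Comp C a (amap T a)}"

text \<open>The Eilenberg-Moore category of the monad \<open>(T, \<eta>, \<mu>)\<close> on \<open>C\<close>. Arrows carry their domain and
  codomain, since the same arrow of \<open>C\<close> may underlie several algebra morphisms.\<close>

definition EM_cat :: "('p, 'b) cat \<Rightarrow> ('p, 'b, 'p, 'b) fctr \<Rightarrow> ('p \<Rightarrow> 'b) \<Rightarrow> ('p \<Rightarrow> 'b) \<Rightarrow>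
    ('p \<times> 'b, ('p \<times> 'b) \<times> 'b \<times> ('p \<times> 'b)) cat" where
  "EM_cat C T \<eta> \<mu> =
     \<lparr>Obj = EM_algebras C T \<eta> \<mu>,
      Arr = {((c, a), m, (c', a')). (c, a) \<in> EM_algebras C T \<eta> \<mu> \<and> (c', a') \<in> EM_algebras C T \<eta> \<mu> \<and>
               m \<in> hom C c c' \<and> Comp C m a = Comp C a' (amap T m)},
      Dom = (\<lambda>(x, m, y). x),
      Cod = (\<lambda>(x, m, y). y),
      Idt = (\<lambda>x. (x, Idt C (fst x), x)),
      Comp = (\<lambda>(x', n, y') (x, m, y). (x, Comp C n m, y'))\<rparr>"

text \<open>The Eilenberg-Moore category of the monad \<open>(G F, \<eta>, G \<epsilon> F)\<close> induced by an adjunction, and the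
  comparison functor \<open>b \<mapsto> (G b, G \<epsilon>\<^sub>b)\<close>.\<close>

definition induced_EM :: "('p, 'b) cat \<Rightarrow> ('p, 'b, 'o, 'a) fctr \<Rightarrow> ('o, 'a, 'p, 'b) fctr \<Rightarrow>
    ('p \<Rightarrow> 'b) \<Rightarrow> ('o \<Rightarrow> 'a) \<Rightarrow> ('p \<times> 'b, ('p \<times> 'b) \<times> 'b \<times> ('p \<times> 'b)) cat" where
  "induced_EM C F G \<eta> \<epsilon> = EM_cat C (G \<circ>\<^sub>F F) \<eta> (\<lambda>c. amap G (\<epsilon> (omap F c)))"

definition comparison :: "('o, 'a) cat \<Rightarrow> ('o, 'a, 'p, 'b) fctr \<Rightarrow> ('o \<Rightarrow> 'a) \<Rightarrow>
    ('o, 'a, 'p \<times> 'b, ('p \<times> 'b) \<times> 'b \<times> ('p \<times> 'b)) fctr" where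
  "comparison B G \<epsilon> =
     \<lparr>omap = (\<lambda>b. (omap G b, amap G (\<epsilon> b))),
      amap = (\<lambda>f. ((omap G (Dom B f), amap G (\<epsilon> (Dom B f))), amap G f,
                  (omap G (Cod B f), amap G (\<epsilon> (Cod B f)))))\<rparr>"

definition monadic :: "('o, 'a) cat \<Rightarrow> ('p, 'b) cat \<Rightarrow> ('o, 'a, 'p, 'b) fctr \<Rightarrow> bool" where
  "monadic B C G \<longleftrightarrow> (\<exists>F \<eta> \<epsilon>. adjunction B C F G \<eta> \<epsilon> \<and>
     is_equivalence B (induced_EM C F G \<eta> \<epsilon>) (comparison B G \<epsilon>))"


section \<open>The category \<open>\<Delta>\<^sub>3\<close>\<close>

text \<open>The ordinal \<open>n\<close> is \<open>{0, \<dots>, n - 1}\<close>. A map \<open>n \<rightarrow> m\<close> is \<open>(n, xs, m)\<close> with \<open>xs\<close> its list of values.\<close>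

type_synonym ordmap = "nat \<times> nat list \<times> nat"

definition fin_ord :: "(nat, ordmap) cat" where
  "fin_ord =
     \<lparr>Obj = {n. 0 < n},
      Arr = {(n, xs, m). 0 < n \<and> 0 < m \<and> length xs = n \<and> set xs \<subseteq> {..<m} \<and> sorted xs},
      Dom = (\<lambda>(n, xs, m). n),
      Cod = (\<lambda>(n, xs, m). m),
      Idt = (\<lambda>n. (n, [0..<n], n)),
      Comp = (\<lambda>(n', ys, m') (n, xs, m). (n, map (\<lambda>j. ys ! j) xs, m'))\<rparr>"

definition coface :: "nat \<Rightarrow> nat \<Rightarrow> ordmap" where
  "coface n i = (n, map (\<lambda>j. if j < i then j else Suc j) [0..<n], Suc n)"

definition d_map :: "nat \<Rightarrow> ordmap" where "d_map i = coface 1 i"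
definition D_map :: "nat \<Rightarrow> ordmap" where "D_map i = coface 2 i"
definition s_map :: ordmap where "s_map = (2, [0, 0], 1)"

inductive_set delta3_arr :: "ordmap set" where
  identity: "n \<in> {1, 2, 3} \<Longrightarrow> Idt fin_ord n \<in> delta3_arr"
| face1: "i \<in> {0, 1} \<Longrightarrow> d_map i \<in> delta3_arr"
| face2: "i \<in> {0, 1, 2} \<Longrightarrow> D_map i \<in> delta3_arr"
| degeneracy: "s_map \<in> delta3_arr"
| compose: "\<lbrakk>f \<in> delta3_arr; g \<in> delta3_arr; Dom fin_ord g = Cod fin_ord f\<rbrakk>
    \<Longrightarrow> Comp fin_ord g f \<in> delta3_arr"

definition delta3 :: "(nat, ordmap) cat" where
  "delta3 = fin_ord\<lparr>Obj := {1, 2, 3}, Arr := delta3_arr\<rparr>"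

lemmas delta3_gens = delta3_def fin_ord_def d_map_def D_map_def s_map_def coface_def

lemma delta3_relations:
  "Comp delta3 s_map (d_map 1) = Idt delta3 1"
  "Comp delta3 s_map (d_map 0) = Idt delta3 1"
  "k < t \<Longrightarrow> t \<le> 2 \<Longrightarrow> Comp delta3 (D_map t) (d_map k) = Comp delta3 (D_map k) (d_map (t - 1))"
  by (auto simp: delta3_gens numeral_2_eq_2 nth_append)


section \<open>Pseudofunctors into \<open>Cat\<close>\<close>

text \<open>A universe is given by the family \<open>U\<close> of subsets of a type that are small. The only closure
  properties required are the ones below; the small sets of a Grothendieck universe have them, as
  do all subsets of an infinite type.\<close>

definition universe :: "'u set set \<Rightarrow> bool" where
  "universe U \<longleftrightarrow>
     (\<forall>X \<in> U. \<forall>Y. Y \<subseteq> X \<longrightarrow> Y \<in> U) \<and>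
     (\<exists>a b. a \<noteq> b \<and> {a, b} \<in> U) \<and>
     (\<forall>X \<in> U. \<forall>Y \<in> U. \<exists>Z \<in> U. \<exists>f. bij_betw f (X \<times> Y) Z)"

definition in_Cat :: "'u set set \<Rightarrow> ('u, 'u) cat \<Rightarrow> bool" where
  "in_Cat U C \<longleftrightarrow> category C \<and> Obj C \<in> U \<and> Arr C \<in> U"

text \<open>\<open>pf_comp A h g\<close> is the component family of \<open>\<aa>\<^bsub>hg\<^esub> : A(h) A(g) \<Rightarrow> A(h g)\<close>, and
  \<open>pf_unit A x\<close> that of \<open>\<aa>\<^bsub>x\<^esub> : id \<Rightarrow> A(id\<^bsub>x\<^esub>)\<close>.\<close>

record ('x, 'y, 'u) pseudo =
  pf_obj :: "'x \<Rightarrow> ('u, 'u) cat"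
  pf_arr :: "'y \<Rightarrow> ('u, 'u, 'u, 'u) fctr"
  pf_comp :: "'y \<Rightarrow> 'y \<Rightarrow> 'u \<Rightarrow> 'u"
  pf_unit :: "'x \<Rightarrow> 'u \<Rightarrow> 'u"

definition pseudofunctor :: "'u set set \<Rightarrow> ('x, 'y) cat \<Rightarrow> ('x, 'y, 'u) pseudo \<Rightarrow> bool" where
  "pseudofunctor U X A \<longleftrightarrow> category X \<and>
     (\<forall>x \<in> Obj X. in_Cat U (pf_obj A x)) \<and>
     (\<forall>f \<in> Arr X. is_functor (pf_obj A (Dom X f)) (pf_obj A (Cod X f)) (pf_arr A f)) \<and>
     (\<forall>g \<in> Arr X. \<forall>h \<in> Arr X. Dom X h = Cod X g \<longrightarrow>
        nat_iso (pf_obj A (Dom X g)) (pf_obj A (Cod X h))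
          (pf_arr A h \<circ>\<^sub>F pf_arr A g) (pf_arr A (Comp X h g)) (pf_comp A h g)) \<and>
     (\<forall>x \<in> Obj X. nat_iso (pf_obj A x) (pf_obj A x) id_functor (pf_arr A (Idt X x)) (pf_unit A x)) \<and>
     (\<forall>f \<in> Arr X. \<forall>g \<in> Arr X. \<forall>h \<in> Arr X. Dom X g = Cod X f \<longrightarrow> Dom X h = Cod X g \<longrightarrow>
        (\<forall>c \<in> Obj (pf_obj A (Dom X f)).
           Comp (pf_obj A (Cod X h)) (pf_comp A h (Comp X g f) c) (amap (pf_arr A h) (pf_comp A g f c)) =
           Comp (pf_obj A (Cod X h)) (pf_comp A (Comp X h g) f c) (pf_comp A h g (omap (pf_arr A f) c)))) \<and>
     (\<forall>f \<in> Arr X. \<forall>c \<in> Obj (pf_obj A (Dom X f)).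
        Comp (pf_obj A (Cod X f)) (pf_comp A (Idt X (Cod X f)) f c)
            (pf_unit A (Cod X f) (omap (pf_arr A f) c))
          = Idt (pf_obj A (Cod X f)) (omap (pf_arr A f) c) \<and>
        Comp (pf_obj A (Cod X f)) (pf_comp A f (Idt X (Dom X f)) c)
            (amap (pf_arr A f) (pf_unit A (Dom X f) c))
          = Idt (pf_obj A (Cod X f)) (omap (pf_arr A f) c))"


section \<open>The lax descent category\<close>

type_synonym 'u descent = "(nat, ordmap, 'u) pseudo"

definition sigma01 :: "'u descent \<Rightarrow> 'u \<Rightarrow> 'u" where
  "sigma01 A w = Comp (pf_obj A 3)
     (inv_arr (pf_obj A 3) (pf_comp A (D_map 0) (d_map 0) w)) (pf_comp A (D_map 1) (d_map 0) w)"

definition sigma02 :: "'u descent \<Rightarrow> 'u \<Rightarrow> 'u" where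
  "sigma02 A w = Comp (pf_obj A 3)
     (inv_arr (pf_obj A 3) (pf_comp A (D_map 0) (d_map 1) w)) (pf_comp A (D_map 2) (d_map 0) w)"

definition sigma12 :: "'u descent \<Rightarrow> 'u \<Rightarrow> 'u" where
  "sigma12 A w = Comp (pf_obj A 3)
     (inv_arr (pf_obj A 3) (pf_comp A (D_map 1) (d_map 1) w)) (pf_comp A (D_map 2) (d_map 1) w)"

definition nn :: "'u descent \<Rightarrow> nat \<Rightarrow> 'u \<Rightarrow> 'u" where
  "nn A i w = Comp (pf_obj A 1)
     (inv_arr (pf_obj A 1) (pf_unit A 1 w)) (pf_comp A s_map (d_map i) w)"

definition descent_data :: "'u descent \<Rightarrow> ('u \<times> 'u) set" where
  "descent_data A = {(w, \<phi>). w \<in> Obj (pf_obj A 1) \<and>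
     \<phi> \<in> hom (pf_obj A 2) (omap (pf_arr A (d_map 1)) w) (omap (pf_arr A (d_map 0)) w) \<and>
     Comp (pf_obj A 3) (amap (pf_arr A (D_map 0)) \<phi>)
         (Comp (pf_obj A 3) (sigma02 A w) (amap (pf_arr A (D_map 2)) \<phi>))
       = Comp (pf_obj A 3) (sigma01 A w)
         (Comp (pf_obj A 3) (amap (pf_arr A (D_map 1)) \<phi>) (sigma12 A w)) \<and>
     Comp (pf_obj A 1) (nn A 0 w) (amap (pf_arr A s_map) \<phi>) = nn A 1 w}"

definition lax_desc :: "'u descent \<Rightarrow> ('u \<times> 'u, ('u \<times> 'u) \<times> 'u \<times> ('u \<times> 'u)) cat" where
  "lax_desc A =
     \<lparr>Obj = descent_data A,
      Arr = {((w, \<phi>), m, (w', \<phi>')). (w, \<phi>) \<in> descent_data A \<and> (w', \<phi>') \<in> descent_data A \<and>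
               m \<in> hom (pf_obj A 1) w w' \<and>
               Comp (pf_obj A 2) (amap (pf_arr A (d_map 0)) m) \<phi> =
               Comp (pf_obj A 2) \<phi>' (amap (pf_arr A (d_map 1)) m)},
      Dom = (\<lambda>(x, m, y). x),
      Cod = (\<lambda>(x, m, y). y),
      Idt = (\<lambda>x. (x, Idt (pf_obj A 1) (fst x), x)),
      Comp = (\<lambda>(x', n, y') (x, m, y). (x, Comp (pf_obj A 1) n m, y'))\<rparr>"

definition forget_desc :: "('u \<times> 'u, ('u \<times> 'u) \<times> 'u \<times> ('u \<times> 'u), 'u, 'u) fctr" where
  "forget_desc = \<lparr>omap = (\<lambda>(w, \<phi>). w), amap = (\<lambda>(x, m, y). m)\<rparr>"

end

theory Submission
  imports Defs
begin

text \<open>Let \<open>F\<close> be left adjoint to \<open>G\<close> and \<open>T = G F\<close>. Monadicity is tested on the comparison functor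
  \<open>\<Phi>\<close>, and a functor is an equivalence exactly if it is fully faithful and essentially surjective.

  Suppose first that \<open>G\<close> is the forgetful functor of a lax descent category up to an equivalence
  \<open>K\<close>, so that every object \<open>b\<close> of \<open>B\<close> gives a descent structure \<open>\<phi>\<^sub>b\<close> on \<open>G b\<close>, and an
  arrow \<open>G b \<rightarrow> G b'\<close> lifts to \<open>B\<close> if and only if it respects these structures. An algebra
  \<open>a : T c \<rightarrow> c\<close> is a split epimorphism of \<open>C\<close>, with section \<open>\<eta>\<^sub>c\<close>, and stays one under
  each of the functors of the diagram. Since all conditions that define descent data and their
  morphisms are equations between natural constructions, they may be checked after composition with
  such an epimorphism (\<open>descent_along_split_epi\<close>, \<open>descent_morphism_along_split_epi\<close>). This is
  a direct form of Beck's criterion: the structure of the free object \<open>F c\<close> descends along \<open>a\<close>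
  to a structure on \<open>c\<close>, and the object of \<open>B\<close> that has this structure is sent by \<open>\<Phi>\<close> to
  the algebra \<open>(c, a)\<close>, up to isomorphism
  (\<open>comparison_equivalence_if_factors_through_lax_descent\<close>).

  Conversely, the Eilenberg-Moore category of \<open>T\<close> is itself a lax descent category. Take for
  \<open>A(n)\<close> the collage with \<open>n\<close> copies of \<open>C\<close>, in which an arrow from \<open>c\<close> in copy \<open>i\<close>
  to \<open>c'\<close> in copy \<open>j \<ge> i\<close> is an arrow \<open>T\<^sup>j\<^sup>-\<^sup>i c \<rightarrow> c'\<close> of \<open>C\<close>. A map \<open>u : 2 \<rightarrow> n\<close> acts
  on an arrow \<open>T c \<rightarrow> c'\<close> by precomposition with \<open>\<eta>\<close>, the identity or \<open>\<mu>\<close>, according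
  to whether \<open>u(1) - u(0)\<close> is 0, 1 or 2. An arrow from the first copy of \<open>w\<close> to the second one
  is an arrow \<open>a : T w \<rightarrow> w\<close>; the associativity condition of descent says
  \<open>a \<cdot> T a = a \<cdot> \<mu>\<close>, and the unit condition says \<open>a \<cdot> \<eta> = 1\<close>. So descent data are
  algebras (\<open>descent_data_cells\<close>), and \<open>K\<close> is \<open>\<Phi>\<close> followed by this identification. The
  diagram is strict, but \<open>A(1)\<close> has to be \<open>C\<close> itself and \<open>A(2)\<close>, \<open>A(3)\<close> have to
  consist of elements of the universe; for this the collages are transported along bijections.\<close>



section \<open>Calculating with composites and functors\<close>

lemma category_rules:
  assumes "category C"
  shows category_hom_obj: "f \<in> hom C x y \<Longrightarrow> x \<in> Obj C \<and> y \<in> Obj C"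
    and category_Idt: "x \<in> Obj C \<Longrightarrow> Idt C x \<in> hom C x x"
    and category_Comp: "g \<in> hom C y z \<Longrightarrow> f \<in> hom C x y \<Longrightarrow> Comp C g f \<in> hom C x z"
    and category_left_unit: "f \<in> hom C x y \<Longrightarrow> Comp C (Idt C y) f = f"
    and category_right_unit: "f \<in> hom C x y \<Longrightarrow> Comp C f (Idt C x) = f"
    and category_assoc: "h \<in> hom C z w \<Longrightarrow> g \<in> hom C y z \<Longrightarrow> f \<in> hom C x y \<Longrightarrow>
      Comp C (Comp C h g) f = Comp C h (Comp C g f)"
  using assms unfolding category_def hom_def by auto

lemma hom_iff: "f \<in> hom C x y \<longleftrightarrow> f \<in> Arr C \<and> Dom C f = x \<and> Cod C f = y"
  by (auto simp: hom_def)

lemma categoryI: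
  assumes "\<And>f. f \<in> Arr C \<Longrightarrow> Dom C f \<in> Obj C \<and> Cod C f \<in> Obj C"
    and "\<And>x. x \<in> Obj C \<Longrightarrow> Idt C x \<in> hom C x x"
    and "\<And>x y z f g. f \<in> hom C x y \<Longrightarrow> g \<in> hom C y z \<Longrightarrow> Comp C g f \<in> hom C x z"
    and "\<And>x y f. f \<in> hom C x y \<Longrightarrow> Comp C (Idt C y) f = f"
    and "\<And>x y f. f \<in> hom C x y \<Longrightarrow> Comp C f (Idt C x) = f"
    and "\<And>x y z w f g h. f \<in> hom C x y \<Longrightarrow> g \<in> hom C y z \<Longrightarrow> h \<in> hom C z w \<Longrightarrow>
      Comp C h (Comp C g f) = Comp C (Comp C h g) f"
  shows "category C"
  unfolding category_def using assms by (simp add: hom_iff)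

lemma functor_rules:
  assumes "is_functor C D F"
  shows functor_source: "category C" and functor_target: "category D"
    and functor_obj: "x \<in> Obj C \<Longrightarrow> omap F x \<in> Obj D"
    and functor_hom: "f \<in> hom C x y \<Longrightarrow> amap F f \<in> hom D (omap F x) (omap F y)"
    and functor_Idt: "x \<in> Obj C \<Longrightarrow> amap F (Idt C x) = Idt D (omap F x)"
    and functor_Comp: "g \<in> hom C y z \<Longrightarrow> f \<in> hom C x y \<Longrightarrow>
      amap F (Comp C g f) = Comp D (amap F g) (amap F f)"
  using assms unfolding is_functor_def hom_def by auto

lemma functorI:
  assumes "category C" and "category D"
    and "\<And>x. x \<in> Obj C \<Longrightarrow> omap F x \<in> Obj D"
    and "\<And>x y f. f \<in> hom C x y \<Longrightarrow> amap F f \<in> hom D (omap F x) (omap F y)"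
    and "\<And>x. x \<in> Obj C \<Longrightarrow> amap F (Idt C x) = Idt D (omap F x)"
    and "\<And>x y z f g. f \<in> hom C x y \<Longrightarrow> g \<in> hom C y z \<Longrightarrow>
      amap F (Comp C g f) = Comp D (amap F g) (amap F f)"
  shows "is_functor C D F"
  unfolding is_functor_def using assms by (simp add: hom_iff)

lemma comp_functor_simps [simp]:
  "omap (G \<circ>\<^sub>F F) x = omap G (omap F x)"
  "amap (G \<circ>\<^sub>F F) f = amap G (amap F f)"
  by (auto simp: comp_functor_def)

lemma id_functor_simps [simp]: "omap id_functor x = x" "amap id_functor f = f"
  by (auto simp: id_functor_def)

lemma id_is_functor: "category C \<Longrightarrow> is_functor C C id_functor"
  by (auto intro!: functorI simp: category_Idt)

lemma comp_is_functor:
  assumes "is_functor C D F" and "is_functor D E G"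
  shows "is_functor C E (G \<circ>\<^sub>F F)"
proof (rule functorI)
  fix x y z f g assume f: "f \<in> hom C x y" and g: "g \<in> hom C y z"
  show "amap (G \<circ>\<^sub>F F) (Comp C g f) = Comp E (amap (G \<circ>\<^sub>F F) g) (amap (G \<circ>\<^sub>F F) f)"
    using functor_Comp[OF assms(1) g f]
      functor_Comp[OF assms(2) functor_hom[OF assms(1) g] functor_hom[OF assms(1) f]] by simp
qed (auto simp: functor_source[OF assms(1)] functor_target[OF assms(2)]
    functor_obj[OF assms(1)] functor_obj[OF assms(2)] functor_Idt[OF assms(1)] functor_Idt[OF assms(2)]
    intro: functor_hom[OF assms(1)] functor_hom[OF assms(2)])

lemma nat_trans_rules:
  assumes "nat_trans C D F G \<tau>"
  shows nat_trans_hom: "x \<in> Obj C \<Longrightarrow> \<tau> x \<in> hom D (omap F x) (omap G x)"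
    and nat_trans_natural: "f \<in> hom C x y \<Longrightarrow>
      Comp D (\<tau> y) (amap F f) = Comp D (amap G f) (\<tau> x)"
  using assms unfolding nat_trans_def hom_def by auto

lemma nat_transI:
  assumes "is_functor C D F" and "is_functor C D G"
    and "\<And>x. x \<in> Obj C \<Longrightarrow> \<tau> x \<in> hom D (omap F x) (omap G x)"
    and "\<And>x y f. f \<in> hom C x y \<Longrightarrow> Comp D (\<tau> y) (amap F f) = Comp D (amap G f) (\<tau> x)"
  shows "nat_trans C D F G \<tau>"
  unfolding nat_trans_def using assms by (simp add: hom_iff)

text \<open>The equations between long composites below are obtained by pasting commutative squares: here
  \<open>p\<close>, \<open>q\<close>, \<open>r\<close> are the vertical sides.\<close>

lemma paste_squares:
  assumes C: "category C"
    and f: "f \<in> hom C x y" and g: "g \<in> hom C y z"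
    and f': "f' \<in> hom C x' y'" and g': "g' \<in> hom C y' z'"
    and p: "p \<in> hom C x x'" and q: "q \<in> hom C y y'" and r: "r \<in> hom C z z'"
    and left: "Comp C q f = Comp C f' p" and right: "Comp C r g = Comp C g' q"
  shows "Comp C r (Comp C g f) = Comp C (Comp C g' f') p"
  by (simp add: category_assoc[OF C r g f, symmetric] right category_assoc[OF C g' q f] left
      category_assoc[OF C g' f' p])

lemma functor_square:
  assumes F: "is_functor C D F"
    and f: "f \<in> hom C x y" and f': "f' \<in> hom C x' y'"
    and p: "p \<in> hom C x x'" and q: "q \<in> hom C y y'"
    and eq: "Comp C q f = Comp C f' p"
  shows "Comp D (amap F q) (amap F f) = Comp D (amap F f') (amap F p)"
  by (metis functor_Comp[OF F q f] functor_Comp[OF F f' p] eq)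

lemma split_epi_cancel:
  assumes C: "category C" and m: "m \<in> hom C x y" and e: "e \<in> hom C y x"
    and me: "Comp C m e = Idt C y"
    and f: "f \<in> hom C y z" and g: "g \<in> hom C y z" and eq: "Comp C f m = Comp C g m"
  shows "f = g"
  by (metis category_assoc[OF C f m e] category_assoc[OF C g m e] eq me
    category_right_unit[OF C f] category_right_unit[OF C g])

lemma is_isoI:
  "f \<in> hom C x y \<Longrightarrow> g \<in> hom C y x \<Longrightarrow> Comp C g f = Idt C x \<Longrightarrow> Comp C f g = Idt C y \<Longrightarrow> is_iso C f"
  by (auto simp: is_iso_def is_inverse_def hom_iff)

lemma is_isoE:
  assumes "is_iso C f" and "f \<in> hom C x y"
  obtains g where "g \<in> hom C y x" "Comp C g f = Idt C x" "Comp C f g = Idt C y"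
  using assms by (auto simp: is_iso_def is_inverse_def hom_iff)

lemma is_inverse_unique:
  assumes "category C" and "f \<in> Arr C" and "is_inverse C f g" and "is_inverse C f h"
  shows "g = h"
proof -
  have f: "f \<in> hom C (Dom C f) (Cod C f)" using assms by (simp add: hom_iff)
  have g: "g \<in> hom C (Cod C f) (Dom C f)" and h: "h \<in> hom C (Cod C f) (Dom C f)"
    using assms by (auto simp: is_inverse_def)
  have "g = Comp C g (Comp C f h)"
    using assms(1,4) category_right_unit[OF assms(1) g] by (simp add: is_inverse_def)
  also have "\<dots> = Comp C (Comp C g f) h" using category_assoc[OF assms(1) g f h] by simp
  also have "\<dots> = h" using assms(3) category_left_unit[OF assms(1) h] by (simp add: is_inverse_def)
  finally show ?thesis .
qed

lemma inv_arr_eq: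
  assumes "category C" "f \<in> hom C x y" "g \<in> hom C y x" "Comp C g f = Idt C x" "Comp C f g = Idt C y"
  shows "inv_arr C f = g"
proof -
  have "is_inverse C f g" using assms by (auto simp: is_inverse_def hom_iff)
  moreover have "f \<in> Arr C" using assms by (simp add: hom_iff)
  ultimately show ?thesis
    unfolding inv_arr_def using is_inverse_unique[OF assms(1)] by blast
qed

lemma inv_arr_rules:
  assumes "category C" "is_iso C f" "f \<in> hom C x y"
  shows inv_arr_hom: "inv_arr C f \<in> hom C y x"
    and inv_arr_left: "Comp C (inv_arr C f) f = Idt C x"
    and inv_arr_right: "Comp C f (inv_arr C f) = Idt C y"
  using is_isoE[OF assms(2,3)] inv_arr_eq[OF assms(1,3)] by metis+

lemma inv_arr_Idt: "category C \<Longrightarrow> x \<in> Obj C \<Longrightarrow> inv_arr C (Idt C x) = Idt C x"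
  using category_left_unit[OF _ category_Idt] category_Idt inv_arr_eq by metis

text \<open>A commutative square with invertible sides \<open>i\<close> and \<open>j\<close> stays commutative when these are
  replaced by their inverses; this gives naturality of inverses.\<close>

lemma inverse_square:
  assumes C: "category C"
    and i: "i \<in> hom C x x'" "i' \<in> hom C x' x" "Comp C i i' = Idt C x'"
    and j: "j \<in> hom C y y'" "j' \<in> hom C y' y" "Comp C j' j = Idt C y"
    and f: "f \<in> hom C x y" "f' \<in> hom C x' y'"
    and eq: "Comp C j f = Comp C f' i"
  shows "Comp C j' f' = Comp C f i'"
proof -
  have "Comp C j' f' = Comp C j' (Comp C f' (Comp C i i'))"
    using category_right_unit[OF C f(2)] i(3) by simp
  also have "\<dots> = Comp C j' (Comp C (Comp C j f) i')"
    using category_assoc[OF C f(2) i(1,2)] eq by simp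
  also have "\<dots> = Comp C (Comp C j' j) (Comp C f i')"
    using category_assoc[OF C category_Comp[OF C j(2,1)] f(1) i(2)]
      category_assoc[OF C j(2,1) category_Comp[OF C f(1) i(2)]]
      category_assoc[OF C j(2) category_Comp[OF C j(1) f(1)] i(2)]
      category_assoc[OF C j(1) f(1) i(2)] category_assoc[OF C j(2,1) f(1)] by simp
  also have "\<dots> = Comp C f i'"
    using j(3) category_left_unit[OF C category_Comp[OF C f(1) i(2)]] by simp
  finally show ?thesis .
qed

lemma nat_iso_inverse:
  assumes "nat_iso C D F G \<alpha>"
  shows "nat_iso C D G F (\<lambda>x. inv_arr D (\<alpha> x))"
proof -
  have a: "nat_trans C D F G \<alpha>" and iso: "\<And>x. x \<in> Obj C \<Longrightarrow> is_iso D (\<alpha> x)"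
    using assms by (auto simp: nat_iso_def)
  have F: "is_functor C D F" and G: "is_functor C D G" using a by (auto simp: nat_trans_def)
  have D: "category D" using functor_target[OF F] .
  note inv = inv_arr_rules[OF D iso nat_trans_hom[OF a]]
  have "nat_trans C D G F (\<lambda>x. inv_arr D (\<alpha> x))"
  proof (rule nat_transI[OF G F])
    fix x y f assume f: "f \<in> hom C x y"
    then have x: "x \<in> Obj C" and y: "y \<in> Obj C"
      using category_hom_obj[OF functor_source[OF F]] by auto
    show "Comp D (inv_arr D (\<alpha> y)) (amap G f) = Comp D (amap F f) (inv_arr D (\<alpha> x))"
      by (rule inverse_square[OF D nat_trans_hom[OF a x] inv(1)[OF x x] inv(3)[OF x x]
          nat_trans_hom[OF a y] inv(1)[OF y y] inv(2)[OF y y] functor_hom[OF F f] functor_hom[OF G f]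
          nat_trans_natural[OF a f]])
  qed (use inv in auto)
  moreover have "is_iso D (inv_arr D (\<alpha> x))" if "x \<in> Obj C" for x
    using is_isoI[OF inv(1) nat_trans_hom[OF a] inv(3) inv(2)] that by blast
  ultimately show ?thesis by (simp add: nat_iso_def)
qed

text \<open>The transformations \<open>\<sigma>\<^sub>0\<^sub>1\<close>, \<open>\<sigma>\<^sub>0\<^sub>2\<close>, \<open>\<sigma>\<^sub>1\<^sub>2\<close>,
  \<open>\<nn>\<^sub>0\<close> and \<open>\<nn>\<^sub>1\<close> of a pseudofunctor are all of this form.\<close>

lemma nat_iso_comp_inverse:
  assumes \<alpha>: "nat_iso C D F H \<alpha>" and \<beta>: "nat_iso C D G H \<beta>"
  shows "nat_trans C D F G (\<lambda>x. Comp D (inv_arr D (\<beta> x)) (\<alpha> x))"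
proof -
  have a: "nat_trans C D F H \<alpha>" and b: "nat_trans C D H G (\<lambda>x. inv_arr D (\<beta> x))"
    using \<alpha> nat_iso_inverse[OF \<beta>] by (auto simp: nat_iso_def)
  have F: "is_functor C D F" and G: "is_functor C D G" and H: "is_functor C D H"
    using a b by (auto simp: nat_trans_def)
  have D: "category D" using functor_target[OF F] .
  show ?thesis
  proof (rule nat_transI[OF F G])
    show "Comp D (inv_arr D (\<beta> x)) (\<alpha> x) \<in> hom D (omap F x) (omap G x)" if "x \<in> Obj C" for x
      using category_Comp[OF D nat_trans_hom[OF b that] nat_trans_hom[OF a that]] .
  next
    fix x y f assume f: "f \<in> hom C x y"
    have x: "x \<in> Obj C" and y: "y \<in> Obj C"
      using category_hom_obj[OF functor_source[OF F] f] by auto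
    show "Comp D (Comp D (inv_arr D (\<beta> y)) (\<alpha> y)) (amap F f) =
        Comp D (amap G f) (Comp D (inv_arr D (\<beta> x)) (\<alpha> x))"
      by (rule paste_squares[OF D nat_trans_hom[OF a x] nat_trans_hom[OF b x] nat_trans_hom[OF a y]
            nat_trans_hom[OF b y] functor_hom[OF F f] functor_hom[OF H f] functor_hom[OF G f]
            nat_trans_natural[OF a f, symmetric] nat_trans_natural[OF b f, symmetric], symmetric])
  qed
qed


section \<open>Equivalences are the fully faithful and essentially surjective functors\<close>

definition fully_faithful :: "('o, 'a) cat \<Rightarrow> ('p, 'b) cat \<Rightarrow> ('o, 'a, 'p, 'b) fctr \<Rightarrow> bool" where
  "fully_faithful C D K \<longleftrightarrow>
     (\<forall>x \<in> Obj C. \<forall>y \<in> Obj C. bij_betw (amap K) (hom C x y) (hom D (omap K x) (omap K y)))"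

definition essentially_surjective ::
  "('o, 'a) cat \<Rightarrow> ('p, 'b) cat \<Rightarrow> ('o, 'a, 'p, 'b) fctr \<Rightarrow> bool" where
  "essentially_surjective C D K \<longleftrightarrow>
     (\<forall>d \<in> Obj D. \<exists>c \<in> Obj C. \<exists>i \<in> hom D (omap K c) d. is_iso D i)"

lemma fully_faithful_rules:
  assumes "fully_faithful C D K" and "x \<in> Obj C" and "y \<in> Obj C"
  shows fully_faithful_inj: "f \<in> hom C x y \<Longrightarrow> g \<in> hom C x y \<Longrightarrow> amap K f = amap K g \<Longrightarrow> f = g"
    and fully_faithful_surj: "h \<in> hom D (omap K x) (omap K y) \<Longrightarrow> \<exists>f \<in> hom C x y. amap K f = h"
proof -
  have bij: "bij_betw (amap K) (hom C x y) (hom D (omap K x) (omap K y))"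
    using assms by (simp add: fully_faithful_def)
  show "f \<in> hom C x y \<Longrightarrow> g \<in> hom C x y \<Longrightarrow> amap K f = amap K g \<Longrightarrow> f = g"
    using bij_betw_imp_inj_on[OF bij] by (simp add: inj_on_eq_iff)
  show "h \<in> hom D (omap K x) (omap K y) \<Longrightarrow> \<exists>f \<in> hom C x y. amap K f = h"
    using bij_betw_imp_surj_on[OF bij] by (metis imageE)
qed

lemma fully_faithfulI:
  assumes "is_functor C D K"
    and "\<And>x y f g. x \<in> Obj C \<Longrightarrow> y \<in> Obj C \<Longrightarrow> f \<in> hom C x y \<Longrightarrow> g \<in> hom C x y \<Longrightarrow>
      amap K f = amap K g \<Longrightarrow> f = g"
    and "\<And>x y h. x \<in> Obj C \<Longrightarrow> y \<in> Obj C \<Longrightarrow> h \<in> hom D (omap K x) (omap K y) \<Longrightarrow>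
      \<exists>f \<in> hom C x y. amap K f = h"
  shows "fully_faithful C D K"
  unfolding fully_faithful_def bij_betw_def inj_on_def
  using assms functor_hom[OF assms(1)] by blast

text \<open>An arrow \<open>f : x \<rightarrow> y\<close> is determined by \<open>H f\<close> because naturality expresses
  \<open>f \<cdot> \<beta>\<^sub>x\<close> through it. This is used for \<open>L K\<close> as well as for \<open>K L\<close>, where \<open>L\<close> is a
  quasi-inverse of \<open>K\<close>.\<close>

lemma nat_iso_to_id_faithful:
  assumes \<beta>: "nat_iso D D H id_functor \<beta>"
    and f: "f \<in> hom D x y" and g: "g \<in> hom D x y" and eq: "amap H f = amap H g"
  shows "f = g"
proof -
  have b: "nat_trans D D H id_functor \<beta>" using \<beta> by (simp add: nat_iso_def)
  have H: "is_functor D D H" using b by (simp add: nat_trans_def)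
  have D: "category D" using functor_source[OF H] .
  have x: "x \<in> Obj D" using category_hom_obj[OF D f] by simp
  have bx: "\<beta> x \<in> hom D (omap H x) x" using nat_trans_hom[OF b x] by simp
  have "is_iso D (\<beta> x)" using \<beta> x by (simp add: nat_iso_def)
  then obtain b' where b': "b' \<in> hom D x (omap H x)" "Comp D (\<beta> x) b' = Idt D x"
    using is_isoE[OF _ bx] by metis
  have "Comp D f (\<beta> x) = Comp D g (\<beta> x)"
    using nat_trans_natural[OF b f] nat_trans_natural[OF b g] eq by simp
  then show ?thesis using split_epi_cancel[OF D bx b' f g] by simp
qed

lemma equivalence_fully_faithful:
  assumes "is_equivalence C D K"
  shows "fully_faithful C D K"
proof -
  obtain L \<alpha> \<beta> where K: "is_functor C D K" and L: "is_functor D C L"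
    and \<alpha>: "nat_iso C C id_functor (L \<circ>\<^sub>F K) \<alpha>" and \<beta>: "nat_iso D D (K \<circ>\<^sub>F L) id_functor \<beta>"
    using assms unfolding is_equivalence_def by blast
  have a: "nat_trans C C id_functor (L \<circ>\<^sub>F K) \<alpha>" using \<alpha> by (simp add: nat_iso_def)
  have C: "category C" using functor_source[OF K] .
  show ?thesis
  proof (rule fully_faithfulI[OF K])
    fix x y f g assume "f \<in> hom C x y" "g \<in> hom C x y" "amap K f = amap K g"
    then show "f = g" using nat_iso_to_id_faithful[OF nat_iso_inverse[OF \<alpha>]] by simp
  next
    fix x y h assume x: "x \<in> Obj C" and y: "y \<in> Obj C" and h: "h \<in> hom D (omap K x) (omap K y)"
    have ax: "\<alpha> x \<in> hom C x (omap L (omap K x))" and ay: "\<alpha> y \<in> hom C y (omap L (omap K y))"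
      using nat_trans_hom[OF a] x y by simp_all
    obtain x' where x': "x' \<in> hom C (omap L (omap K x)) x" "Comp C (\<alpha> x) x' = Idt C (omap L (omap K x))"
      using \<alpha> x is_isoE[OF _ ax] unfolding nat_iso_def by metis
    obtain y' where y': "y' \<in> hom C (omap L (omap K y)) y" "Comp C (\<alpha> y) y' = Idt C (omap L (omap K y))"
      using \<alpha> y is_isoE[OF _ ay] unfolding nat_iso_def by metis
    have Lh: "amap L h \<in> hom C (omap L (omap K x)) (omap L (omap K y))" using functor_hom[OF L h] .
    \<comment> \<open>The preimage of \<open>h\<close> is \<open>L h\<close> conjugated by the unit; faithfulness of \<open>L\<close> shows \<open>K f = h\<close>.\<close>
    define f where "f = Comp C y' (Comp C (amap L h) (\<alpha> x))"
    have f: "f \<in> hom C x y" unfolding f_def using category_Comp[OF C] y' Lh ax by blast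
    have "Comp C (\<alpha> y) f = Comp C (amap L h) (\<alpha> x)"
      unfolding f_def using category_assoc[OF C ay y'(1) category_Comp[OF C Lh ax]] y'(2)
        category_left_unit[OF C category_Comp[OF C Lh ax]] by simp
    then have "Comp C (amap L (amap K f)) (\<alpha> x) = Comp C (amap L h) (\<alpha> x)"
      using nat_trans_natural[OF a f] by simp
    then have "amap L (amap K f) = amap L h"
      using split_epi_cancel[OF C ax x' functor_hom[OF L functor_hom[OF K f]] Lh] by simp
    then have "amap K f = h"
      using nat_iso_to_id_faithful[OF \<beta> functor_hom[OF K f] h] by simp
    then show "\<exists>f \<in> hom C x y. amap K f = h" using f by blast
  qed
qed

lemma equivalence_essentially_surjective:
  assumes "is_equivalence C D K"
  shows "essentially_surjective C D K"
proof -
  obtain L \<beta> where L: "is_functor D C L" and \<beta>: "nat_iso D D (K \<circ>\<^sub>F L) id_functor \<beta>"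
    using assms unfolding is_equivalence_def by blast
  then have "\<beta> d \<in> hom D (omap K (omap L d)) d" "is_iso D (\<beta> d)" if "d \<in> Obj D" for d
    using that nat_trans_hom[of D D "K \<circ>\<^sub>F L" id_functor \<beta>] by (auto simp: nat_iso_def)
  then show ?thesis
    unfolding essentially_surjective_def using functor_obj[OF L] by blast
qed

lemma fully_faithful_reflects_iso:
  assumes K: "is_functor C D K" and ff: "fully_faithful C D K"
    and f: "f \<in> hom C x y" and iso: "is_iso D (amap K f)"
  shows "is_iso C f"
proof -
  have C: "category C" and x: "x \<in> Obj C" and y: "y \<in> Obj C"
    using functor_source[OF K] category_hom_obj[OF _ f] by auto
  obtain k where k: "k \<in> hom D (omap K y) (omap K x)"
    "Comp D k (amap K f) = Idt D (omap K x)" "Comp D (amap K f) k = Idt D (omap K y)"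
    using is_isoE[OF iso functor_hom[OF K f]] by blast
  obtain g where g: "g \<in> hom C y x" "amap K g = k" using fully_faithful_surj[OF ff y x k(1)] by blast
  have "Comp C g f = Idt C x"
    by (rule fully_faithful_inj[OF ff x x category_Comp[OF C g(1) f] category_Idt[OF C x]])
      (simp add: functor_Comp[OF K g(1) f] functor_Idt[OF K x] g(2) k(2))
  moreover have "Comp C f g = Idt C y"
    by (rule fully_faithful_inj[OF ff y y category_Comp[OF C f g(1)] category_Idt[OF C y]])
      (simp add: functor_Comp[OF K f g(1)] functor_Idt[OF K y] g(2) k(3))
  ultimately show ?thesis using is_isoI[OF f g(1)] by blast
qed

text \<open>The quasi-inverse chooses for each \<open>d\<close> an object \<open>l d\<close> with an isomorphism
  \<open>i\<^sub>d : K (l d) \<rightarrow> d\<close>; on arrows it is the lift along \<open>K\<close> of conjugation by these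
  isomorphisms. It is functorial because an arrow \<open>f\<close> equals \<open>L h\<close> as soon as
  \<open>i \<cdot> K f = h \<cdot> i\<close>.\<close>

lemma fully_faithful_essentially_surjective_equivalence:
  assumes K: "is_functor C D K" and ff: "fully_faithful C D K"
    and eso: "essentially_surjective C D K"
  shows "is_equivalence C D K"
proof -
  have C: "category C" and D: "category D" using functor_source[OF K] functor_target[OF K] .
  have "\<forall>d \<in> Obj D. \<exists>c i j. c \<in> Obj C \<and> i \<in> hom D (omap K c) d \<and> j \<in> hom D d (omap K c) \<and>
      Comp D j i = Idt D (omap K c) \<and> Comp D i j = Idt D d"
    using eso unfolding essentially_surjective_def by (metis is_isoE)
  then obtain l i j where l: "\<And>d. d \<in> Obj D \<Longrightarrow> l d \<in> Obj C"
    and i: "\<And>d. d \<in> Obj D \<Longrightarrow> i d \<in> hom D (omap K (l d)) d"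
    and j: "\<And>d. d \<in> Obj D \<Longrightarrow> j d \<in> hom D d (omap K (l d))"
    and ji: "\<And>d. d \<in> Obj D \<Longrightarrow> Comp D (j d) (i d) = Idt D (omap K (l d))"
    and ij: "\<And>d. d \<in> Obj D \<Longrightarrow> Comp D (i d) (j d) = Idt D d"
    by metis
  define lift where "lift x y h = (THE f. f \<in> hom C x y \<and> amap K f = h)" for x y h
  have lift: "lift x y h \<in> hom C x y \<and> amap K (lift x y h) = h"
    if "x \<in> Obj C" "y \<in> Obj C" "h \<in> hom D (omap K x) (omap K y)" for x y h
    unfolding lift_def
    by (rule theI', use fully_faithful_inj[OF ff that(1,2)] fully_faithful_surj[OF ff that] in blast)
  define conj where "conj h = Comp D (j (Cod D h)) (Comp D h (i (Dom D h)))" for h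
  have conj_hom: "conj h \<in> hom D (omap K (l x)) (omap K (l y))" if h: "h \<in> hom D x y" for x y h
    using h category_hom_obj[OF D h] category_Comp[OF D] i[of x] j[of y]
    unfolding conj_def by (simp add: hom_iff)
  define L where "L = \<lparr>omap = l, amap = (\<lambda>h. lift (l (Dom D h)) (l (Cod D h)) (conj h))\<rparr>"
  have L_o: "omap L = l" by (simp add: L_def)
  have L_a: "amap L h \<in> hom C (l x) (l y)" "amap K (amap L h) = conj h" if h: "h \<in> hom D x y" for h x y
    using lift[OF l l conj_hom[OF h]] category_hom_obj[OF D h] h by (auto simp: L_def hom_iff)
  have i_nat: "Comp D (i y) (conj h) = Comp D h (i x)" if h: "h \<in> hom D x y" for h x y
  proof -
    have x: "x \<in> Obj D" and y: "y \<in> Obj D" using category_hom_obj[OF D h] by auto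
    have hi: "Comp D h (i x) \<in> hom D (omap K (l x)) y" using category_Comp[OF D h i[OF x]] .
    have "Comp D (i y) (conj h) = Comp D (Comp D (i y) (j y)) (Comp D h (i x))"
      using h category_assoc[OF D i[OF y] j[OF y] hi] by (simp add: conj_def hom_iff)
    then show ?thesis using ij[OF y] category_left_unit[OF D hi] by simp
  qed
  have KL_unique: "f = amap L h"
    if h: "h \<in> hom D x y" and f: "f \<in> hom C (l x) (l y)"
      and eq: "Comp D (i y) (amap K f) = Comp D h (i x)" for f h x y
  proof -
    have x: "x \<in> Obj D" and y: "y \<in> Obj D" using category_hom_obj[OF D h] by auto
    have Kf: "amap K f \<in> hom D (omap K (l x)) (omap K (l y))" using functor_hom[OF K f] .
    have "amap K f = Comp D (Comp D (j y) (i y)) (amap K f)"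
      using ji[OF y] category_left_unit[OF D Kf] by simp
    also have "\<dots> = Comp D (j y) (Comp D h (i x))"
      using category_assoc[OF D j[OF y] i[OF y] Kf] eq by simp
    also have "\<dots> = conj h" using h by (simp add: conj_def hom_iff)
    finally show ?thesis
      using fully_faithful_inj[OF ff l[OF x] l[OF y] f L_a(1)[OF h]] L_a(2)[OF h] by simp
  qed
  have L: "is_functor D C L"
  proof (rule functorI[OF D C])
    fix x assume "x \<in> Obj D" then show "omap L x \<in> Obj C" using l by (simp add: L_o)
  next
    fix x y f assume "f \<in> hom D x y"
    then show "amap L f \<in> hom C (omap L x) (omap L y)" using L_a by (simp add: L_o)
  next
    fix x assume x: "x \<in> Obj D"
    show "amap L (Idt D x) = Idt C (omap L x)"
      by (rule KL_unique[OF category_Idt[OF D x], symmetric])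
        (simp_all add: L_o category_Idt[OF C l[OF x]] functor_Idt[OF K l[OF x]]
          category_left_unit[OF D i[OF x]] category_right_unit[OF D i[OF x]])
  next
    fix x y z f g assume f: "f \<in> hom D x y" and g: "g \<in> hom D y z"
    have x: "x \<in> Obj D" and y: "y \<in> Obj D" and z: "z \<in> Obj D"
      using category_hom_obj[OF D f] category_hom_obj[OF D g] by auto
    show "amap L (Comp D g f) = Comp C (amap L g) (amap L f)"
    proof (rule KL_unique[OF category_Comp[OF D g f], symmetric])
      show "Comp C (amap L g) (amap L f) \<in> hom C (l x) (l z)"
        using category_Comp[OF C L_a(1)[OF g] L_a(1)[OF f]] .
      show "Comp D (i z) (amap K (Comp C (amap L g) (amap L f))) = Comp D (Comp D g f) (i x)"
        unfolding functor_Comp[OF K L_a(1)[OF g] L_a(1)[OF f]] L_a(2)[OF g] L_a(2)[OF f]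
        by (rule paste_squares[OF D conj_hom[OF f] conj_hom[OF g] f g i[OF x] i[OF y] i[OF z]
              i_nat[OF f] i_nat[OF g]])
    qed
  qed
  have "nat_iso D D (K \<circ>\<^sub>F L) id_functor i"
    unfolding nat_iso_def
  proof (intro conjI ballI nat_transI)
    show "is_functor D D (K \<circ>\<^sub>F L)" using comp_is_functor[OF L K] .
    show "is_functor D D id_functor" using id_is_functor[OF D] .
  qed (auto simp: L_o L_a i i_nat intro: is_isoI[OF i j ji ij])
  moreover define a where "a c = lift c (l (omap K c)) (j (omap K c))" for c
  have a: "a c \<in> hom C c (l (omap K c))" "amap K (a c) = j (omap K c)" if c: "c \<in> Obj C" for c
    using lift[OF c l j] functor_obj[OF K c] by (auto simp: a_def)
  have "nat_iso C C id_functor (L \<circ>\<^sub>F K) a"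
    unfolding nat_iso_def
  proof (intro conjI ballI nat_transI)
    show "is_functor C C (L \<circ>\<^sub>F K)" using comp_is_functor[OF K L] .
    show "is_functor C C id_functor" using id_is_functor[OF C] .
    fix x assume x: "x \<in> Obj C"
    then show "a x \<in> hom C (omap id_functor x) (omap (L \<circ>\<^sub>F K) x)" using a by (simp add: L_o)
    show "is_iso C (a x)"
      using fully_faithful_reflects_iso[OF K ff a(1)[OF x]] a(2)[OF x] functor_obj[OF K x]
        is_isoI[OF j i ij ji] by metis
  next
    fix x y f assume f: "f \<in> hom C x y"
    have x: "x \<in> Obj C" and y: "y \<in> Obj C" using category_hom_obj[OF C f] by auto
    have Kx: "omap K x \<in> Obj D" and Ky: "omap K y \<in> Obj D" using functor_obj[OF K] x y by auto
    have Kf: "amap K f \<in> hom D (omap K x) (omap K y)" using functor_hom[OF K f] .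
    have LKf: "amap L (amap K f) \<in> hom C (l (omap K x)) (l (omap K y))" using L_a(1)[OF Kf] .
    have "Comp D (j (omap K y)) (amap K f) = Comp D (conj (amap K f)) (j (omap K x))"
      by (rule inverse_square[OF D i[OF Kx] j[OF Kx] ij[OF Kx] i[OF Ky] j[OF Ky] ji[OF Ky]
            conj_hom[OF Kf] Kf i_nat[OF Kf]])
    then have "Comp C (a y) f = Comp C (amap L (amap K f)) (a x)"
      by (intro fully_faithful_inj[OF ff x l[OF Ky] category_Comp[OF C a(1)[OF y] f]
            category_Comp[OF C LKf a(1)[OF x]]])
        (simp add: functor_Comp[OF K a(1)[OF y] f] functor_Comp[OF K LKf a(1)[OF x]]
          a(2)[OF x] a(2)[OF y] L_a(2)[OF Kf])
    then show "Comp C (a y) (amap id_functor f) = Comp C (amap (L \<circ>\<^sub>F K) f) (a x)" by simp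
  qed
  ultimately show ?thesis unfolding is_equivalence_def using K L by blast
qed

lemma fully_faithful_comp:
  assumes F: "is_functor C D F" and G: "is_functor D E G"
    and "fully_faithful C D F" and "fully_faithful D E G"
  shows "fully_faithful C E (G \<circ>\<^sub>F F)"
  unfolding fully_faithful_def
proof (intro ballI)
  fix x y assume "x \<in> Obj C" "y \<in> Obj C"
  then have "bij_betw (amap G \<circ> amap F) (hom C x y) (hom E (omap G (omap F x)) (omap G (omap F y)))"
    using assms(3,4) functor_obj[OF F] unfolding fully_faithful_def by (blast intro: bij_betw_trans)
  then show "bij_betw (amap (G \<circ>\<^sub>F F)) (hom C x y) (hom E (omap (G \<circ>\<^sub>F F) x) (omap (G \<circ>\<^sub>F F) y))"
    by (simp add: comp_functor_def)
qed

lemma functor_preserves_iso: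
  assumes F: "is_functor C D F" and f: "f \<in> hom C x y" and "is_iso C f"
  shows "is_iso D (amap F f)"
proof -
  obtain g where g: "g \<in> hom C y x" "Comp C g f = Idt C x" "Comp C f g = Idt C y"
    using is_isoE[OF assms(3) f] by blast
  have "x \<in> Obj C" "y \<in> Obj C" using category_hom_obj[OF functor_source[OF F] f] by auto
  then show ?thesis
    using is_isoI[OF functor_hom[OF F f] functor_hom[OF F g(1)]] g
    by (metis functor_Comp[OF F] functor_Idt[OF F] f)
qed


text \<open>The ordinal 1 is an index of categories and functors and has to keep its form as a numeral when
  the terms it occurs in are simplified.\<close>

declare One_nat_def [simp del]

section \<open>Categories of structured objects\<close>

text \<open>Eilenberg-Moore categories and lax descent categories have the same form: objects are objects of
  \<open>C\<close> with a structure, and arrows are the arrows of \<open>C\<close> that are compatible with the structures.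
  The relation \<open>R\<close> is this compatibility.\<close>

definition structure_cat :: "('o, 'a) cat \<Rightarrow> ('o \<times> 'x) set \<Rightarrow>
    ('o \<times> 'x \<Rightarrow> 'a \<Rightarrow> 'o \<times> 'x \<Rightarrow> bool) \<Rightarrow> ('o \<times> 'x, ('o \<times> 'x) \<times> 'a \<times> ('o \<times> 'x)) cat" where
  "structure_cat C S R =
     \<lparr>Obj = S,
      Arr = {(x, m, y). x \<in> S \<and> y \<in> S \<and> m \<in> hom C (fst x) (fst y) \<and> R x m y},
      Dom = (\<lambda>(x, m, y). x),
      Cod = (\<lambda>(x, m, y). y),
      Idt = (\<lambda>x. (x, Idt C (fst x), x)),
      Comp = (\<lambda>(x', n, y') (x, m, y). (x, Comp C n m, y'))\<rparr>"

lemma structure_cat_simps [simp]: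
  "Obj (structure_cat C S R) = S"
  "Idt (structure_cat C S R) x = (x, Idt C (fst x), x)"
  "Comp (structure_cat C S R) (x', n, y') (x, m, y) = (x, Comp C n m, y')"
  "Dom (structure_cat C S R) (x, m, y) = x"
  "Cod (structure_cat C S R) (x, m, y) = y"
  by (simp_all add: structure_cat_def)

lemma hom_structure_cat:
  "f \<in> hom (structure_cat C S R) x y \<longleftrightarrow>
     (\<exists>m. f = (x, m, y) \<and> x \<in> S \<and> y \<in> S \<and> m \<in> hom C (fst x) (fst y) \<and> R x m y)"
  unfolding structure_cat_def hom_def by auto

lemma category_structure_cat:
  assumes C: "category C" and S: "\<And>x. x \<in> S \<Longrightarrow> fst x \<in> Obj C"
    and R_id: "\<And>x. x \<in> S \<Longrightarrow> R x (Idt C (fst x)) x"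
    and R_comp: "\<And>x y z m n. x \<in> S \<Longrightarrow> y \<in> S \<Longrightarrow> z \<in> S \<Longrightarrow> m \<in> hom C (fst x) (fst y) \<Longrightarrow>
      n \<in> hom C (fst y) (fst z) \<Longrightarrow> R x m y \<Longrightarrow> R y n z \<Longrightarrow> R x (Comp C n m) z"
  shows "category (structure_cat C S R)"
proof (rule categoryI)
  show "Dom (structure_cat C S R) f \<in> Obj (structure_cat C S R) \<and>
      Cod (structure_cat C S R) f \<in> Obj (structure_cat C S R)" if "f \<in> Arr (structure_cat C S R)" for f
    using that by (auto simp: structure_cat_def)
qed (auto simp: hom_structure_cat category_Idt[OF C S] R_id category_left_unit[OF C]
    category_right_unit[OF C] category_assoc[OF C] intro: category_Comp[OF C] R_comp)

lemma EM_cat_structure: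
  "EM_cat C T \<eta> \<mu> = structure_cat C (EM_algebras C T \<eta> \<mu>)
     (\<lambda>x m y. Comp C m (snd x) = Comp C (snd y) (amap T m))"
  unfolding EM_cat_def structure_cat_def by auto

lemma lax_desc_structure:
  "lax_desc A = structure_cat (pf_obj A 1) (descent_data A)
     (\<lambda>x m y. Comp (pf_obj A 2) (amap (pf_arr A (d_map 0)) m) (snd x) =
        Comp (pf_obj A 2) (snd y) (amap (pf_arr A (d_map 1)) m))"
  unfolding lax_desc_def structure_cat_def by auto

lemma category_EM_cat:
  assumes T: "is_functor C C T"
  shows "category (EM_cat C T \<eta> \<mu>)"
  unfolding EM_cat_structure
proof (rule category_structure_cat)
  show C: "category C" using functor_source[OF T] .
  fix x assume x: "x \<in> EM_algebras C T \<eta> \<mu>"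
  then have x1: "fst x \<in> Obj C" and x2: "snd x \<in> hom C (omap T (fst x)) (fst x)"
    by (auto simp: EM_algebras_def)
  show "fst x \<in> Obj C" by fact
  show "Comp C (Idt C (fst x)) (snd x) = Comp C (snd x) (amap T (Idt C (fst x)))"
    using category_left_unit[OF C x2] category_right_unit[OF C x2] functor_Idt[OF T x1] by simp
next
  have C: "category C" using functor_source[OF T] .
  fix x y z m n assume "x \<in> EM_algebras C T \<eta> \<mu>" "y \<in> EM_algebras C T \<eta> \<mu>" "z \<in> EM_algebras C T \<eta> \<mu>"
  then have a: "snd x \<in> hom C (omap T (fst x)) (fst x)" "snd y \<in> hom C (omap T (fst y)) (fst y)"
      "snd z \<in> hom C (omap T (fst z)) (fst z)"
    by (auto simp: EM_algebras_def)
  assume m: "m \<in> hom C (fst x) (fst y)" and n: "n \<in> hom C (fst y) (fst z)"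
    and sq: "Comp C m (snd x) = Comp C (snd y) (amap T m)" "Comp C n (snd y) = Comp C (snd z) (amap T n)"
  show "Comp C (Comp C n m) (snd x) = Comp C (snd z) (amap T (Comp C n m))"
    unfolding functor_Comp[OF T n m]
    by (rule paste_squares[OF C functor_hom[OF T m] functor_hom[OF T n] m n a sq[symmetric], symmetric])
qed


section \<open>Descent data\<close>

lemma delta3_simps [simp]:
  "Dom delta3 = Dom fin_ord" "Cod delta3 = Cod fin_ord" "Comp delta3 = Comp fin_ord"
  "Idt delta3 = Idt fin_ord" "Arr delta3 = delta3_arr" "Obj delta3 = {1, 2, 3}"
  by (simp_all add: delta3_def)

lemma delta3_generator_hom:
  "i \<in> {0, 1} \<Longrightarrow> d_map i \<in> hom delta3 1 2"
  "i \<in> {0, 1, 2} \<Longrightarrow> D_map i \<in> hom delta3 2 3"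
  "s_map \<in> hom delta3 2 1"
  using delta3_arr.face1[of i] delta3_arr.face2[of i] delta3_arr.degeneracy
  by (auto simp: hom_iff fin_ord_def d_map_def D_map_def s_map_def coface_def)

text \<open>The functors and natural transformations of the definition of the lax descent category, with their
  types, for a given pseudofunctor.\<close>

locale lax_descent =
  fixes U :: "'u set set" and A :: "'u descent"
  assumes pseudo: "pseudofunctor U delta3 A"
begin

abbreviation "d i \<equiv> pf_arr A (d_map i)"
abbreviation "D i \<equiv> pf_arr A (D_map i)"
abbreviation "s \<equiv> pf_arr A s_map"
abbreviation "Compn n \<equiv> Comp (pf_obj A n)"

lemma functors:
  "f \<in> hom delta3 x y \<Longrightarrow> is_functor (pf_obj A x) (pf_obj A y) (pf_arr A f)"
  using pseudo unfolding pseudofunctor_def hom_iff by metis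

lemmas d_functor = functors[OF delta3_generator_hom(1)]
lemmas D_functor = functors[OF delta3_generator_hom(2)]
lemmas s_functor = functors[OF delta3_generator_hom(3)]

lemma compositors:
  "g \<in> hom delta3 x y \<Longrightarrow> h \<in> hom delta3 y z \<Longrightarrow>
    nat_iso (pf_obj A x) (pf_obj A z) (pf_arr A h \<circ>\<^sub>F pf_arr A g) (pf_arr A (Comp delta3 h g)) (pf_comp A h g)"
  using pseudo unfolding pseudofunctor_def hom_iff by metis

lemma unitors:
  "x \<in> Obj delta3 \<Longrightarrow> nat_iso (pf_obj A x) (pf_obj A x) id_functor (pf_arr A (Idt delta3 x)) (pf_unit A x)"
  using pseudo unfolding pseudofunctor_def by blast

lemma sigma_natural:
  "nat_trans (pf_obj A 1) (pf_obj A 3) (D 1 \<circ>\<^sub>F d 0) (D 0 \<circ>\<^sub>F d 0) (sigma01 A)"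
  "nat_trans (pf_obj A 1) (pf_obj A 3) (D 2 \<circ>\<^sub>F d 0) (D 0 \<circ>\<^sub>F d 1) (sigma02 A)"
  "nat_trans (pf_obj A 1) (pf_obj A 3) (D 2 \<circ>\<^sub>F d 1) (D 1 \<circ>\<^sub>F d 1) (sigma12 A)"
proof -
  have c: "nat_iso (pf_obj A 1) (pf_obj A 3) (D j \<circ>\<^sub>F d i) (pf_arr A (Comp delta3 (D_map j) (d_map i)))
      (pf_comp A (D_map j) (d_map i))" if "i \<in> {0, 1}" "j \<in> {0, 1, 2}" for i j
    using compositors[OF delta3_generator_hom(1,2)] that by blast
  have r: "Comp delta3 (D_map 1) (d_map 0) = Comp delta3 (D_map 0) (d_map 0)"
    "Comp delta3 (D_map 2) (d_map 0) = Comp delta3 (D_map 0) (d_map 1)"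
    "Comp delta3 (D_map 2) (d_map 1) = Comp delta3 (D_map 1) (d_map 1)"
    using delta3_relations(3)[of 0 1] delta3_relations(3)[of 0 2] delta3_relations(3)[of 1 2]
    by (simp_all add: One_nat_def)
  note c' = c[of 0 1, unfolded r] c[of 0 2, unfolded r] c[of 1 2, unfolded r]
  show "nat_trans (pf_obj A 1) (pf_obj A 3) (D 1 \<circ>\<^sub>F d 0) (D 0 \<circ>\<^sub>F d 0) (sigma01 A)"
    unfolding sigma01_def[abs_def] by (rule nat_iso_comp_inverse[OF c'(1) c]) auto
  show "nat_trans (pf_obj A 1) (pf_obj A 3) (D 2 \<circ>\<^sub>F d 0) (D 0 \<circ>\<^sub>F d 1) (sigma02 A)"
    unfolding sigma02_def[abs_def] by (rule nat_iso_comp_inverse[OF c'(2) c]) auto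
  show "nat_trans (pf_obj A 1) (pf_obj A 3) (D 2 \<circ>\<^sub>F d 1) (D 1 \<circ>\<^sub>F d 1) (sigma12 A)"
    unfolding sigma12_def[abs_def] by (rule nat_iso_comp_inverse[OF c'(3) c]) auto
qed

lemma nn_natural:
  assumes "i \<in> {0, 1}"
  shows "nat_trans (pf_obj A 1) (pf_obj A 1) (s \<circ>\<^sub>F d i) id_functor (nn A i)"
proof -
  have "Comp delta3 s_map (d_map i) = Idt delta3 1"
    using assms delta3_relations(1,2) by auto
  then have "nat_iso (pf_obj A 1) (pf_obj A 1) (s \<circ>\<^sub>F d i) (pf_arr A (Idt delta3 1))
      (pf_comp A s_map (d_map i))"
    using compositors[OF delta3_generator_hom(1)[OF assms] delta3_generator_hom(3)] by simp
  moreover have "nat_iso (pf_obj A 1) (pf_obj A 1) id_functor (pf_arr A (Idt delta3 1)) (pf_unit A 1)"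
    using unitors[of 1] by simp
  ultimately show ?thesis
    unfolding nn_def[abs_def] by (rule nat_iso_comp_inverse)
qed

lemma category_lax_desc: "category (lax_desc A)"
  unfolding lax_desc_structure
proof (rule category_structure_cat)
  note d0 = d_functor[of 0, simplified] and d1 = d_functor[of 1, simplified]
  show "category (pf_obj A 1)" using functor_source[OF d0] .
  have X: "category (pf_obj A 2)" using functor_target[OF d0] .
  {
    fix x assume x: "x \<in> descent_data A"
    then have x1: "fst x \<in> Obj (pf_obj A 1)"
      and x2: "snd x \<in> hom (pf_obj A 2) (omap (d 1) (fst x)) (omap (d 0) (fst x))"
      by (auto simp: descent_data_def)
    show "fst x \<in> Obj (pf_obj A 1)" by fact
    show "Compn 2 (amap (d 0) (Idt (pf_obj A 1) (fst x))) (snd x) =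
        Compn 2 (snd x) (amap (d 1) (Idt (pf_obj A 1) (fst x)))"
      unfolding functor_Idt[OF d0 x1] functor_Idt[OF d1 x1]
      using category_left_unit[OF X x2] category_right_unit[OF X x2] by simp
  next
    fix x y z m n assume "x \<in> descent_data A" "y \<in> descent_data A" "z \<in> descent_data A"
    then have p: "snd x \<in> hom (pf_obj A 2) (omap (d 1) (fst x)) (omap (d 0) (fst x))"
      "snd y \<in> hom (pf_obj A 2) (omap (d 1) (fst y)) (omap (d 0) (fst y))"
      "snd z \<in> hom (pf_obj A 2) (omap (d 1) (fst z)) (omap (d 0) (fst z))"
      by (auto simp: descent_data_def)
    assume m: "m \<in> hom (pf_obj A 1) (fst x) (fst y)" and n: "n \<in> hom (pf_obj A 1) (fst y) (fst z)"
      and sq: "Compn 2 (amap (d 0) m) (snd x) = Compn 2 (snd y) (amap (d 1) m)"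
        "Compn 2 (amap (d 0) n) (snd y) = Compn 2 (snd z) (amap (d 1) n)"
    show "Compn 2 (amap (d 0) (Compn 1 n m)) (snd x) = Compn 2 (snd z) (amap (d 1) (Compn 1 n m))"
      unfolding functor_Comp[OF d0 n m] functor_Comp[OF d1 n m]
      by (rule paste_squares[OF X functor_hom[OF d1 m] functor_hom[OF d1 n]
            functor_hom[OF d0 m] functor_hom[OF d0 n] p sq[symmetric], symmetric])
  }
qed

text \<open>The two sides of the associativity condition, and of the unit condition, are the two ways
  round a diagram built from \<open>\<phi>\<close> and natural transformations. So a map compatible with the
  structures \<open>\<psi>\<close> and \<open>\<phi>\<close> is compatible with both sides, and a split epimorphism may be cancelled.\<close>

lemma descent_along_split_epi:
  assumes data: "(w, \<psi>) \<in> descent_data A"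
    and m: "m \<in> hom (pf_obj A 1) w w'" and e: "e \<in> hom (pf_obj A 1) w' w"
    and me: "Compn 1 m e = Idt (pf_obj A 1) w'"
    and \<phi>: "\<phi> \<in> hom (pf_obj A 2) (omap (d 1) w') (omap (d 0) w')"
    and sq: "Compn 2 (amap (d 0) m) \<psi> = Compn 2 \<phi> (amap (d 1) m)"
  shows "(w', \<phi>) \<in> descent_data A"
proof -
  note d0 = d_functor[of 0, simplified] and d1 = d_functor[of 1, simplified]
  note D0 = D_functor[of 0, simplified] and D1 = D_functor[of 1, simplified]
    and D2 = D_functor[of 2, simplified]
  have X1: "category (pf_obj A 1)" and X3: "category (pf_obj A 3)"
    using functor_source[OF d0] functor_target[OF D0] .
  have w: "w \<in> Obj (pf_obj A 1)" and w': "w' \<in> Obj (pf_obj A 1)"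
    using category_hom_obj[OF X1 m] by auto
  have \<psi>: "\<psi> \<in> hom (pf_obj A 2) (omap (d 1) w) (omap (d 0) w)"
    and assoc_\<psi>: "Compn 3 (amap (D 0) \<psi>) (Compn 3 (sigma02 A w) (amap (D 2) \<psi>)) =
      Compn 3 (sigma01 A w) (Compn 3 (amap (D 1) \<psi>) (sigma12 A w))"
    and unit_\<psi>: "Compn 1 (nn A 0 w) (amap s \<psi>) = nn A 1 w"
    using data by (auto simp: descent_data_def)
  note \<sigma> = sigma_natural[THEN nat_trans_hom, simplified]
  note \<sigma>_nat = sigma_natural[THEN nat_trans_natural, simplified, OF m]
  note dm = functor_hom[OF d0 m] functor_hom[OF d1 m]
  note Ddm = functor_hom[OF D0 dm(1)] functor_hom[OF D0 dm(2)] functor_hom[OF D1 dm(1)]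
    functor_hom[OF D1 dm(2)] functor_hom[OF D2 dm(1)] functor_hom[OF D2 dm(2)]
  note Dsq = functor_square[OF D0 \<psi> \<phi> dm(2,1) sq] functor_square[OF D1 \<psi> \<phi> dm(2,1) sq]
    functor_square[OF D2 \<psi> \<phi> dm(2,1) sq]
  note D\<psi> = functor_hom[OF D0 \<psi>] functor_hom[OF D1 \<psi>] functor_hom[OF D2 \<psi>]
  note D\<phi> = functor_hom[OF D0 \<phi>] functor_hom[OF D1 \<phi>] functor_hom[OF D2 \<phi>]
  have left1: "Compn 3 (amap (D 0) (amap (d 1) m)) (Compn 3 (sigma02 A w) (amap (D 2) \<psi>)) =
      Compn 3 (Compn 3 (sigma02 A w') (amap (D 2) \<phi>)) (amap (D 2) (amap (d 1) m))"
    by (rule paste_squares[OF X3 D\<psi>(3) \<sigma>(2)[OF w] D\<phi>(3) \<sigma>(2)[OF w'] Ddm(6) Ddm(5) Ddm(2)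
          Dsq(3) \<sigma>_nat(2)[symmetric]])
  have left: "Compn 3 (amap (D 0) (amap (d 0) m))
        (Compn 3 (amap (D 0) \<psi>) (Compn 3 (sigma02 A w) (amap (D 2) \<psi>))) =
      Compn 3 (Compn 3 (amap (D 0) \<phi>) (Compn 3 (sigma02 A w') (amap (D 2) \<phi>)))
        (amap (D 2) (amap (d 1) m))"
    by (rule paste_squares[OF X3 category_Comp[OF X3 \<sigma>(2)[OF w] D\<psi>(3)] D\<psi>(1)
          category_Comp[OF X3 \<sigma>(2)[OF w'] D\<phi>(3)] D\<phi>(1) Ddm(6) Ddm(2) Ddm(1) left1 Dsq(1)])
  have right1: "Compn 3 (amap (D 1) (amap (d 0) m)) (Compn 3 (amap (D 1) \<psi>) (sigma12 A w)) =
      Compn 3 (Compn 3 (amap (D 1) \<phi>) (sigma12 A w')) (amap (D 2) (amap (d 1) m))"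
    by (rule paste_squares[OF X3 \<sigma>(3)[OF w] D\<psi>(2) \<sigma>(3)[OF w'] D\<phi>(2) Ddm(6) Ddm(4) Ddm(3)
          \<sigma>_nat(3)[symmetric] Dsq(2)])
  have right: "Compn 3 (amap (D 0) (amap (d 0) m))
        (Compn 3 (sigma01 A w) (Compn 3 (amap (D 1) \<psi>) (sigma12 A w))) =
      Compn 3 (Compn 3 (sigma01 A w') (Compn 3 (amap (D 1) \<phi>) (sigma12 A w')))
        (amap (D 2) (amap (d 1) m))"
    by (rule paste_squares[OF X3 category_Comp[OF X3 D\<psi>(2) \<sigma>(3)[OF w]] \<sigma>(1)[OF w]
          category_Comp[OF X3 D\<phi>(2) \<sigma>(3)[OF w']] \<sigma>(1)[OF w'] Ddm(6) Ddm(3) Ddm(1) right1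
          \<sigma>_nat(1)[symmetric]])
  have D2d1: "is_functor (pf_obj A 1) (pf_obj A 3) (D 2 \<circ>\<^sub>F d 1)" using comp_is_functor[OF d1 D2] .
  have split3: "Compn 3 (amap (D 2) (amap (d 1) m)) (amap (D 2) (amap (d 1) e)) =
      Idt (pf_obj A 3) (omap (D 2) (omap (d 1) w'))"
    using functor_Comp[OF D2d1 m e] functor_Idt[OF D2d1 w'] me by simp
  have assoc_\<phi>: "Compn 3 (amap (D 0) \<phi>) (Compn 3 (sigma02 A w') (amap (D 2) \<phi>)) =
      Compn 3 (sigma01 A w') (Compn 3 (amap (D 1) \<phi>) (sigma12 A w'))"
    by (rule split_epi_cancel[OF X3 Ddm(6) _ split3])
      (use functor_hom[OF D2d1 e] left right assoc_\<psi> in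
        \<open>auto intro!: category_Comp[OF X3] D\<phi> intro: \<sigma>[OF w']\<close>)
  note s = s_functor
  note nn0 = nn_natural[of 0, simplified] and nn1 = nn_natural[of 1, simplified]
  note nn = nat_trans_hom[OF nn0, simplified] nat_trans_hom[OF nn1, simplified]
  have s\<psi>: "amap s \<psi> \<in> hom (pf_obj A 1) (omap s (omap (d 1) w)) (omap s (omap (d 0) w))"
    and s\<phi>: "amap s \<phi> \<in> hom (pf_obj A 1) (omap s (omap (d 1) w')) (omap s (omap (d 0) w'))"
    using functor_hom[OF s] \<psi> \<phi> by auto
  have sd1: "is_functor (pf_obj A 1) (pf_obj A 1) (s \<circ>\<^sub>F d 1)" using comp_is_functor[OF d1 s] .
  have split1: "Compn 1 (amap s (amap (d 1) m)) (amap s (amap (d 1) e)) =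
      Idt (pf_obj A 1) (omap s (omap (d 1) w'))"
    using functor_Comp[OF sd1 m e] functor_Idt[OF sd1 w'] me by simp
  have "Compn 1 m (Compn 1 (nn A 0 w) (amap s \<psi>)) =
      Compn 1 (Compn 1 (nn A 0 w') (amap s \<phi>)) (amap s (amap (d 1) m))"
    by (rule paste_squares[OF X1 s\<psi> nn(1)[OF w] s\<phi> nn(1)[OF w'] functor_hom[OF s dm(2)]
          functor_hom[OF s dm(1)] m functor_square[OF s \<psi> \<phi> dm(2,1) sq]
          nat_trans_natural[OF nn0 m, simplified, symmetric]])
  then have "Compn 1 (Compn 1 (nn A 0 w') (amap s \<phi>)) (amap s (amap (d 1) m)) =
      Compn 1 (nn A 1 w') (amap s (amap (d 1) m))"
    using nat_trans_natural[OF nn1 m] unit_\<psi> by simp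
  then have "Compn 1 (nn A 0 w') (amap s \<phi>) = nn A 1 w'"
    by (rule split_epi_cancel[OF X1 functor_hom[OF s dm(2)] _ split1
          category_Comp[OF X1 nn(1)[OF w'] s\<phi>] nn(2)[OF w'], rotated])
      (use functor_hom[OF sd1 e] in simp)
  then show ?thesis
    using w' \<phi> assoc_\<phi> by (simp add: descent_data_def)
qed

end


section \<open>The comparison functor\<close>

lemma adjunction_rules:
  assumes "adjunction B C F G \<eta> \<epsilon>"
  shows adjunction_right: "is_functor B C G" and adjunction_left: "is_functor C B F"
    and adjunction_unit_hom: "c \<in> Obj C \<Longrightarrow> \<eta> c \<in> hom C c (omap G (omap F c))"
    and adjunction_counit_hom: "b \<in> Obj B \<Longrightarrow> \<epsilon> b \<in> hom B (omap F (omap G b)) b"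
    and adjunction_unit_natural: "m \<in> hom C c c' \<Longrightarrow>
      Comp C (\<eta> c') m = Comp C (amap G (amap F m)) (\<eta> c)"
    and adjunction_counit_natural: "f \<in> hom B b b' \<Longrightarrow>
      Comp B (\<epsilon> b') (amap F (amap G f)) = Comp B f (\<epsilon> b)"
    and adjunction_triangle_right: "b \<in> Obj B \<Longrightarrow>
      Comp C (amap G (\<epsilon> b)) (\<eta> (omap G b)) = Idt C (omap G b)"
    and adjunction_triangle_left: "c \<in> Obj C \<Longrightarrow>
      Comp B (\<epsilon> (omap F c)) (amap F (\<eta> c)) = Idt B (omap F c)"
  using assms nat_trans_hom[of C C id_functor "G \<circ>\<^sub>F F" \<eta>] nat_trans_hom[of B B "F \<circ>\<^sub>F G" id_functor \<epsilon>]
    nat_trans_natural[of C C id_functor "G \<circ>\<^sub>F F" \<eta>] nat_trans_natural[of B B "F \<circ>\<^sub>F G" id_functor \<epsilon>]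
  unfolding adjunction_def by auto

lemma hom_induced_EM:
  "f \<in> hom (induced_EM C F G \<eta> \<epsilon>) x y \<longleftrightarrow> (\<exists>m. f = (x, m, y) \<and>
     x \<in> Obj (induced_EM C F G \<eta> \<epsilon>) \<and> y \<in> Obj (induced_EM C F G \<eta> \<epsilon>) \<and> m \<in> hom C (fst x) (fst y) \<and>
     Comp C m (snd x) = Comp C (snd y) (amap G (amap F m)))"
  by (simp add: induced_EM_def EM_cat_structure hom_structure_cat)

lemma induced_EM_simps [simp]:
  "Idt (induced_EM C F G \<eta> \<epsilon>) x = (x, Idt C (fst x), x)"
  "Comp (induced_EM C F G \<eta> \<epsilon>) (x', n, y') (x, m, y) = (x, Comp C n m, y')"
  by (simp_all add: induced_EM_def EM_cat_structure)

lemma Obj_induced_EM: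
  "(c, a) \<in> Obj (induced_EM C F G \<eta> \<epsilon>) \<longleftrightarrow> c \<in> Obj C \<and> a \<in> hom C (omap G (omap F c)) c \<and>
     Comp C a (\<eta> c) = Idt C c \<and>
     Comp C a (amap G (\<epsilon> (omap F c))) = Comp C a (amap G (amap F a))"
  by (simp add: induced_EM_def EM_cat_structure EM_algebras_def)

lemma omap_comparison: "omap (comparison B G \<epsilon>) b = (omap G b, amap G (\<epsilon> b))"
  by (simp add: comparison_def)

lemma amap_comparison:
  "f \<in> hom B b b' \<Longrightarrow> amap (comparison B G \<epsilon>) f =
     (omap (comparison B G \<epsilon>) b, amap G f, omap (comparison B G \<epsilon>) b')"
  by (auto simp: comparison_def hom_iff)

lemma comparison_functor:
  assumes adj: "adjunction B C F G \<eta> \<epsilon>"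
  shows "is_functor B (induced_EM C F G \<eta> \<epsilon>) (comparison B G \<epsilon>)"
proof -
  note G = adjunction_right[OF adj] and F = adjunction_left[OF adj]
  note \<epsilon> = adjunction_counit_hom[OF adj] and \<eta> = adjunction_unit_hom[OF adj]
  have B: "category B" and C: "category C" using functor_source[OF G] functor_target[OF G] .
  have obj: "omap (comparison B G \<epsilon>) b \<in> Obj (induced_EM C F G \<eta> \<epsilon>)" if b: "b \<in> Obj B" for b
  proof -
    have Gb: "omap G b \<in> Obj C" using functor_obj[OF G b] .
    have Fb: "omap F (omap G b) \<in> Obj B" using functor_obj[OF F Gb] .
    have "Comp C (amap G (\<epsilon> b)) (amap G (\<epsilon> (omap F (omap G b)))) =
        Comp C (amap G (\<epsilon> b)) (amap G (amap F (amap G (\<epsilon> b))))"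
      by (metis functor_Comp[OF G \<epsilon>[OF b] \<epsilon>[OF Fb]] adjunction_counit_natural[OF adj \<epsilon>[OF b]]
          functor_Comp[OF G \<epsilon>[OF b] functor_hom[OF F functor_hom[OF G \<epsilon>[OF b]]]])
    then show ?thesis
      using Gb functor_hom[OF G \<epsilon>[OF b]] adjunction_triangle_right[OF adj b]
      by (simp add: omap_comparison Obj_induced_EM)
  qed
  show ?thesis
  proof (rule functorI[OF B _ obj])
    show "category (induced_EM C F G \<eta> \<epsilon>)"
      unfolding induced_EM_def by (rule category_EM_cat[OF comp_is_functor[OF F G]])
  next
    fix b b' f assume f: "f \<in> hom B b b'"
    have b: "b \<in> Obj B" and b': "b' \<in> Obj B" using category_hom_obj[OF B f] by auto
    have "Comp C (amap G f) (amap G (\<epsilon> b)) = Comp C (amap G (\<epsilon> b')) (amap G (amap F (amap G f)))"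
      using functor_Comp[OF G f \<epsilon>[OF b]] adjunction_counit_natural[OF adj f]
        functor_Comp[OF G \<epsilon>[OF b'] functor_hom[OF F functor_hom[OF G f]]] by simp
    then show "amap (comparison B G \<epsilon>) f \<in>
        hom (induced_EM C F G \<eta> \<epsilon>) (omap (comparison B G \<epsilon>) b) (omap (comparison B G \<epsilon>) b')"
      unfolding hom_induced_EM amap_comparison[OF f]
      using obj[OF b] obj[OF b'] functor_hom[OF G f] by (simp add: omap_comparison)
  next
    fix b assume b: "b \<in> Obj B"
    show "amap (comparison B G \<epsilon>) (Idt B b) =
        Idt (induced_EM C F G \<eta> \<epsilon>) (omap (comparison B G \<epsilon>) b)"
      unfolding amap_comparison[OF category_Idt[OF B b]]
      using functor_Idt[OF G b] by (simp add: omap_comparison)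
  next
    fix x y z f g assume f: "f \<in> hom B x y" and g: "g \<in> hom B y z"
    show "amap (comparison B G \<epsilon>) (Comp B g f) =
        Comp (induced_EM C F G \<eta> \<epsilon>) (amap (comparison B G \<epsilon>) g) (amap (comparison B G \<epsilon>) f)"
      unfolding amap_comparison[OF f] amap_comparison[OF g] amap_comparison[OF category_Comp[OF B g f]]
      using functor_Comp[OF G g f] by simp
  qed
qed


section \<open>Right adjoints that factor through a lax descent category are monadic\<close>

context lax_descent
begin

lemma hom_lax_desc:
  "f \<in> hom (lax_desc A) x y \<longleftrightarrow> (\<exists>m. f = (x, m, y) \<and> x \<in> descent_data A \<and> y \<in> descent_data A \<and>
     m \<in> hom (pf_obj A 1) (fst x) (fst y) \<and>
     Compn 2 (amap (d 0) m) (snd x) = Compn 2 (snd y) (amap (d 1) m))"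
  by (simp add: lax_desc_structure hom_structure_cat)

lemma lax_desc_simps [simp]:
  "Obj (lax_desc A) = descent_data A"
  "Idt (lax_desc A) x = (x, Idt (pf_obj A 1) (fst x), x)"
  "Comp (lax_desc A) (x', n, y') (x, m, y) = (x, Compn 1 n m, y')"
  by (simp_all add: lax_desc_structure)

lemma descent_dataD:
  assumes "(w, \<phi>) \<in> descent_data A"
  shows "w \<in> Obj (pf_obj A 1)" and "\<phi> \<in> hom (pf_obj A 2) (omap (d 1) w) (omap (d 0) w)"
  using assms by (auto simp: descent_data_def)

text \<open>Descent structures have the lifting property of final structures for split epimorphisms: \<open>m\<close> is
  compatible with the structures as soon as \<open>m \<cdot> p\<close> is.\<close>

lemma descent_morphism_along_split_epi:
  assumes \<psi>: "\<psi> \<in> hom (pf_obj A 2) (omap (d 1) w) (omap (d 0) w)"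
    and \<phi>: "\<phi> \<in> hom (pf_obj A 2) (omap (d 1) w') (omap (d 0) w')"
    and \<phi>': "\<phi>' \<in> hom (pf_obj A 2) (omap (d 1) w'') (omap (d 0) w'')"
    and p: "p \<in> hom (pf_obj A 1) w w'" and e: "e \<in> hom (pf_obj A 1) w' w"
    and pe: "Compn 1 p e = Idt (pf_obj A 1) w'"
    and m: "m \<in> hom (pf_obj A 1) w' w''"
    and sq_p: "Compn 2 (amap (d 0) p) \<psi> = Compn 2 \<phi> (amap (d 1) p)"
    and sq_mp: "Compn 2 (amap (d 0) (Compn 1 m p)) \<psi> = Compn 2 \<phi>' (amap (d 1) (Compn 1 m p))"
  shows "Compn 2 (amap (d 0) m) \<phi> = Compn 2 \<phi>' (amap (d 1) m)"
proof (rule split_epi_cancel)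
  note d0 = d_functor[of 0, simplified] and d1 = d_functor[of 1, simplified]
  show X: "category (pf_obj A 2)" using functor_target[OF d0] .
  note d0m = functor_hom[OF d0 m] and d1m = functor_hom[OF d1 m]
    and d0p = functor_hom[OF d0 p] and d1p = functor_hom[OF d1 p]
  have w': "w' \<in> Obj (pf_obj A 1)" using category_hom_obj[OF functor_source[OF d0] p] by simp
  show "amap (d 1) p \<in> hom (pf_obj A 2) (omap (d 1) w) (omap (d 1) w')" by (fact d1p)
  show "amap (d 1) e \<in> hom (pf_obj A 2) (omap (d 1) w') (omap (d 1) w)" by (fact functor_hom[OF d1 e])
  show "Compn 2 (amap (d 1) p) (amap (d 1) e) = Idt (pf_obj A 2) (omap (d 1) w')"
    using functor_Comp[OF d1 p e] functor_Idt[OF d1 w'] pe by simp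
  show "Compn 2 (amap (d 0) m) \<phi> \<in> hom (pf_obj A 2) (omap (d 1) w') (omap (d 0) w'')"
    by (rule category_Comp[OF X d0m \<phi>])
  show "Compn 2 \<phi>' (amap (d 1) m) \<in> hom (pf_obj A 2) (omap (d 1) w') (omap (d 0) w'')"
    by (rule category_Comp[OF X \<phi>' d1m])
  show "Compn 2 (Compn 2 (amap (d 0) m) \<phi>) (amap (d 1) p) = Compn 2 (Compn 2 \<phi>' (amap (d 1) m)) (amap (d 1) p)"
    using sq_mp unfolding functor_Comp[OF d0 m p] functor_Comp[OF d1 m p]
      category_assoc[OF X d0m d0p \<psi>] category_assoc[OF X \<phi>' d1m d1p] category_assoc[OF X d0m \<phi> d1p]
    by (simp only: sq_p)
qed

text \<open>Both halves of the proof use the split epimorphisms \<open>a : T c \<rightarrow> c\<close> given by algebras, the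
  second with an algebra that is not yet known to come from \<open>B\<close>. That such an \<open>a\<close> underlies a
  morphism out of the free object \<open>F c\<close> is arranged by the choice of the structure on \<open>c\<close>.\<close>

theorem comparison_equivalence_if_factors_through_lax_descent:
  assumes adj: "adjunction B (pf_obj A 1) F G \<eta> \<epsilon>"
    and K: "is_equivalence B (lax_desc A) K"
    and factors: "functor_eq B G (forget_desc \<circ>\<^sub>F K)"
  shows "is_equivalence B (induced_EM (pf_obj A 1) F G \<eta> \<epsilon>) (comparison B G \<epsilon>)"
proof (rule fully_faithful_essentially_surjective_equivalence)
  let ?C = "pf_obj A 1" and ?EM = "induced_EM (pf_obj A 1) F G \<eta> \<epsilon>" and ?\<Phi> = "comparison B G \<epsilon>"
  note d0 = d_functor[of 0, simplified] and d1 = d_functor[of 1, simplified]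
  note G = adjunction_right[OF adj] and F = adjunction_left[OF adj]
  note \<epsilon> = adjunction_counit_hom[OF adj] and \<eta> = adjunction_unit_hom[OF adj]
  have B: "category B" and C: "category ?C" using functor_source[OF G] functor_target[OF G] .
  have X: "category (pf_obj A 2)" using functor_target[OF d0] .
  have K_functor: "is_functor B (lax_desc A) K" using K by (simp add: is_equivalence_def)
  note K_ff = equivalence_fully_faithful[OF K]
  show \<Phi>: "is_functor B ?EM ?\<Phi>" by (rule comparison_functor[OF adj])

  define \<phi> where "\<phi> b = snd (omap K b)" for b
  have K_obj: "omap K b = (omap G b, \<phi> b)" if "b \<in> Obj B" for b
    using factors that by (auto simp: functor_eq_def forget_desc_def \<phi>_def split: prod.splits)
  have \<phi>_data: "(omap G b, \<phi> b) \<in> descent_data A" if "b \<in> Obj B" for b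
    using functor_obj[OF K_functor that] K_obj[OF that] by simp
  note \<phi>_hom = descent_dataD(2)[OF \<phi>_data]
  have K_arr: "amap K f = (omap K b, amap G f, omap K b')"
    and \<phi>_square: "Compn 2 (amap (d 0) (amap G f)) (\<phi> b) = Compn 2 (\<phi> b') (amap (d 1) (amap G f))"
    if f: "f \<in> hom B b b'" for f b b'
  proof -
    have b: "b \<in> Obj B" and b': "b' \<in> Obj B" using category_hom_obj[OF B f] by auto
    obtain m where m: "amap K f = (omap K b, m, omap K b')"
      "Compn 2 (amap (d 0) m) (\<phi> b) = Compn 2 (\<phi> b') (amap (d 1) m)"
      using functor_hom[OF K_functor f] unfolding hom_lax_desc \<phi>_def by blast
    have "f \<in> Arr B" using f by (simp add: hom_iff)
    then have "amap G f = m"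
      using factors m(1) by (auto simp: functor_eq_def forget_desc_def)
    then show "amap K f = (omap K b, amap G f, omap K b')"
      and "Compn 2 (amap (d 0) (amap G f)) (\<phi> b) = Compn 2 (\<phi> b') (amap (d 1) (amap G f))"
      using m by auto
  qed
  have descent_full: "\<exists>f \<in> hom B b b'. amap G f = m"
    if b: "b \<in> Obj B" and b': "b' \<in> Obj B" and m: "m \<in> hom ?C (omap G b) (omap G b')"
      and sq: "Compn 2 (amap (d 0) m) (\<phi> b) = Compn 2 (\<phi> b') (amap (d 1) m)" for b b' m
  proof -
    have "(omap K b, m, omap K b') \<in> hom (lax_desc A) (omap K b) (omap K b')"
      unfolding hom_lax_desc using K_obj[OF b] K_obj[OF b'] \<phi>_data[OF b] \<phi>_data[OF b'] m sq by simp
    then obtain f where "f \<in> hom B b b'" "amap K f = (omap K b, m, omap K b')"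
      using fully_faithful_surj[OF K_ff b b'] by blast
    then show ?thesis using K_arr by auto
  qed

  show "fully_faithful B ?EM ?\<Phi>"
  proof (rule fully_faithfulI[OF \<Phi>])
    fix b b' f g assume b: "b \<in> Obj B" and b': "b' \<in> Obj B"
      and f: "f \<in> hom B b b'" and g: "g \<in> hom B b b'" and eq: "amap ?\<Phi> f = amap ?\<Phi> g"
    have "amap G f = amap G g" using eq by (simp add: amap_comparison[OF f] amap_comparison[OF g])
    then show "f = g"
      using fully_faithful_inj[OF K_ff b b' f g] K_arr[OF f] K_arr[OF g] by simp
  next
    fix b b' h assume b: "b \<in> Obj B" and b': "b' \<in> Obj B"
      and "h \<in> hom ?EM (omap ?\<Phi> b) (omap ?\<Phi> b')"
    then obtain m where h: "h = (omap ?\<Phi> b, m, omap ?\<Phi> b')"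
      and m: "m \<in> hom ?C (omap G b) (omap G b')"
      and alg: "Comp ?C m (amap G (\<epsilon> b)) = Comp ?C (amap G (\<epsilon> b')) (amap G (amap F m))"
      unfolding hom_induced_EM by (auto simp: omap_comparison)
    have Gb: "omap G b \<in> Obj ?C" using functor_obj[OF G b] .
    have FGb: "omap F (omap G b) \<in> Obj B" using functor_obj[OF F Gb] .
    \<comment> \<open>As \<open>m\<close> is a morphism of algebras, \<open>m \<cdot> G \<epsilon>\<^sub>b\<close> lies in the image of \<open>G\<close>.\<close>
    have mp: "Comp ?C m (amap G (\<epsilon> b)) = amap G (Comp B (\<epsilon> b') (amap F m))"
      using alg functor_Comp[OF G \<epsilon>[OF b'] functor_hom[OF F m]] by simp
    have "Compn 2 (amap (d 0) m) (\<phi> b) = Compn 2 (\<phi> b') (amap (d 1) m)"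
    proof (rule descent_morphism_along_split_epi[OF \<phi>_hom[OF FGb] \<phi>_hom[OF b] \<phi>_hom[OF b']
          functor_hom[OF G \<epsilon>[OF b]] \<eta>[OF Gb] adjunction_triangle_right[OF adj b] m \<phi>_square[OF \<epsilon>[OF b]]])
      show "Compn 2 (amap (d 0) (Comp ?C m (amap G (\<epsilon> b)))) (\<phi> (omap F (omap G b))) =
          Compn 2 (\<phi> b') (amap (d 1) (Comp ?C m (amap G (\<epsilon> b))))"
        unfolding mp by (rule \<phi>_square[OF category_Comp[OF B \<epsilon>[OF b'] functor_hom[OF F m]]])
    qed
    then obtain f where "f \<in> hom B b b'" "amap G f = m"
      using descent_full[OF b b' m] by blast
    then show "\<exists>f \<in> hom B b b'. amap ?\<Phi> f = h"
      using amap_comparison h by metis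
  qed

  show "essentially_surjective B ?EM ?\<Phi>"
    unfolding essentially_surjective_def
  proof
    fix x assume x: "x \<in> Obj ?EM"
    obtain c a where x_eq: "x = (c, a)" by (cases x)
    have c: "c \<in> Obj ?C" and a: "a \<in> hom ?C (omap G (omap F c)) c"
      and a_unit: "Comp ?C a (\<eta> c) = Idt ?C c"
      and a_assoc: "Comp ?C a (amap G (\<epsilon> (omap F c))) = Comp ?C a (amap G (amap F a))"
      using x by (auto simp: x_eq Obj_induced_EM)
    define T where "T c = omap G (omap F c)" for c
    note a = a[folded T_def]
    have Fc: "omap F c \<in> Obj B" using functor_obj[OF F c] .
    have Tc: "T c \<in> Obj ?C" using functor_obj[OF G Fc] by (simp add: T_def)
    have FTc: "omap F (T c) \<in> Obj B" using functor_obj[OF F Tc] .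
    have \<eta>c: "\<eta> c \<in> hom ?C c (T c)" and \<eta>T: "\<eta> (T c) \<in> hom ?C (T c) (T (T c))"
      using \<eta>[OF c] \<eta>[OF Tc] by (simp_all add: T_def)
    have Ta: "amap G (amap F a) \<in> hom ?C (T (T c)) (T c)"
      using functor_hom[OF G functor_hom[OF F a]] by (simp add: T_def)
    have \<mu>: "amap G (\<epsilon> (omap F c)) \<in> hom ?C (T (T c)) (T c)"
      using functor_hom[OF G \<epsilon>[OF Fc]] by (simp add: T_def)
    define \<psi> where "\<psi> = \<phi> (omap F c)"
    define \<psi>' where "\<psi>' = \<phi> (omap F (T c))"
    have \<psi>: "\<psi> \<in> hom (pf_obj A 2) (omap (d 1) (T c)) (omap (d 0) (T c))"
      using \<phi>_hom[OF Fc] by (simp add: \<psi>_def T_def)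
    have \<psi>': "\<psi>' \<in> hom (pf_obj A 2) (omap (d 1) (T (T c))) (omap (d 0) (T (T c)))"
      using \<phi>_hom[OF FTc] by (simp add: \<psi>'_def T_def)
    have Ta_sq: "Compn 2 (amap (d 0) (amap G (amap F a))) \<psi>' = Compn 2 \<psi> (amap (d 1) (amap G (amap F a)))"
      using \<phi>_square[OF functor_hom[OF F a]] by (simp add: \<psi>_def \<psi>'_def)
    have \<mu>_sq: "Compn 2 (amap (d 0) (amap G (\<epsilon> (omap F c)))) \<psi>' =
        Compn 2 \<psi> (amap (d 1) (amap G (\<epsilon> (omap F c))))"
      using \<phi>_square[OF \<epsilon>[OF Fc]] by (simp add: \<psi>_def \<psi>'_def T_def)
    \<comment> \<open>Compatibility of \<open>a\<close> with \<open>\<psi>\<close> and \<open>\<chi>\<close> forces this value of \<open>\<chi>\<close>, as \<open>\<eta>\<^sub>c\<close> is a section of \<open>a\<close>.\<close>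
    define \<chi> where "\<chi> = Compn 2 (amap (d 0) a) (Compn 2 \<psi> (amap (d 1) (\<eta> c)))"
    note d0a = functor_hom[OF d0 a] and d1a = functor_hom[OF d1 a]
      and d0Ta = functor_hom[OF d0 Ta] and d1Ta = functor_hom[OF d1 Ta]
      and d0\<mu> = functor_hom[OF d0 \<mu>] and d1\<mu> = functor_hom[OF d1 \<mu>]
      and d1\<eta>c = functor_hom[OF d1 \<eta>c] and d1\<eta>T = functor_hom[OF d1 \<eta>T]
    have \<chi>: "\<chi> \<in> hom (pf_obj A 2) (omap (d 1) c) (omap (d 0) c)"
      unfolding \<chi>_def by (rule category_Comp[OF X d0a category_Comp[OF X \<psi> d1\<eta>c]])
    have a_sq: "Compn 2 (amap (d 0) a) \<psi> = Compn 2 \<chi> (amap (d 1) a)"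
    proof -
      have "Compn 2 \<chi> (amap (d 1) a) =
          Compn 2 (amap (d 0) a) (Compn 2 \<psi> (Compn 2 (amap (d 1) (\<eta> c)) (amap (d 1) a)))"
        unfolding \<chi>_def category_assoc[OF X d0a category_Comp[OF X \<psi> d1\<eta>c] d1a]
          category_assoc[OF X \<psi> d1\<eta>c d1a] ..
      also have "Compn 2 (amap (d 1) (\<eta> c)) (amap (d 1) a) =
          Compn 2 (amap (d 1) (amap G (amap F a))) (amap (d 1) (\<eta> (T c)))"
        using functor_square[OF d1 a Ta \<eta>T \<eta>c] adjunction_unit_natural[OF adj a] by simp
      also have "Compn 2 \<psi> \<dots> = Compn 2 (amap (d 0) (amap G (amap F a))) (Compn 2 \<psi>' (amap (d 1) (\<eta> (T c))))"
        unfolding category_assoc[OF X \<psi> d1Ta d1\<eta>T, symmetric] Ta_sq[symmetric]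
          category_assoc[OF X d0Ta \<psi>' d1\<eta>T] ..
      also have "Compn 2 (amap (d 0) a) \<dots> = Compn 2 (amap (d 0) a)
          (Compn 2 (amap (d 0) (amap G (\<epsilon> (omap F c)))) (Compn 2 \<psi>' (amap (d 1) (\<eta> (T c)))))"
        unfolding category_assoc[OF X d0a d0Ta category_Comp[OF X \<psi>' d1\<eta>T], symmetric]
          category_assoc[OF X d0a d0\<mu> category_Comp[OF X \<psi>' d1\<eta>T], symmetric]
          functor_Comp[OF d0 a Ta, symmetric] functor_Comp[OF d0 a \<mu>, symmetric] a_assoc ..
      also have "Compn 2 (amap (d 0) (amap G (\<epsilon> (omap F c)))) (Compn 2 \<psi>' (amap (d 1) (\<eta> (T c)))) = \<psi>"
        unfolding category_assoc[OF X d0\<mu> \<psi>' d1\<eta>T, symmetric] \<mu>_sq category_assoc[OF X \<psi> d1\<mu> d1\<eta>T]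
          functor_Comp[OF d1 \<mu> \<eta>T, symmetric]
        using adjunction_triangle_right[OF adj Fc] functor_Idt[OF d1 Tc] category_right_unit[OF X \<psi>]
        by (simp add: T_def)
      finally show ?thesis ..
    qed
    have data: "(c, \<chi>) \<in> descent_data A"
      using descent_along_split_epi[OF _ a \<eta>c a_unit \<chi> a_sq] \<phi>_data[OF Fc] by (simp add: \<psi>_def T_def)
    obtain b k where b: "b \<in> Obj B" and k: "k \<in> hom (lax_desc A) (omap K b) (c, \<chi>)" "is_iso (lax_desc A) k"
      using equivalence_essentially_surjective[OF K] data unfolding essentially_surjective_def by auto
    obtain k' where k': "k' \<in> hom (lax_desc A) (c, \<chi>) (omap K b)"
      "Comp (lax_desc A) k' k = Idt (lax_desc A) (omap K b)"
      "Comp (lax_desc A) k k' = Idt (lax_desc A) (c, \<chi>)"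
      using is_isoE[OF k(2,1)] by blast
    obtain j where j: "k = (omap K b, j, (c, \<chi>))" "j \<in> hom ?C (omap G b) c"
      using k(1) K_obj[OF b] unfolding hom_lax_desc by auto
    obtain i where i: "k' = ((c, \<chi>), i, omap K b)" "i \<in> hom ?C c (omap G b)"
      and i_sq: "Compn 2 (amap (d 0) i) \<chi> = Compn 2 (\<phi> b) (amap (d 1) i)"
      using k'(1) K_obj[OF b] unfolding hom_lax_desc by auto
    have ij: "Comp ?C i j = Idt ?C (omap G b)" and ji: "Comp ?C j i = Idt ?C c"
      using k'(2,3) K_obj[OF b] by (auto simp: i(1) j(1))
    have ia: "Comp ?C i a \<in> hom ?C (T c) (omap G b)" using category_Comp[OF C i(2) a] .
    have "Compn 2 (amap (d 0) (Comp ?C i a)) \<psi> = Compn 2 (\<phi> b) (amap (d 1) (Comp ?C i a))"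
      unfolding functor_Comp[OF d0 i(2) a] functor_Comp[OF d1 i(2) a]
      by (rule paste_squares[OF X d1a functor_hom[OF d1 i(2)] d0a functor_hom[OF d0 i(2)] \<psi> \<chi>
            \<phi>_hom[OF b] a_sq[symmetric] i_sq[symmetric], symmetric])
    then obtain f where f: "f \<in> hom B (omap F c) b" "amap G f = Comp ?C i a"
      using descent_full[OF Fc b, of "Comp ?C i a"] ia by (auto simp: \<psi>_def T_def)
    have Gf: "amap G f \<in> hom ?C (T c) (omap G b)" using ia f(2) by simp
    have i_eq: "Comp ?C (amap G f) (\<eta> c) = i"
      unfolding f(2) category_assoc[OF C i(2) a \<eta>c] a_unit by (rule category_right_unit[OF C i(2)])
    \<comment> \<open>Both sides have the same transpose \<open>i\<close>. Applying \<open>G\<close> gives that \<open>i\<close> is a morphism of algebras.\<close>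
    have "Comp B (\<epsilon> b) (amap F i) = f"
    proof -
      have FGf: "amap F (amap G f) \<in> hom B (omap F (T c)) (omap F (omap G b))"
        and F\<eta>: "amap F (\<eta> c) \<in> hom B (omap F c) (omap F (T c))"
        and \<epsilon>F: "\<epsilon> (omap F c) \<in> hom B (omap F (T c)) (omap F c)"
        using functor_hom[OF F Gf] functor_hom[OF F \<eta>c] \<epsilon>[OF Fc] by (simp_all add: T_def)
      have "Comp B (\<epsilon> b) (amap F i) = Comp B (\<epsilon> b) (Comp B (amap F (amap G f)) (amap F (\<eta> c)))"
        using functor_Comp[OF F Gf \<eta>c] i_eq by simp
      also have "\<dots> = Comp B f (Comp B (\<epsilon> (omap F c)) (amap F (\<eta> c)))"
        unfolding category_assoc[OF B \<epsilon>[OF b] FGf F\<eta>, symmetric] adjunction_counit_natural[OF adj f(1)]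
          category_assoc[OF B f(1) \<epsilon>F F\<eta>] ..
      also have "\<dots> = f"
        using adjunction_triangle_left[OF adj c] category_right_unit[OF B f(1)] by simp
      finally show ?thesis .
    qed
    then have i_alg: "Comp ?C i a = Comp ?C (amap G (\<epsilon> b)) (amap G (amap F i))"
      using functor_Comp[OF G \<epsilon>[OF b] functor_hom[OF F i(2)]] f(2) by simp
    note GF = comp_is_functor[OF F G]
    have GFi: "amap G (amap F i) \<in> hom ?C (T c) (T (omap G b))"
      and GFj: "amap G (amap F j) \<in> hom ?C (T (omap G b)) (T c)"
      and p: "amap G (\<epsilon> b) \<in> hom ?C (T (omap G b)) (omap G b)"
      using functor_hom[OF GF i(2)] functor_hom[OF GF j(2)] functor_hom[OF G \<epsilon>[OF b]]
      by (simp_all add: T_def)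
    have GFij: "Comp ?C (amap G (amap F i)) (amap G (amap F j)) = Idt ?C (T (omap G b))"
      using functor_Comp[OF GF i(2) j(2)] functor_Idt[OF GF functor_obj[OF G b]] ij
      by (simp add: T_def)
    have j_alg: "Comp ?C j (amap G (\<epsilon> b)) = Comp ?C a (amap G (amap F j))"
      by (rule inverse_square[OF C GFi GFj GFij i(2) j(2) ji a p i_alg])
    have \<Phi>b: "omap ?\<Phi> b \<in> Obj ?EM" using functor_obj[OF \<Phi> b] .
    have j_hom: "(omap ?\<Phi> b, j, x) \<in> hom ?EM (omap ?\<Phi> b) x"
      unfolding hom_induced_EM using \<Phi>b x j(2) j_alg by (simp add: omap_comparison x_eq)
    have i_hom: "(x, i, omap ?\<Phi> b) \<in> hom ?EM x (omap ?\<Phi> b)"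
      unfolding hom_induced_EM using \<Phi>b x i(2) i_alg by (simp add: omap_comparison x_eq)
    have "is_iso ?EM (omap ?\<Phi> b, j, x)"
      by (rule is_isoI[OF j_hom i_hom]) (simp_all add: ij ji omap_comparison x_eq)
    then show "\<exists>b \<in> Obj B. \<exists>k \<in> hom ?EM (omap ?\<Phi> b) x. is_iso ?EM k"
      using b j_hom by blast
  qed
qed

end


section \<open>Strict diagrams of categories\<close>

definition strict_diagram ::
  "('x, 'y) cat \<Rightarrow> ('x \<Rightarrow> ('o, 'a) cat) \<Rightarrow> ('y \<Rightarrow> ('o, 'a, 'o, 'a) fctr) \<Rightarrow> bool" where
  "strict_diagram X \<C> F \<longleftrightarrow> category X \<and> (\<forall>x \<in> Obj X. category (\<C> x)) \<and>
     (\<forall>f \<in> Arr X. is_functor (\<C> (Dom X f)) (\<C> (Cod X f)) (F f)) \<and>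
     (\<forall>x \<in> Obj X. functor_eq (\<C> x) (F (Idt X x)) id_functor) \<and>
     (\<forall>f \<in> Arr X. \<forall>g \<in> Arr X. Dom X g = Cod X f \<longrightarrow>
        functor_eq (\<C> (Dom X f)) (F g \<circ>\<^sub>F F f) (F (Comp X g f)))"

lemma strict_diagramI:
  assumes "category X" "\<And>x. x \<in> Obj X \<Longrightarrow> category (\<C> x)"
    and "\<And>x y f. f \<in> hom X x y \<Longrightarrow> is_functor (\<C> x) (\<C> y) (F f)"
    and "\<And>x. x \<in> Obj X \<Longrightarrow> functor_eq (\<C> x) (F (Idt X x)) id_functor"
    and "\<And>x y z f g. f \<in> hom X x y \<Longrightarrow> g \<in> hom X y z \<Longrightarrow>
      functor_eq (\<C> x) (F g \<circ>\<^sub>F F f) (F (Comp X g f))"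
  shows "strict_diagram X \<C> F"
  unfolding strict_diagram_def using assms by (simp add: hom_iff)

lemma strict_diagram_rules:
  assumes "strict_diagram X \<C> F"
  shows strict_diagram_shape: "category X"
    and strict_diagram_category: "x \<in> Obj X \<Longrightarrow> category (\<C> x)"
    and strict_diagram_functor: "f \<in> hom X x y \<Longrightarrow> is_functor (\<C> x) (\<C> y) (F f)"
    and strict_diagram_Idt: "x \<in> Obj X \<Longrightarrow> functor_eq (\<C> x) (F (Idt X x)) id_functor"
    and strict_diagram_Comp: "f \<in> hom X x y \<Longrightarrow> g \<in> hom X y z \<Longrightarrow>
      functor_eq (\<C> x) (F g \<circ>\<^sub>F F f) (F (Comp X g f))"
  using assms unfolding strict_diagram_def hom_iff by blast+

text \<open>The components of the comparison transformations are identities, written at the object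
  \<open>F h (F g c)\<close>, which equals \<open>F (h g) c\<close>.\<close>

definition strict_pseudo ::
  "('x, 'y) cat \<Rightarrow> ('x \<Rightarrow> ('u, 'u) cat) \<Rightarrow> ('y \<Rightarrow> ('u, 'u, 'u, 'u) fctr) \<Rightarrow> ('x, 'y, 'u) pseudo" where
  "strict_pseudo X \<C> F =
     \<lparr>pf_obj = \<C>, pf_arr = F,
      pf_comp = (\<lambda>h g c. Idt (\<C> (Cod X h)) (omap (F h) (omap (F g) c))),
      pf_unit = (\<lambda>x c. Idt (\<C> x) c)\<rparr>"

lemma strict_pseudo_simps [simp]:
  "pf_obj (strict_pseudo X \<C> F) = \<C>"
  "pf_arr (strict_pseudo X \<C> F) = F"
  "pf_comp (strict_pseudo X \<C> F) h g c = Idt (\<C> (Cod X h)) (omap (F h) (omap (F g) c))"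
  "pf_unit (strict_pseudo X \<C> F) x c = Idt (\<C> x) c"
  by (simp_all add: strict_pseudo_def)

lemma functor_eq_rules:
  assumes "functor_eq C F G"
  shows functor_eq_obj: "x \<in> Obj C \<Longrightarrow> omap F x = omap G x"
    and functor_eq_hom: "f \<in> hom C x y \<Longrightarrow> amap F f = amap G f"
  using assms by (auto simp: functor_eq_def hom_iff)

lemma functor_eqI:
  assumes "\<And>x. x \<in> Obj C \<Longrightarrow> omap F x = omap G x" "\<And>f x y. f \<in> hom C x y \<Longrightarrow> amap F f = amap G f"
  shows "functor_eq C F G"
  using assms by (simp add: functor_eq_def hom_iff)

lemma Comp_Idt_Idt: "category C \<Longrightarrow> x \<in> Obj C \<Longrightarrow> Comp C (Idt C x) (Idt C x) = Idt C x"
  by (rule category_left_unit[OF _ category_Idt])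

lemma is_iso_Idt: "category C \<Longrightarrow> x \<in> Obj C \<Longrightarrow> is_iso C (Idt C x)"
  by (rule is_isoI[OF category_Idt category_Idt Comp_Idt_Idt Comp_Idt_Idt])

lemma nat_iso_of_functor_eq:
  assumes F: "is_functor C D F" and G: "is_functor C D G" and eq: "functor_eq C F G"
  shows "nat_iso C D F G (\<lambda>x. Idt D (omap F x))"
  unfolding nat_iso_def
proof (intro conjI nat_transI[OF F G] ballI)
  fix x assume x: "x \<in> Obj C"
  then show "Idt D (omap F x) \<in> hom D (omap F x) (omap G x)"
    using category_Idt[OF functor_target[OF F] functor_obj[OF F x]] functor_eq_obj[OF eq x] by simp
  show "is_iso D (Idt D (omap F x))"
    using is_iso_Idt[OF functor_target[OF F] functor_obj[OF F x]] .
next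
  fix x y f assume f: "f \<in> hom C x y"
  note Ff = functor_hom[OF F f]
  show "Comp D (Idt D (omap F y)) (amap F f) = Comp D (amap G f) (Idt D (omap F x))"
    using category_left_unit[OF functor_target[OF F] Ff] category_right_unit[OF functor_target[OF F] Ff]
      functor_eq_hom[OF eq f] by simp
qed

lemma pseudofunctor_strict_pseudo:
  assumes F: "strict_diagram X \<C> F" and U: "\<And>x. x \<in> Obj X \<Longrightarrow> in_Cat U (\<C> x)"
  shows "pseudofunctor U X (strict_pseudo X \<C> F)"
proof -
  have X: "category X" using strict_diagram_shape[OF F] .
  note F_functor = strict_diagram_functor[OF F]
  note F_id = strict_diagram_Idt[OF F] and F_comp = strict_diagram_Comp[OF F]
  have arr: "f \<in> hom X (Dom X f) (Cod X f)" if "f \<in> Arr X" for f using that by (simp add: hom_iff)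
  show ?thesis
    unfolding pseudofunctor_def
  proof (intro conjI ballI impI)
    show "category X" by fact
  next
    fix x assume x: "x \<in> Obj X"
    show "in_Cat U (pf_obj (strict_pseudo X \<C> F) x)" using U[OF x] by simp
  next
    fix f assume f: "f \<in> Arr X"
    show "is_functor (pf_obj (strict_pseudo X \<C> F) (Dom X f)) (pf_obj (strict_pseudo X \<C> F) (Cod X f))
        (pf_arr (strict_pseudo X \<C> F) f)"
      using F_functor[OF arr[OF f]] by simp
  next
    fix g h assume "g \<in> Arr X" "h \<in> Arr X" "Dom X h = Cod X g"
    then have g: "g \<in> hom X (Dom X g) (Cod X g)" and h: "h \<in> hom X (Cod X g) (Cod X h)"
      by (simp_all add: hom_iff)
    show "nat_iso (pf_obj (strict_pseudo X \<C> F) (Dom X g)) (pf_obj (strict_pseudo X \<C> F) (Cod X h))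
        (pf_arr (strict_pseudo X \<C> F) h \<circ>\<^sub>F pf_arr (strict_pseudo X \<C> F) g)
        (pf_arr (strict_pseudo X \<C> F) (Comp X h g)) (pf_comp (strict_pseudo X \<C> F) h g)"
      using nat_iso_of_functor_eq[OF comp_is_functor[OF F_functor[OF g] F_functor[OF h]]
          F_functor[OF category_Comp[OF X h g]] F_comp[OF g h]]
      by (simp add: strict_pseudo_def)
  next
    fix x assume x: "x \<in> Obj X"
    have "functor_eq (\<C> x) id_functor (F (Idt X x))"
      using F_id[OF x] by (simp add: functor_eq_def)
    then show "nat_iso (pf_obj (strict_pseudo X \<C> F) x) (pf_obj (strict_pseudo X \<C> F) x) id_functor
        (pf_arr (strict_pseudo X \<C> F) (Idt X x)) (pf_unit (strict_pseudo X \<C> F) x)"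
      using nat_iso_of_functor_eq[OF id_is_functor[OF strict_diagram_category[OF F x]]
          F_functor[OF category_Idt[OF X x]]]
      by (simp add: strict_pseudo_def)
  next
    fix f g h c assume "f \<in> Arr X" "g \<in> Arr X" "h \<in> Arr X" "Dom X g = Cod X f" "Dom X h = Cod X g"
    then have f: "f \<in> hom X (Dom X f) (Cod X f)" and g: "g \<in> hom X (Cod X f) (Cod X g)"
      and h: "h \<in> hom X (Cod X g) (Cod X h)" by (simp_all add: hom_iff)
    assume "c \<in> Obj (pf_obj (strict_pseudo X \<C> F) (Dom X f))"
    then have c: "c \<in> Obj (\<C> (Dom X f))" by simp
    have fc: "omap (F f) c \<in> Obj (\<C> (Cod X f))" using functor_obj[OF F_functor[OF f] c] .
    have gfc: "omap (F g) (omap (F f) c) \<in> Obj (\<C> (Cod X g))" using functor_obj[OF F_functor[OF g] fc] .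
    have hgfc: "omap (F h) (omap (F g) (omap (F f) c)) \<in> Obj (\<C> (Cod X h))"
      using functor_obj[OF F_functor[OF h] gfc] .
    have cod: "Cod X (Comp X h g) = Cod X h" using category_Comp[OF X h g] by (simp add: hom_iff)
    show "Comp (pf_obj (strict_pseudo X \<C> F) (Cod X h)) (pf_comp (strict_pseudo X \<C> F) h (Comp X g f) c)
        (amap (pf_arr (strict_pseudo X \<C> F) h) (pf_comp (strict_pseudo X \<C> F) g f c)) =
        Comp (pf_obj (strict_pseudo X \<C> F) (Cod X h)) (pf_comp (strict_pseudo X \<C> F) (Comp X h g) f c)
        (pf_comp (strict_pseudo X \<C> F) h g (omap (pf_arr (strict_pseudo X \<C> F) f) c))"
      using functor_Idt[OF F_functor[OF h] gfc] functor_eq_obj[OF F_comp[OF f g] c]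
        functor_eq_obj[OF F_comp[OF g h] fc] cod by simp
  next
    fix f c assume "f \<in> Arr X" and "c \<in> Obj (pf_obj (strict_pseudo X \<C> F) (Dom X f))"
    then have f: "f \<in> hom X (Dom X f) (Cod X f)" and c: "c \<in> Obj (\<C> (Dom X f))"
      by (simp_all add: hom_iff)
    have fc: "omap (F f) c \<in> Obj (\<C> (Cod X f))" using functor_obj[OF F_functor[OF f] c] .
    have x: "Dom X f \<in> Obj X" and y: "Cod X f \<in> Obj X" using category_hom_obj[OF X f] by auto
    have cod: "Cod X (Idt X (Cod X f)) = Cod X f" using category_Idt[OF X y] by (simp add: hom_iff)
    note id = Comp_Idt_Idt[OF strict_diagram_category[OF F y] fc]
    show "Comp (pf_obj (strict_pseudo X \<C> F) (Cod X f))
        (pf_comp (strict_pseudo X \<C> F) (Idt X (Cod X f)) f c)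
        (pf_unit (strict_pseudo X \<C> F) (Cod X f) (omap (pf_arr (strict_pseudo X \<C> F) f) c)) =
        Idt (pf_obj (strict_pseudo X \<C> F) (Cod X f)) (omap (pf_arr (strict_pseudo X \<C> F) f) c)"
      using functor_eq_obj[OF F_id[OF y] fc] cod id by simp
    show "Comp (pf_obj (strict_pseudo X \<C> F) (Cod X f))
        (pf_comp (strict_pseudo X \<C> F) f (Idt X (Dom X f)) c)
        (amap (pf_arr (strict_pseudo X \<C> F) f) (pf_unit (strict_pseudo X \<C> F) (Dom X f) c)) =
        Idt (pf_obj (strict_pseudo X \<C> F) (Cod X f)) (omap (pf_arr (strict_pseudo X \<C> F) f) c)"
      using functor_eq_obj[OF F_id[OF x] c] functor_Idt[OF F_functor[OF f] c] id by simp
  qed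
qed

text \<open>For a strict diagram all the transformations \<open>\<sigma>\<close> and \<open>\<nn>\<close> are identities and drop out
  of the two conditions.\<close>

lemma descent_data_strict:
  assumes F: "strict_diagram delta3 \<C> F"
  shows "(w, \<phi>) \<in> descent_data (strict_pseudo delta3 \<C> F) \<longleftrightarrow> w \<in> Obj (\<C> 1) \<and>
    \<phi> \<in> hom (\<C> 2) (omap (F (d_map 1)) w) (omap (F (d_map 0)) w) \<and>
    Comp (\<C> 3) (amap (F (D_map 0)) \<phi>) (amap (F (D_map 2)) \<phi>) = amap (F (D_map 1)) \<phi> \<and>
    amap (F s_map) \<phi> = Idt (\<C> 1) w"
proof (cases "w \<in> Obj (\<C> 1) \<and> \<phi> \<in> hom (\<C> 2) (omap (F (d_map 1)) w) (omap (F (d_map 0)) w)")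
  case True
  then have w: "w \<in> Obj (\<C> 1)"
    and \<phi>: "\<phi> \<in> hom (\<C> 2) (omap (F (d_map 1)) w) (omap (F (d_map 0)) w)" by auto
  note gen = delta3_generator_hom
  have d: "is_functor (\<C> 1) (\<C> 2) (F (d_map i))" if "i \<in> {0, 1}" for i
    using strict_diagram_functor[OF F gen(1)[OF that]] .
  have D: "is_functor (\<C> 2) (\<C> 3) (F (D_map i))" if "i \<in> {0, 1, 2}" for i
    using strict_diagram_functor[OF F gen(2)[OF that]] .
  have s: "is_functor (\<C> 2) (\<C> 1) (F s_map)" using strict_diagram_functor[OF F gen(3)] .
  have Dd: "omap (F (D_map j)) (omap (F (d_map i)) w) = omap (F (Comp delta3 (D_map j) (d_map i))) w"
    if "i \<in> {0, 1}" "j \<in> {0, 1, 2}" for i j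
    using functor_eq_obj[OF strict_diagram_Comp[OF F gen(1)[OF that(1)] gen(2)[OF that(2)]] w] by simp
  have relations: "omap (F (D_map t)) (omap (F (d_map k)) w) = omap (F (D_map k)) (omap (F (d_map (t - 1))) w)"
    if "k < t" "t \<le> 2" for k t
  proof -
    have "k \<in> {0, 1}" "t \<in> {0, 1, 2}" "k \<in> {0, 1, 2}" "t - 1 \<in> {0, 1}" using that by auto
    then show ?thesis using Dd delta3_relations(3)[OF that] by metis
  qed
  note rel = relations[of 0 1, simplified] relations[of 0 2, simplified, folded One_nat_def]
    relations[of 1 2, simplified, folded One_nat_def]
  have sd: "omap (F s_map) (omap (F (d_map i)) w) = w" if i: "i \<in> {0, 1}" for i
  proof -
    have "Comp delta3 s_map (d_map i) = Idt delta3 1" using i delta3_relations(1,2) by auto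
    then have "omap (F s_map) (omap (F (d_map i)) w) = omap (F (Idt delta3 1)) w"
      using functor_eq_obj[OF strict_diagram_Comp[OF F gen(1)[OF i] gen(3)] w] by simp
    then show ?thesis using functor_eq_obj[OF strict_diagram_Idt[OF F, of 1] w] by simp
  qed
  have C1: "category (\<C> 1)" and C3: "category (\<C> 3)"
    using functor_target[OF s] functor_target[OF D[of 0]] by auto
  have cod: "Cod fin_ord (D_map i) = 3" if "i \<in> {0, 1, 2}" for i
    using gen(2)[OF that] by (simp add: hom_iff)
  have cod_s: "Cod fin_ord s_map = 1" using gen(3) by (simp add: hom_iff)
  have obj: "omap (F (D_map j)) (omap (F (d_map i)) w) \<in> Obj (\<C> 3)"
    if "i \<in> {0, 1}" "j \<in> {0, 1, 2}" for i j
    using functor_obj[OF D[OF that(2)] functor_obj[OF d[OF that(1)] w]] .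
  have sigma: "sigma01 (strict_pseudo delta3 \<C> F) w = Idt (\<C> 3) (omap (F (D_map 0)) (omap (F (d_map 0)) w))"
    "sigma02 (strict_pseudo delta3 \<C> F) w = Idt (\<C> 3) (omap (F (D_map 0)) (omap (F (d_map 1)) w))"
    "sigma12 (strict_pseudo delta3 \<C> F) w = Idt (\<C> 3) (omap (F (D_map 1)) (omap (F (d_map 1)) w))"
    using cod rel obj[of 0 0] obj[of 1 0] obj[of 1 1]
    by (simp_all add: sigma01_def sigma02_def sigma12_def inv_arr_Idt[OF C3] Comp_Idt_Idt[OF C3])
  have nn: "nn (strict_pseudo delta3 \<C> F) i w = Idt (\<C> 1) w" if "i \<in> {0, 1}" for i
    using cod_s sd[OF that] by (simp add: nn_def inv_arr_Idt[OF C1 w] Comp_Idt_Idt[OF C1 w])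
  have D\<phi>: "amap (F (D_map i)) \<phi> \<in> hom (\<C> 3) (omap (F (D_map i)) (omap (F (d_map 1)) w))
      (omap (F (D_map i)) (omap (F (d_map 0)) w))" if "i \<in> {0, 1, 2}" for i
    using functor_hom[OF D[OF that] \<phi>] .
  have s\<phi>: "amap (F s_map) \<phi> \<in> hom (\<C> 1) w w" using functor_hom[OF s \<phi>] sd by simp
  have "Comp (\<C> 3) (sigma02 (strict_pseudo delta3 \<C> F) w) (amap (F (D_map 2)) \<phi>) = amap (F (D_map 2)) \<phi>"
    using category_left_unit[OF C3 D\<phi>[of 2]] rel sigma by simp
  moreover have "Comp (\<C> 3) (amap (F (D_map 1)) \<phi>) (sigma12 (strict_pseudo delta3 \<C> F) w) =
      amap (F (D_map 1)) \<phi>"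
    using category_right_unit[OF C3 D\<phi>[of 1]] sigma by simp
  moreover have "Comp (\<C> 3) (sigma01 (strict_pseudo delta3 \<C> F) w) (amap (F (D_map 1)) \<phi>) =
      amap (F (D_map 1)) \<phi>"
    using category_left_unit[OF C3 D\<phi>[of 1]] rel sigma by simp
  moreover have "Comp (\<C> 1) (nn (strict_pseudo delta3 \<C> F) 0 w) (amap (F s_map) \<phi>) = amap (F s_map) \<phi>"
    using category_left_unit[OF C1 s\<phi>] nn by simp
  ultimately show ?thesis using w \<phi> nn by (simp add: descent_data_def)
qed (auto simp: descent_data_def)


section \<open>Transport along isomorphisms of categories\<close>

definition inverse_functors ::
  "('o, 'a) cat \<Rightarrow> ('p, 'b) cat \<Rightarrow> ('o, 'a, 'p, 'b) fctr \<Rightarrow> ('p, 'b, 'o, 'a) fctr \<Rightarrow> bool" where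
  "inverse_functors C D P Q \<longleftrightarrow> is_functor C D P \<and> is_functor D C Q \<and>
     functor_eq C (Q \<circ>\<^sub>F P) id_functor \<and> functor_eq D (P \<circ>\<^sub>F Q) id_functor"

lemma inverse_functors_rules:
  assumes "inverse_functors C D P Q"
  shows inverse_functors_to: "is_functor C D P" and inverse_functors_from: "is_functor D C Q"
    and inverse_functors_obj: "x \<in> Obj C \<Longrightarrow> omap Q (omap P x) = x"
    and inverse_functors_hom: "f \<in> hom C x y \<Longrightarrow> amap Q (amap P f) = f"
    and inverse_functors_obj': "z \<in> Obj D \<Longrightarrow> omap P (omap Q z) = z"
    and inverse_functors_hom': "g \<in> hom D z w \<Longrightarrow> amap P (amap Q g) = g"
  using assms unfolding inverse_functors_def
  by (auto dest: functor_eq_obj functor_eq_hom)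

text \<open>Conjugating a diagram by isomorphisms of categories, rather than equivalences, keeps it strict: the
  functors \<open>Q\<close> and \<open>P\<close> that meet in a composite cancel.\<close>

lemma strict_diagram_transport:
  assumes F: "strict_diagram X \<C> F"
    and inv: "\<And>x. x \<in> Obj X \<Longrightarrow> inverse_functors (\<C> x) (\<D> x) (P x) (Q x)"
  shows "strict_diagram X \<D> (\<lambda>f. P (Cod X f) \<circ>\<^sub>F F f \<circ>\<^sub>F Q (Dom X f))"
proof (rule strict_diagramI)
  show X: "category X" using strict_diagram_shape[OF F] .
  note P = inverse_functors_to[OF inv] and Q = inverse_functors_from[OF inv]
  {
    fix x assume x: "x \<in> Obj X"
    show "category (\<D> x)" using functor_target[OF P[OF x]] .
    have "Dom X (Idt X x) = x" "Cod X (Idt X x) = x"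
      using category_Idt[OF X x] by (auto simp: hom_iff)
    then show "functor_eq (\<D> x) (P (Cod X (Idt X x)) \<circ>\<^sub>F F (Idt X x) \<circ>\<^sub>F Q (Dom X (Idt X x))) id_functor"
      by (auto intro!: functor_eqI
          simp: functor_eq_obj[OF strict_diagram_Idt[OF F x] functor_obj[OF Q[OF x]]]
            functor_eq_hom[OF strict_diagram_Idt[OF F x] functor_hom[OF Q[OF x]]]
            inverse_functors_obj'[OF inv[OF x]] inverse_functors_hom'[OF inv[OF x]])
  next
    fix x y f assume f: "f \<in> hom X x y"
    then have "Dom X f = x" "Cod X f = y" and x: "x \<in> Obj X" and y: "y \<in> Obj X"
      using category_hom_obj[OF X f] by (auto simp: hom_iff)
    then show "is_functor (\<D> x) (\<D> y) (P (Cod X f) \<circ>\<^sub>F F f \<circ>\<^sub>F Q (Dom X f))"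
      using comp_is_functor[OF comp_is_functor[OF Q[OF x] strict_diagram_functor[OF F f]] P[OF y]]
      by simp
  next
    fix x y z f g assume f: "f \<in> hom X x y" and g: "g \<in> hom X y z"
    have x: "x \<in> Obj X" and y: "y \<in> Obj X" and z: "z \<in> Obj X"
      using category_hom_obj[OF X f] category_hom_obj[OF X g] by auto
    have ends: "Dom X f = x" "Cod X f = y" "Dom X g = y" "Cod X g = z"
      "Dom X (Comp X g f) = x" "Cod X (Comp X g f) = z"
      using f g category_Comp[OF X g f] by (auto simp: hom_iff)
    note Ff = strict_diagram_functor[OF F f] and eq = strict_diagram_Comp[OF F f g]
    show "functor_eq (\<D> x) ((P (Cod X g) \<circ>\<^sub>F F g \<circ>\<^sub>F Q (Dom X g)) \<circ>\<^sub>F (P (Cod X f) \<circ>\<^sub>F F f \<circ>\<^sub>F Q (Dom X f)))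
        (P (Cod X (Comp X g f)) \<circ>\<^sub>F F (Comp X g f) \<circ>\<^sub>F Q (Dom X (Comp X g f)))"
    proof (rule functor_eqI)
      fix w assume "w \<in> Obj (\<D> x)"
      then have w: "omap (Q x) w \<in> Obj (\<C> x)" using functor_obj[OF Q[OF x]] by blast
      show "omap ((P (Cod X g) \<circ>\<^sub>F F g \<circ>\<^sub>F Q (Dom X g)) \<circ>\<^sub>F (P (Cod X f) \<circ>\<^sub>F F f \<circ>\<^sub>F Q (Dom X f))) w =
          omap (P (Cod X (Comp X g f)) \<circ>\<^sub>F F (Comp X g f) \<circ>\<^sub>F Q (Dom X (Comp X g f))) w"
        using inverse_functors_obj[OF inv[OF y] functor_obj[OF Ff w]] functor_eq_obj[OF eq w]
        by (simp add: ends)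
    next
      fix m w w' assume "m \<in> hom (\<D> x) w w'"
      then have m: "amap (Q x) m \<in> hom (\<C> x) (omap (Q x) w) (omap (Q x) w')"
        using functor_hom[OF Q[OF x]] by blast
      show "amap ((P (Cod X g) \<circ>\<^sub>F F g \<circ>\<^sub>F Q (Dom X g)) \<circ>\<^sub>F (P (Cod X f) \<circ>\<^sub>F F f \<circ>\<^sub>F Q (Dom X f))) m =
          amap (P (Cod X (Comp X g f)) \<circ>\<^sub>F F (Comp X g f) \<circ>\<^sub>F Q (Dom X (Comp X g f))) m"
        using inverse_functors_hom[OF inv[OF y] functor_hom[OF Ff m]] functor_eq_hom[OF eq m]
        by (simp add: ends)
    qed
  }
qed

text \<open>The categories of a pseudofunctor consist of elements of the type of the universe. A category
  whose objects and arrows are tuples is brought into this form by injections \<open>p\<close> and \<open>q\<close>.\<close>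

definition relabel :: "('o \<Rightarrow> 'p) \<Rightarrow> ('a \<Rightarrow> 'b) \<Rightarrow> ('o, 'a) cat \<Rightarrow> ('p, 'b) cat" where
  "relabel p q C =
     \<lparr>Obj = p ` Obj C, Arr = q ` Arr C,
      Dom = (\<lambda>f. p (Dom C (inv_into (Arr C) q f))),
      Cod = (\<lambda>f. p (Cod C (inv_into (Arr C) q f))),
      Idt = (\<lambda>x. q (Idt C (inv_into (Obj C) p x))),
      Comp = (\<lambda>g f. q (Comp C (inv_into (Arr C) q g) (inv_into (Arr C) q f)))\<rparr>"

definition unlabel :: "('o \<Rightarrow> 'p) \<Rightarrow> ('a \<Rightarrow> 'b) \<Rightarrow> ('o, 'a) cat \<Rightarrow> ('p, 'b, 'o, 'a) fctr" where
  "unlabel p q C = \<lparr>omap = inv_into (Obj C) p, amap = inv_into (Arr C) q\<rparr>"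

lemma inverse_functors_relabel:
  assumes C: "category C" and p: "inj_on p (Obj C)" and q: "inj_on q (Arr C)"
  shows "inverse_functors C (relabel p q C) \<lparr>omap = p, amap = q\<rparr> (unlabel p q C)"
proof -
  have p': "inv_into (Obj C) p (p x) = x" if "x \<in> Obj C" for x using inv_into_f_f[OF p that] .
  have q': "inv_into (Arr C) q (q f) = f" if "f \<in> hom C x y" for f x y
    using inv_into_f_f[OF q] that by (simp add: hom_iff)
  have obj: "Obj (relabel p q C) = p ` Obj C" by (simp add: relabel_def)
  have hom: "q f \<in> hom (relabel p q C) (p x) (p y)" if "f \<in> hom C x y" for f x y
    using that q'[OF that] by (auto simp: relabel_def hom_iff)
  have hom_cases: "\<exists>x y f. f \<in> hom C x y \<and> g = q f \<and> z = p x \<and> w = p y"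
    if g: "g \<in> hom (relabel p q C) z w" for g z w
  proof -
    obtain f where f: "f \<in> Arr C" "g = q f" using g by (auto simp: relabel_def hom_iff)
    then have f': "f \<in> hom C (Dom C f) (Cod C f)" by (simp add: hom_iff)
    then show ?thesis using g f(2) q'[OF f'] by (auto simp: relabel_def hom_iff)
  qed
  have p_eq: "x = y" if "p x = p y" "x \<in> Obj C" "y \<in> Obj C" for x y
    using p that by (simp add: inj_on_eq_iff)
  have Comp: "Comp (relabel p q C) (q g) (q f) = q (Comp C g f)" if "f \<in> hom C x y" "g \<in> hom C y z" for f g x y z
    using q'[OF that(1)] q'[OF that(2)] by (simp add: relabel_def)
  have Idt: "Idt (relabel p q C) (p x) = q (Idt C x)" if "x \<in> Obj C" for x
    using p'[OF that] by (simp add: relabel_def)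
  have cat: "category (relabel p q C)"
  proof (rule categoryI)
    fix g assume "g \<in> Arr (relabel p q C)"
    then have "g \<in> hom (relabel p q C) (Dom (relabel p q C) g) (Cod (relabel p q C) g)"
      by (simp add: hom_iff)
    then show "Dom (relabel p q C) g \<in> Obj (relabel p q C) \<and> Cod (relabel p q C) g \<in> Obj (relabel p q C)"
      using hom_cases category_hom_obj[OF C] unfolding obj by blast
  next
    fix z assume "z \<in> Obj (relabel p q C)"
    then show "Idt (relabel p q C) z \<in> hom (relabel p q C) z z"
      using Idt hom[OF category_Idt[OF C]] by (auto simp: obj)
  next
    fix z1 z2 g assume "g \<in> hom (relabel p q C) z1 z2"
    then obtain x y f where f: "f \<in> hom C x y" "g = q f" "z1 = p x" "z2 = p y" using hom_cases by metis
    have x: "x \<in> Obj C" and y: "y \<in> Obj C" using category_hom_obj[OF C f(1)] by auto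
    show "Comp (relabel p q C) (Idt (relabel p q C) z2) g = g"
      using Comp[OF f(1) category_Idt[OF C y]] Idt[OF y] category_left_unit[OF C f(1)] f by simp
    show "Comp (relabel p q C) g (Idt (relabel p q C) z1) = g"
      using Comp[OF category_Idt[OF C x] f(1)] Idt[OF x] category_right_unit[OF C f(1)] f by simp
  next
    fix z1 z2 z3 g h assume "g \<in> hom (relabel p q C) z1 z2" "h \<in> hom (relabel p q C) z2 z3"
    then obtain x y f y' w k where f: "f \<in> hom C x y" "g = q f" "z1 = p x" "z2 = p y"
      and k: "k \<in> hom C y' w" "h = q k" "z2 = p y'" "z3 = p w" using hom_cases by metis
    have "y' = y" using p_eq category_hom_obj[OF C f(1)] category_hom_obj[OF C k(1)] f k by metis
    then show "Comp (relabel p q C) h g \<in> hom (relabel p q C) z1 z3"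
      using hom[OF category_Comp[OF C k(1)]] Comp[OF f(1)] f k by auto
  next
    fix z1 z2 z3 z4 g h l
    assume "g \<in> hom (relabel p q C) z1 z2" "h \<in> hom (relabel p q C) z2 z3"
      and "l \<in> hom (relabel p q C) z3 z4"
    then obtain x y f y' w k w' v n where f: "f \<in> hom C x y" "g = q f" "z2 = p y"
      and k: "k \<in> hom C y' w" "h = q k" "z2 = p y'" "z3 = p w"
      and n: "n \<in> hom C w' v" "l = q n" "z3 = p w'" using hom_cases by metis
    have "y' = y" using p_eq category_hom_obj[OF C f(1)] category_hom_obj[OF C k(1)] f k by metis
    moreover have "w' = w" using p_eq category_hom_obj[OF C n(1)] category_hom_obj[OF C k(1)] n k by metis
    ultimately have k': "k \<in> hom C y w" and n': "n \<in> hom C w v" using k n by auto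
    show "Comp (relabel p q C) l (Comp (relabel p q C) h g) =
        Comp (relabel p q C) (Comp (relabel p q C) l h) g"
      unfolding f(2) k(2) n(2) Comp[OF f(1) k'] Comp[OF k' n'] Comp[OF category_Comp[OF C k' f(1)] n']
        Comp[OF f(1) category_Comp[OF C n' k']] category_assoc[OF C n' k' f(1)] ..
  qed
  have to: "is_functor C (relabel p q C) \<lparr>omap = p, amap = q\<rparr>"
    using hom by (auto intro!: functorI[OF C cat] simp: obj Idt Comp)
  have "is_functor (relabel p q C) C (unlabel p q C)"
  proof (rule functorI[OF cat C])
    fix z assume "z \<in> Obj (relabel p q C)"
    then obtain x where x: "x \<in> Obj C" "z = p x" by (auto simp: obj)
    then show "omap (unlabel p q C) z \<in> Obj C" using p' by (simp add: unlabel_def)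
    show "amap (unlabel p q C) (Idt (relabel p q C) z) = Idt C (omap (unlabel p q C) z)"
      using x p' q'[OF category_Idt[OF C x(1)]] Idt by (simp add: unlabel_def)
  next
    fix z1 z2 g assume "g \<in> hom (relabel p q C) z1 z2"
    then obtain x y f where f: "f \<in> hom C x y" "g = q f" "z1 = p x" "z2 = p y" using hom_cases by metis
    then show "amap (unlabel p q C) g \<in> hom C (omap (unlabel p q C) z1) (omap (unlabel p q C) z2)"
      using p' q'[OF f(1)] category_hom_obj[OF C f(1)] by (simp add: unlabel_def)
  next
    fix z1 z2 z3 g h assume "g \<in> hom (relabel p q C) z1 z2" "h \<in> hom (relabel p q C) z2 z3"
    then obtain x y f y' w k where f: "f \<in> hom C x y" "g = q f" "z1 = p x" "z2 = p y"
      and k: "k \<in> hom C y' w" "h = q k" "z2 = p y'" "z3 = p w" using hom_cases by metis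
    have "y' = y" using p_eq category_hom_obj[OF C f(1)] category_hom_obj[OF C k(1)] f k by metis
    then have k': "k \<in> hom C y w" using k by simp
    show "amap (unlabel p q C) (Comp (relabel p q C) h g) =
        Comp C (amap (unlabel p q C) h) (amap (unlabel p q C) g)"
      unfolding f(2) k(2) Comp[OF f(1) k']
      using q'[OF f(1)] q'[OF k'] q'[OF category_Comp[OF C k' f(1)]] by (simp add: unlabel_def)
  qed
  moreover have "functor_eq C (unlabel p q C \<circ>\<^sub>F \<lparr>omap = p, amap = q\<rparr>) id_functor"
    by (rule functor_eqI) (auto simp: unlabel_def p' q')
  moreover have "functor_eq (relabel p q C) (\<lparr>omap = p, amap = q\<rparr> \<circ>\<^sub>F unlabel p q C) id_functor"
    by (auto simp: functor_eq_def unlabel_def relabel_def f_inv_into_f)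
  ultimately show ?thesis using to by (simp add: inverse_functors_def)
qed


section \<open>Sets that can be encoded in a universe\<close>

text \<open>The sets of tuples from which collages are built live on other types than the members of \<open>U\<close>, and
  are compared with them through injections.\<close>

definition small :: "'u set set \<Rightarrow> 's set \<Rightarrow> bool" where
  "small U S \<longleftrightarrow> (\<exists>p. inj_on p S \<and> p ` S \<in> U)"

lemma small_member: "S \<in> U \<Longrightarrow> small U S"
  unfolding small_def by (rule exI[of _ id]) simp

lemma small_inj:
  assumes U: "universe U" and R: "small U R" and f: "inj_on f S" "f ` S \<subseteq> R"
  shows "small U S"
proof -
  obtain p where p: "inj_on p R" "p ` R \<in> U" using R by (auto simp: small_def)
  have "inj_on (p \<circ> f) S" using comp_inj_on[OF f(1) inj_on_subset[OF p(1) f(2)]] .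
  moreover have "(p \<circ> f) ` S \<subseteq> p ` R" using f(2) by auto
  then have "(p \<circ> f) ` S \<in> U" using U p(2) unfolding universe_def by metis
  ultimately show ?thesis unfolding small_def by blast
qed

lemma small_subset: "universe U \<Longrightarrow> small U R \<Longrightarrow> S \<subseteq> R \<Longrightarrow> small U S"
  by (rule small_inj[where f=id]) auto

lemma small_Times:
  assumes U: "universe U" and S: "small U S" and R: "small U R"
  shows "small U (S \<times> R)"
proof -
  obtain p q where p: "inj_on p S" "p ` S \<in> U" and q: "inj_on q R" "q ` R \<in> U"
    using S R by (auto simp: small_def)
  obtain Z f where Z: "Z \<in> U" and f: "bij_betw f (p ` S \<times> q ` R) Z"
    using U p(2) q(2) unfolding universe_def by metis
  have "small U (p ` S \<times> q ` R)"
    using f Z by (auto simp: small_def bij_betw_def)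
  moreover have "inj_on (map_prod p q) (S \<times> R)" using p(1) q(1) by (rule map_prod_inj_on)
  moreover have "map_prod p q ` (S \<times> R) \<subseteq> p ` S \<times> q ` R" by auto
  ultimately show ?thesis by (rule small_inj[OF U])
qed

text \<open>The axioms of a universe provide a small set with two elements; its square has room for three.\<close>

lemma small_three:
  assumes U: "universe U"
  shows "small U {..<3::nat}"
proof -
  obtain a b where ab: "a \<noteq> b" "{a, b} \<in> U" using U by (auto simp: universe_def)
  have "small U ({a, b} \<times> {a, b})" using small_Times[OF U] small_member[OF ab(2)] by blast
  moreover have "inj_on (\<lambda>i::nat. if i = 0 then (a, a) else if i = 1 then (a, b) else (b, a)) {..<3}"
    using ab(1) by (auto simp: inj_on_def)
  ultimately show ?thesis by (rule small_inj[OF U]) auto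
qed


section \<open>The arrows of \<open>\<Delta>\<^sub>3\<close>\<close>

lemma fin_ord_simps [simp]:
  "Dom fin_ord (n, xs, m) = n" "Cod fin_ord (n, xs, m) = m"
  "Idt fin_ord n = (n, [0..<n], n)"
  "Comp fin_ord (n', ys, m') (n, xs, m) = (n, map (\<lambda>j. ys ! j) xs, m')"
  by (simp_all add: fin_ord_def)

lemma upt_three: "[0..<3] = [0, 1, 2::nat]"
  by (simp add: upt_rec numeral_2_eq_2 One_nat_def)

text \<open>The last clause is the point: there is no codegeneracy out of \<open>3\<close>, so the only arrow out of
  \<open>3\<close> is the identity. Every other arrow starts at \<open>1\<close> or \<open>2\<close>.\<close>

lemma delta3_arr_shape:
  "u \<in> delta3_arr \<Longrightarrow> \<exists>n xs m. u = (n, xs, m) \<and> n \<in> {1, 2, 3} \<and> m \<in> {1, 2, 3} \<and>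
     length xs = n \<and> set xs \<subseteq> {..<m} \<and> sorted xs \<and> (n = 3 \<longrightarrow> m = 3 \<and> xs = [0..<3])"
proof (induction rule: delta3_arr.induct)
  case (identity n)
  then show ?case by auto
next
  case (face1 i)
  then show ?case by (auto simp: d_map_def coface_def upt_rec One_nat_def)
next
  case (face2 i)
  then show ?case by (auto simp: D_map_def coface_def upt_rec numeral_2_eq_2 One_nat_def)
next
  case degeneracy
  then show ?case by (simp add: s_map_def)
next
  case (compose f g)
  then obtain n xs m where f: "f = (n, xs, m)" "n \<in> {1, 2, 3}" "m \<in> {1, 2, 3}" "length xs = n"
    "set xs \<subseteq> {..<m}" "sorted xs" "n = 3 \<longrightarrow> m = 3 \<and> xs = [0..<3]" by blast
  obtain ys k where g: "g = (m, ys, k)" "k \<in> {1, 2, 3}" "length ys = m"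
    "set ys \<subseteq> {..<k}" "sorted ys" "m = 3 \<longrightarrow> k = 3 \<and> ys = [0..<3]"
  proof -
    obtain m' ys k where *: "g = (m', ys, k)" "k \<in> {1, 2, 3}" "length ys = m'"
      "set ys \<subseteq> {..<k}" "sorted ys" "m' = 3 \<longrightarrow> k = 3 \<and> ys = [0..<3]" using compose.IH(2) by blast
    moreover have "m' = m" using compose.hyps(3) f(1) *(1) by simp
    ultimately show thesis using that by blast
  qed
  have range: "ys ! j \<in> {..<k}" if "j \<in> set xs" for j
  proof -
    have "j < length ys" using that f(5) g(3) by auto
    then show ?thesis using g(4) nth_mem by blast
  qed
  have "sorted (map (\<lambda>j. ys ! j) xs)"
  proof -
    have "ys ! (xs ! i) \<le> ys ! (xs ! j)" if ij: "i \<le> j" "j < length xs" for i j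
    proof -
      have "xs ! j \<in> set xs" using ij by simp
      then have "xs ! j < length ys" using f(5) g(3) by auto
      then show ?thesis using sorted_nth_mono[OF g(5) sorted_nth_mono[OF f(6) ij]] by simp
    qed
    then show ?thesis by (simp add: sorted_iff_nth_mono)
  qed
  moreover have "n = 3 \<longrightarrow> k = 3 \<and> map (\<lambda>j. ys ! j) xs = [0..<3]"
    using f(7) g(6) by (auto simp: upt_three)
  moreover have "set (map (\<lambda>j. ys ! j) xs) \<subseteq> {..<k}" using range by auto
  moreover have "Comp fin_ord g f = (n, map (\<lambda>j. ys ! j) xs, k)" by (simp add: f(1) g(1))
  moreover have "length (map (\<lambda>j. ys ! j) xs) = n" using f(4) by simp
  ultimately show ?case using f(2) g(2) by blast
qed

lemma delta3_homE:
  assumes "u \<in> hom delta3 n m"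
  obtains xs where "u = (n, xs, m)" "n \<in> {1, 2, 3}" "m \<in> {1, 2, 3}" "length xs = n"
    "set xs \<subseteq> {..<m}" "sorted xs" "n = 3 \<Longrightarrow> m = 3 \<and> xs = [0..<3]"
proof -
  obtain n' xs m' where u: "u = (n', xs, m')" "n' \<in> {1, 2, 3}" "m' \<in> {1, 2, 3}" "length xs = n'"
    "set xs \<subseteq> {..<m'}" "sorted xs" "n' = 3 \<longrightarrow> m' = 3 \<and> xs = [0..<3]"
    using delta3_arr_shape[of u] assms unfolding hom_iff by auto
  moreover have "n' = n" "m' = m" using assms u(1) by (simp_all add: hom_iff)
  ultimately show thesis using that by blast
qed

lemma category_delta3: "category delta3"
proof (rule categoryI)
  show "Dom delta3 f \<in> Obj delta3 \<and> Cod delta3 f \<in> Obj delta3" if "f \<in> Arr delta3" for f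
    using delta3_arr_shape[of f] that by auto
  show "Idt delta3 x \<in> hom delta3 x x" if "x \<in> Obj delta3" for x
    using delta3_arr.identity[of x] that by (auto simp: hom_iff)
next
  fix x y z f g assume f: "f \<in> hom delta3 x y" and g: "g \<in> hom delta3 y z"
  then have "Comp fin_ord g f \<in> delta3_arr"
    by (intro delta3_arr.compose) (auto simp: hom_iff)
  moreover obtain xs ys where "f = (x, xs, y)" "g = (y, ys, z)" using f g by (meson delta3_homE)
  ultimately show "Comp delta3 g f \<in> hom delta3 x z" by (simp add: hom_iff)
next
  fix x y f assume "f \<in> hom delta3 x y"
  then obtain xs where f: "f = (x, xs, y)" "length xs = x" "set xs \<subseteq> {..<y}" by (rule delta3_homE)
  then show "Comp delta3 (Idt delta3 y) f = f"
    by (auto simp: subset_iff intro!: map_idI)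
  show "Comp delta3 f (Idt delta3 x) = f" using f map_nth[of xs] by simp
next
  fix x y z w f g h
  assume "f \<in> hom delta3 x y" "g \<in> hom delta3 y z" "h \<in> hom delta3 z w"
  moreover from this obtain xs where "f = (x, xs, y)" "set xs \<subseteq> {..<y}" by (meson delta3_homE)
  moreover from calculation obtain ys where "g = (y, ys, z)" "length ys = y" by (meson delta3_homE)
  moreover from calculation obtain zs where "h = (z, zs, w)" by (meson delta3_homE)
  ultimately show "Comp delta3 h (Comp delta3 g f) = Comp delta3 (Comp delta3 h g) f"
    by (auto simp: subset_iff)
qed


section \<open>The collage of a pointed endofunctor with a multiplication\<close>

primrec functor_power :: "('o, 'a, 'o, 'a) fctr \<Rightarrow> nat \<Rightarrow> ('o, 'a, 'o, 'a) fctr" where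
  "functor_power T 0 = id_functor"
| "functor_power T (Suc k) = T \<circ>\<^sub>F functor_power T k"

lemma functor_power_functor:
  assumes "is_functor C C T"
  shows "is_functor C C (functor_power T k)"
proof (induction k)
  case 0
  show ?case using id_is_functor[OF functor_source[OF assms]] by simp
next
  case (Suc k)
  then show ?case using comp_is_functor[OF _ assms] by simp
qed

lemma functor_power_add:
  "omap (functor_power T (j + k)) x = omap (functor_power T j) (omap (functor_power T k) x)"
  "amap (functor_power T (j + k)) f = amap (functor_power T j) (amap (functor_power T k) f)"
  by (induction j) simp_all

lemma functor_power_1 [simp]: "functor_power T 1 = T"
  by (simp add: One_nat_def comp_functor_def id_functor_def comp_def)

lemma functor_power_2 [simp]: "functor_power T 2 = T \<circ>\<^sub>F T"
  by (simp add: numeral_2_eq_2 comp_functor_def id_functor_def comp_def)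

text \<open>For \<open>n = 2\<close> this is the collage of the profunctor \<open>C(T -, -)\<close>. In general \<open>n\<close> copies of
  \<open>C\<close> are joined by arrows \<open>T\<^sup>j\<^sup>-\<^sup>i c \<rightarrow> c'\<close> from copy \<open>i\<close> to copy \<open>j\<close>, and the exponents
  add up under composition.\<close>

definition collage :: "('o, 'a) cat \<Rightarrow> ('o, 'a, 'o, 'a) fctr \<Rightarrow> nat \<Rightarrow>
    ('o \<times> nat, ('o \<times> nat) \<times> 'a \<times> ('o \<times> nat)) cat" where
  "collage C T n =
     \<lparr>Obj = Obj C \<times> {..<n},
      Arr = {(p, f, q). fst p \<in> Obj C \<and> fst q \<in> Obj C \<and> snd p \<le> snd q \<and> snd q < n \<and>
               f \<in> hom C (omap (functor_power T (snd q - snd p)) (fst p)) (fst q)},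
      Dom = (\<lambda>(p, f, q). p),
      Cod = (\<lambda>(p, f, q). q),
      Idt = (\<lambda>p. (p, Idt C (fst p), p)),
      Comp = (\<lambda>(q', g, r) (p, f, q). (p, Comp C g (amap (functor_power T (snd r - snd q)) f), r))\<rparr>"

lemma collage_simps [simp]:
  "Obj (collage C T n) = Obj C \<times> {..<n}"
  "Idt (collage C T n) p = (p, Idt C (fst p), p)"
  "Comp (collage C T n) (q', g, r) (p, f, q) =
     (p, Comp C g (amap (functor_power T (snd r - snd q)) f), r)"
  by (simp_all add: collage_def)

lemma hom_collage:
  "m \<in> hom (collage C T n) p q \<longleftrightarrow> (\<exists>f. m = (p, f, q) \<and> fst p \<in> Obj C \<and> fst q \<in> Obj C \<and>
     snd p \<le> snd q \<and> snd q < n \<and> f \<in> hom C (omap (functor_power T (snd q - snd p)) (fst p)) (fst q))"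
  by (auto simp: collage_def hom_def)

lemma collage_Comp_hom:
  assumes T: "is_functor C C T"
    and f: "f \<in> hom C (omap (functor_power T (j - i)) x) y"
    and g: "g \<in> hom C (omap (functor_power T (k - j)) y) z" and le: "i \<le> j" "j \<le> k"
  shows "Comp C g (amap (functor_power T (k - j)) f) \<in> hom C (omap (functor_power T (k - i)) x) z"
    and "amap (functor_power T (k - j)) f \<in>
      hom C (omap (functor_power T (k - i)) x) (omap (functor_power T (k - j)) y)"
proof -
  have "k - i = (k - j) + (j - i)" using le by simp
  then show "amap (functor_power T (k - j)) f \<in>
      hom C (omap (functor_power T (k - i)) x) (omap (functor_power T (k - j)) y)"
    using functor_hom[OF functor_power_functor[OF T] f] by (simp only: functor_power_add)
  then show "Comp C g (amap (functor_power T (k - j)) f) \<in> hom C (omap (functor_power T (k - i)) x) z"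
    by (rule category_Comp[OF functor_source[OF T] g])
qed

lemma category_collage:
  assumes T: "is_functor C C T"
  shows "category (collage C T n)"
proof (rule categoryI)
  have C: "category C" using functor_source[OF T] .
  note Tn = functor_power_functor[OF T]
  {
    show "Dom (collage C T n) m \<in> Obj (collage C T n) \<and> Cod (collage C T n) m \<in> Obj (collage C T n)"
      if "m \<in> Arr (collage C T n)" for m
      using that by (auto simp: collage_def)
    show "Idt (collage C T n) p \<in> hom (collage C T n) p p" if "p \<in> Obj (collage C T n)" for p
      using that category_Idt[OF C] by (auto simp: hom_collage)
  next
    fix p q m assume "m \<in> hom (collage C T n) p q"
    then obtain f where m: "m = (p, f, q)" and p: "fst p \<in> Obj C"
      and f: "f \<in> hom C (omap (functor_power T (snd q - snd p)) (fst p)) (fst q)"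
      by (auto simp: hom_collage)
    show "Comp (collage C T n) (Idt (collage C T n) q) m = m"
      using category_left_unit[OF C f] m by simp
    show "Comp (collage C T n) m (Idt (collage C T n) p) = m"
      using functor_Idt[OF Tn p] category_right_unit[OF C f] m by simp
  next
    fix p q r m m' assume "m \<in> hom (collage C T n) p q" "m' \<in> hom (collage C T n) q r"
    then show "Comp (collage C T n) m' m \<in> hom (collage C T n) p r"
      using collage_Comp_hom(1)[OF T] by (auto simp: hom_collage)
  next
    fix p q r s m m' m''
    assume "m \<in> hom (collage C T n) p q" "m' \<in> hom (collage C T n) q r" "m'' \<in> hom (collage C T n) r s"
    then obtain f g h where m: "m = (p, f, q)" "m' = (q, g, r)" "m'' = (r, h, s)"
      and f: "f \<in> hom C (omap (functor_power T (snd q - snd p)) (fst p)) (fst q)"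
      and g: "g \<in> hom C (omap (functor_power T (snd r - snd q)) (fst q)) (fst r)"
      and h: "h \<in> hom C (omap (functor_power T (snd s - snd r)) (fst r)) (fst s)"
      and le: "snd p \<le> snd q" "snd q \<le> snd r" "snd r \<le> snd s"
      unfolding hom_collage by blast
    note Tf = collage_Comp_hom(2)[OF T f g le(1,2)]
    have "snd s - snd q = (snd s - snd r) + (snd r - snd q)" using le by simp
    then have TTf: "amap (functor_power T (snd s - snd q)) f =
        amap (functor_power T (snd s - snd r)) (amap (functor_power T (snd r - snd q)) f)"
      by (simp only: functor_power_add)
    have TTf_hom: "amap (functor_power T (snd s - snd r)) (amap (functor_power T (snd r - snd q)) f) \<in>
        hom C (omap (functor_power T (snd s - snd p)) (fst p)) (omap (functor_power T (snd s - snd q)) (fst q))"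
      using collage_Comp_hom(2)[OF T f category_Idt[OF C functor_obj[OF Tn]], of "snd s"] le
        category_hom_obj[OF C f] unfolding TTf[symmetric] by auto
    show "Comp (collage C T n) m'' (Comp (collage C T n) m' m) =
        Comp (collage C T n) (Comp (collage C T n) m'' m') m"
      unfolding m collage_simps functor_Comp[OF Tn g Tf] TTf
      using category_assoc[OF C h collage_Comp_hom(2)[OF T g h le(2,3)] TTf_hom] by simp
  }
qed

text \<open>Order-preserving maps act on collages through these transformations: \<open>\<eta>\<close> belongs to the
  degeneracy, which collapses a step, and \<open>\<mu>\<close> to the coface \<open>D\<^sup>1\<close>, which stretches one.\<close>

locale pointed_multiplicative =
  fixes C :: "('o, 'a) cat" and T \<eta> \<mu>
  assumes unit: "nat_trans C C id_functor T \<eta>"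
    and mult: "nat_trans C C (T \<circ>\<^sub>F T) T \<mu>"
begin

lemma T_functor: "is_functor C C T"
  using unit by (simp add: nat_trans_def)

lemma C_category: "category C"
  using functor_source[OF T_functor] .

text \<open>The canonical transformation \<open>T\<^sup>k \<Rightarrow> T\<close> for \<open>k \<le> 2\<close>.\<close>

definition flatten :: "nat \<Rightarrow> 'o \<Rightarrow> 'a" where
  "flatten k c = (if k = 0 then \<eta> c else if k = 1 then Idt C (omap T c) else \<mu> c)"

lemma flatten_natural:
  assumes "k \<le> 2"
  shows "nat_trans C C (functor_power T k) T (flatten k)"
proof -
  consider "k = 0" | "k = 1" | "k = 2" using assms by linarith
  then show ?thesis
  proof cases
    case 1
    then show ?thesis using unit by (simp add: flatten_def[abs_def])
  next
    case 2
    have "functor_eq C T T" by (simp add: functor_eq_def)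
    then have "nat_trans C C T T (\<lambda>x. Idt C (omap T x))"
      using nat_iso_of_functor_eq[OF T_functor T_functor] by (simp add: nat_iso_def)
    then show ?thesis using 2 by (simp add: flatten_def[abs_def])
  next
    case 3
    then show ?thesis using mult by (simp add: flatten_def[abs_def])
  qed
qed

lemmas flatten_hom = nat_trans_hom[OF flatten_natural]

text \<open>An arrow within one copy of \<open>C\<close> is kept, and so is
  every arrow if the source is \<open>3\<close>, since then the map is the identity. Otherwise the source is
  \<open>2\<close> and the arrow goes from copy \<open>0\<close> to copy \<open>1\<close>.\<close>

definition collage_map :: "ordmap \<Rightarrow>
    ('o \<times> nat, ('o \<times> nat) \<times> 'a \<times> ('o \<times> nat), 'o \<times> nat, ('o \<times> nat) \<times> 'a \<times> ('o \<times> nat)) fctr" where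
  "collage_map = (\<lambda>(n, xs, m).
     \<lparr>omap = (\<lambda>(c, i). (c, xs ! i)),
      amap = (\<lambda>((c, i), f, (c', j)). ((c, xs ! i),
        if n = 3 \<or> i = j then f else Comp C f (flatten (xs ! j - xs ! i) c), (c', xs ! j)))\<rparr>)"

lemma collage_map_simps [simp]:
  "omap (collage_map (n, xs, m)) (c, i) = (c, xs ! i)"
  "amap (collage_map (n, xs, m)) ((c, i), f, (c', j)) = ((c, xs ! i),
     if n = 3 \<or> i = j then f else Comp C f (flatten (xs ! j - xs ! i) c), (c', xs ! j))"
  by (simp_all add: collage_map_def)

lemma collage_step_cases:
  fixes n :: nat
  assumes "n \<in> {1, 2, 3}" and "i \<le> j" and "j < n"
  obtains (diagonal) "n = 3 \<or> i = j" | (step) "n = 2" "i = 0" "j = 1"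
  using assms by fastforce

text \<open>Let the source be \<open>2\<close>. If the first factor of a composite from copy 0 to copy 1 lies within
  copy 0, functoriality is naturality of \<open>flatten\<close> at this factor; if the first factor itself goes
  from copy 0 to copy 1, functoriality is associativity.\<close>

lemma collage_map_functor:
  assumes u: "u \<in> hom delta3 n m"
  shows "is_functor (collage C T n) (collage C T m) (collage_map u)"
proof -
  obtain xs where u_eq: "u = (n, xs, m)" and n: "n \<in> {1, 2, 3}" and m: "m \<in> {1, 2, 3}"
    and len: "length xs = n" and range: "set xs \<subseteq> {..<m}" and sorted: "sorted xs"
    and three: "n = 3 \<Longrightarrow> m = 3 \<and> xs = [0..<3]"
    using u by (rule delta3_homE) blast
  have bound: "xs ! i < m" if "i < n" for i using that len range nth_mem by blast
  have mono: "xs ! i \<le> xs ! j" if "i \<le> j" "j < n" for i j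
    using sorted_nth_mono[OF sorted] that len by simp
  have small: "xs ! j - xs ! i \<le> 2" if "j < n" for i j using bound[OF that] m by auto
  have diff: "xs ! j - xs ! i = j - i" if "n = 3 \<or> i = j" "i \<le> j" "j < n" for i j
    using that three by auto
  note T = T_functor and C = C_category
  note Tn = functor_power_functor[OF T]
  show ?thesis
    unfolding u_eq
  proof (rule functorI[OF category_collage[OF T] category_collage[OF T]])
    fix p assume "p \<in> Obj (collage C T n)"
    then show "omap (collage_map (n, xs, m)) p \<in> Obj (collage C T m)"
      using bound by (cases p) simp
    show "amap (collage_map (n, xs, m)) (Idt (collage C T n) p) =
        Idt (collage C T m) (omap (collage_map (n, xs, m)) p)"
      by (cases p) simp
  next
    fix p q a assume a: "a \<in> hom (collage C T n) p q"
    obtain x i y j where pq: "p = (x, i)" "q = (y, j)" by (cases p, cases q)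
    obtain f where a_eq: "a = ((x, i), f, (y, j))" and x: "x \<in> Obj C" and y: "y \<in> Obj C"
      and le: "i \<le> j" "j < n" and f: "f \<in> hom C (omap (functor_power T (j - i)) x) y"
      using a unfolding pq hom_collage by auto
    from n le show "amap (collage_map (n, xs, m)) a \<in>
        hom (collage C T m) (omap (collage_map (n, xs, m)) p) (omap (collage_map (n, xs, m)) q)"
    proof (cases rule: collage_step_cases)
      case diagonal
      then show ?thesis
        using x y f mono[OF le] bound[OF le(2)] diff[OF diagonal le] by (simp add: a_eq pq hom_collage)
    next
      case step
      have "f \<in> hom C (omap T x) y" using f step by simp
      then have "Comp C f (flatten (xs ! j - xs ! i) x) \<in> hom C (omap (functor_power T (xs ! j - xs ! i)) x) y"
        using category_Comp[OF C _ flatten_hom[OF small[OF le(2)] x]] by blast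
      then show ?thesis
        using x y mono[OF le] bound[OF le(2)] step by (simp add: a_eq pq hom_collage)
    qed
  next
    fix p q r a b assume a: "a \<in> hom (collage C T n) p q" and b: "b \<in> hom (collage C T n) q r"
    obtain x i y j z k where pqr: "p = (x, i)" "q = (y, j)" "r = (z, k)" by (cases p, cases q, cases r)
    obtain f g where a_eq: "a = ((x, i), f, (y, j))" and b_eq: "b = ((y, j), g, (z, k))"
      and x: "x \<in> Obj C" and y: "y \<in> Obj C" and le: "i \<le> j" "j \<le> k" "k < n"
      and f: "f \<in> hom C (omap (functor_power T (j - i)) x) y"
      and g: "g \<in> hom C (omap (functor_power T (k - j)) y) z"
      using a b unfolding pqr hom_collage by auto
    have jn: "j < n" using le by simp
    let ?F = "collage_map (n, xs, m)"
    consider (diagonal) "n = 3 \<or> i = j \<and> j = k" | (right) "n = 2" "i = 0" "j = 0" "k = 1"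
      | (left) "n = 2" "i = 0" "j = 1" "k = 1"
      using n le by fastforce
    then show "amap ?F (Comp (collage C T n) b a) = Comp (collage C T m) (amap ?F b) (amap ?F a)"
    proof cases
      case diagonal
      then show ?thesis using diff[of j k] le by (auto simp: a_eq b_eq)
    next
      case right
      let ?k = "xs ! 1 - xs ! 0"
      have small': "?k \<le> 2" using small[of 1] right by simp
      have f': "f \<in> hom C x y" and g': "g \<in> hom C (omap T y) z" using f g right by simp_all
      note \<kappa> = flatten_hom[OF small']
      have "Comp C (Comp C g (amap T f)) (flatten ?k x) = Comp C g (Comp C (amap T f) (flatten ?k x))"
        by (rule category_assoc[OF C g' functor_hom[OF T f'] \<kappa>[OF x]])
      also have "Comp C (amap T f) (flatten ?k x) = Comp C (flatten ?k y) (amap (functor_power T ?k) f)"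
        using nat_trans_natural[OF flatten_natural[OF small'] f'] by simp
      also have "Comp C g \<dots> = Comp C (Comp C g (flatten ?k y)) (amap (functor_power T ?k) f)"
        by (rule category_assoc[OF C g' \<kappa>[OF y] functor_hom[OF Tn f'], symmetric])
      finally show ?thesis using right by (simp add: a_eq b_eq)
    next
      case left
      have f': "f \<in> hom C (omap T x) y" and g': "g \<in> hom C y z" using f g left by simp_all
      show ?thesis
        using left category_assoc[OF C g' f' flatten_hom[OF small[OF jn] x, of i]] by (simp add: a_eq b_eq)
    qed
  qed
qed

text \<open>A composite whose first map starts at \<open>2\<close>, followed through on the step from copy 0 to copy 1, never
  applies \<open>flatten\<close> twice in an essential way: the first map is either constant, and the arrow is
  not changed any more once it lies within one copy, or it is the identity of \<open>2\<close>, or its target is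
  \<open>3\<close> and the second map is the identity.\<close>

lemma collage_diagram: "strict_diagram delta3 (collage C T) collage_map"
proof (rule strict_diagramI[OF category_delta3 category_collage[OF T_functor] collage_map_functor])
  fix n assume "n \<in> Obj delta3"
  then have n: "n \<in> {1, 2, 3}" by simp
  show "functor_eq (collage C T n) (collage_map (Idt delta3 n)) id_functor"
  proof (rule functor_eqI)
    fix p assume "p \<in> Obj (collage C T n)"
    then show "omap (collage_map (Idt delta3 n)) p = omap id_functor p" by (cases p) simp
  next
    fix a p q assume a: "a \<in> hom (collage C T n) p q"
    obtain x i y j where pq: "p = (x, i)" "q = (y, j)" by (cases p, cases q)
    obtain f where a_eq: "a = ((x, i), f, (y, j))" and le: "i \<le> j" "j < n"
      and f: "f \<in> hom C (omap (functor_power T (j - i)) x) y"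
      using a unfolding pq hom_collage by auto
    from n le show "amap (collage_map (Idt delta3 n)) a = amap id_functor a"
    proof (cases rule: collage_step_cases)
      case step
      then show ?thesis
        using le f category_right_unit[OF C_category] by (simp add: a_eq flatten_def)
    qed (use le in \<open>auto simp: a_eq\<close>)
  qed
next
  fix n m k u v assume u: "u \<in> hom delta3 n m" and v: "v \<in> hom delta3 m k"
  obtain xs where u_eq: "u = (n, xs, m)" and n: "n \<in> {1, 2, 3}" and m: "m \<in> {1, 2, 3}"
    and len: "length xs = n" and range: "set xs \<subseteq> {..<m}" and sorted: "sorted xs"
    and u3: "n = 3 \<Longrightarrow> m = 3 \<and> xs = [0..<3]"
    using u by (rule delta3_homE) blast
  obtain ys where v_eq: "v = (m, ys, k)"
    and v3: "m = 3 \<Longrightarrow> k = 3 \<and> ys = [0..<3]"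
    using v by (rule delta3_homE) blast
  have bound: "xs ! i < m" if "i < n" for i using that len range nth_mem by blast
  show "functor_eq (collage C T n) (collage_map v \<circ>\<^sub>F collage_map u) (collage_map (Comp delta3 v u))"
    unfolding u_eq v_eq
  proof (rule functor_eqI)
    fix p assume "p \<in> Obj (collage C T n)"
    then show "omap (collage_map (m, ys, k) \<circ>\<^sub>F collage_map (n, xs, m)) p =
        omap (collage_map (Comp delta3 (m, ys, k) (n, xs, m))) p"
      using len by (cases p) simp
  next
    fix a p q assume a: "a \<in> hom (collage C T n) p q"
    obtain x i y j where pq: "p = (x, i)" "q = (y, j)" by (cases p, cases q)
    obtain f where a_eq: "a = ((x, i), f, (y, j))" and le: "i \<le> j" "j < n"
      and f: "f \<in> hom C (omap (functor_power T (j - i)) x) y"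
      using a unfolding pq hom_collage by auto
    from n le show "amap (collage_map (m, ys, k) \<circ>\<^sub>F collage_map (n, xs, m)) a =
        amap (collage_map (Comp delta3 (m, ys, k) (n, xs, m))) a"
    proof (cases rule: collage_step_cases)
      case diagonal
      then show ?thesis using len le u3 by (auto simp: a_eq)
    next
      case step
      have f': "f \<in> hom C (omap T x) y" using f step by simp
      have xs01: "xs ! 0 \<le> xs ! 1" "xs ! 1 < m"
        using sorted_nth_mono[OF sorted, of 0 1] bound[of 1] len step by auto
      from m xs01 show ?thesis
      proof (cases rule: collage_step_cases)
        case diagonal
        then show ?thesis using len step v3 xs01 by (auto simp: a_eq)
      next
        case step': step
        show ?thesis
          using len step step' category_right_unit[OF C_category f'] by (simp add: a_eq flatten_def)
      qed
    qed
  qed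
qed

end


section \<open>Monads give diagrams whose descent data are the algebras\<close>

text \<open>Arrows with given ends are told apart by the underlying arrow of \<open>C\<close>, so full faithfulness says
  that compatibility is the same relation on both sides.\<close>

lemma structure_cat_map:
  assumes dom: "category (structure_cat C S R)" and cod: "category (structure_cat C S' R')"
    and \<theta>: "\<And>x. fst (\<theta> x) = fst x" "\<theta> ` S = S'"
    and R: "\<And>x y m. x \<in> S \<Longrightarrow> y \<in> S \<Longrightarrow> m \<in> hom C (fst x) (fst y) \<Longrightarrow> R' (\<theta> x) m (\<theta> y) \<longleftrightarrow> R x m y"
    and J: "J = \<lparr>omap = \<theta>, amap = (\<lambda>(x, m, y). (\<theta> x, m, \<theta> y))\<rparr>"
  shows "is_functor (structure_cat C S R) (structure_cat C S' R') J"
    and "fully_faithful (structure_cat C S R) (structure_cat C S' R') J"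
proof -
  have S': "\<theta> x \<in> S'" if "x \<in> S" for x using \<theta>(2) that by blast
  show functor_J: "is_functor (structure_cat C S R) (structure_cat C S' R') J"
    by (rule functorI[OF dom cod]) (auto simp: J hom_structure_cat \<theta>(1) S' R)
  show "fully_faithful (structure_cat C S R) (structure_cat C S' R') J"
  proof (rule fully_faithfulI[OF functor_J])
    fix x y h assume "x \<in> Obj (structure_cat C S R)" "y \<in> Obj (structure_cat C S R)"
      and "h \<in> hom (structure_cat C S' R') (omap J x) (omap J y)"
    then obtain m where "h = (\<theta> x, m, \<theta> y)" "(x, m, y) \<in> hom (structure_cat C S R) x y"
      by (auto simp: J hom_structure_cat \<theta>(1) R)
    then show "\<exists>f \<in> hom (structure_cat C S R) x y. amap J f = h"
      by (intro bexI[of _ "(x, m, y)"]) (simp_all add: J)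
  qed (auto simp: J hom_structure_cat)
qed

lemma delta3_generators:
  "d_map 0 = (1, [1], 2)" "d_map 1 = (1, [0], 2)"
  "D_map 0 = (2, [1, 2], 3)" "D_map 1 = (2, [0, 2], 3)" "D_map 2 = (2, [0, 1], 3)"
  "s_map = (2, [0, 0], 1)"
  by (simp_all add: d_map_def D_map_def s_map_def coface_def upt_rec numeral_2_eq_2 numeral_3_eq_3 One_nat_def)

text \<open>The collages on \<open>1\<close>, \<open>2\<close>, \<open>3\<close>, replaced by isomorphic categories \<open>\<D> n\<close> on the type of
  \<open>C\<close>. The collage on \<open>1\<close> is replaced by \<open>C\<close>, along the evident isomorphism, so that the
  forgetful functor of the lax descent category ends in \<open>C\<close>.\<close>

locale encoded_collage = pointed_multiplicative C T \<eta> \<mu>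
  for C :: "('u, 'u) cat" and T \<eta> \<mu> +
  fixes \<D> :: "nat \<Rightarrow> ('u, 'u) cat" and P Q
  assumes inv: "\<And>n. n \<in> {1, 2, 3} \<Longrightarrow> inverse_functors (collage C T n) (\<D> n) (P n) (Q n)"
    and D1: "\<D> 1 = C"
    and P1: "P 1 = \<lparr>omap = fst, amap = (\<lambda>(p, f, q). f)\<rparr>"
    and Q1: "Q 1 = \<lparr>omap = (\<lambda>c. (c, 0)), amap = (\<lambda>f. ((Dom C f, 0), f, (Cod C f, 0)))\<rparr>"
begin

definition transported :: "ordmap \<Rightarrow> ('u, 'u, 'u, 'u) fctr" where
  "transported u = P (Cod delta3 u) \<circ>\<^sub>F collage_map u \<circ>\<^sub>F Q (Dom delta3 u)"

lemma transported_diagram: "strict_diagram delta3 \<D> transported"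
  unfolding transported_def[abs_def]
  by (rule strict_diagram_transport[OF collage_diagram inv]) simp

text \<open>The code of \<open>a : T c \<rightarrow> c'\<close> as an arrow from copy 0 to copy 1 in \<open>\<D> 2\<close>.\<close>

definition cell :: "'u \<Rightarrow> 'u \<Rightarrow> 'u \<Rightarrow> 'u" where
  "cell c a c' = amap (P 2) ((c, 0), a, (c', 1))"

lemma cell_source:
  assumes "c \<in> Obj C" "c' \<in> Obj C" "a \<in> hom C (omap T c) c'"
  shows "((c, 0), a, (c', 1)) \<in> hom (collage C T 2) (c, 0) (c', 1)"
  using assms by (simp add: hom_collage)

lemma transported_faces:
  "omap (transported (d_map 1)) w = omap (P 2) (w, 0)"
  "omap (transported (d_map 0)) w = omap (P 2) (w, 1)"
  "m \<in> hom C w w' \<Longrightarrow> amap (transported (d_map 1)) m = amap (P 2) ((w, 0), m, (w', 0))"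
  "m \<in> hom C w w' \<Longrightarrow> amap (transported (d_map 0)) m = amap (P 2) ((w, 1), m, (w', 1))"
  by (auto simp: transported_def delta3_generators Q1 hom_iff)

lemma transported_cell:
  assumes "c \<in> Obj C" "c' \<in> Obj C" "a \<in> hom C (omap T c) c'"
  shows "amap (transported (D_map 0)) (cell c a c') = amap (P 3) ((c, 1), a, (c', 2))"
    and "amap (transported (D_map 1)) (cell c a c') = amap (P 3) ((c, 0), Comp C a (\<mu> c), (c', 2))"
    and "amap (transported (D_map 2)) (cell c a c') = amap (P 3) ((c, 0), a, (c', 1))"
    and "amap (transported s_map) (cell c a c') = Comp C a (\<eta> c)"
  using inverse_functors_hom[OF inv cell_source[OF assms]] category_right_unit[OF C_category assms(3)]
  by (simp_all add: transported_def delta3_generators cell_def flatten_def P1)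

lemma hom_cell:
  assumes w: "w \<in> Obj C"
  shows "\<phi> \<in> hom (\<D> 2) (omap (P 2) (w, 0)) (omap (P 2) (w, 1)) \<longleftrightarrow>
    (\<exists>a \<in> hom C (omap T w) w. \<phi> = cell w a w)"
proof
  have inv2: "inverse_functors (collage C T 2) (\<D> 2) (P 2) (Q 2)" by (rule inv) simp
  {
    assume \<phi>: "\<phi> \<in> hom (\<D> 2) (omap (P 2) (w, 0)) (omap (P 2) (w, 1))"
    have "omap (Q 2) (omap (P 2) (w, i)) = (w, i)" if "i < 2" for i
      using inverse_functors_obj[OF inv2, of "(w, i)"] w that by simp
    then have "amap (Q 2) \<phi> \<in> hom (collage C T 2) (w, 0) (w, 1)"
      using functor_hom[OF inverse_functors_from[OF inv2] \<phi>] by simp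
    then obtain a where "a \<in> hom C (omap T w) w" "amap (Q 2) \<phi> = ((w, 0), a, (w, 1))"
      by (auto simp: hom_collage)
    moreover from this have "\<phi> = cell w a w"
      unfolding cell_def using inverse_functors_hom'[OF inv2 \<phi>] by simp
    ultimately show "\<exists>a \<in> hom C (omap T w) w. \<phi> = cell w a w" by blast
  next
    assume "\<exists>a \<in> hom C (omap T w) w. \<phi> = cell w a w"
    then show "\<phi> \<in> hom (\<D> 2) (omap (P 2) (w, 0)) (omap (P 2) (w, 1))"
      unfolding cell_def using functor_hom[OF inverse_functors_to[OF inv2] cell_source[OF w w]] by blast
  }
qed

lemma transported_eq_iff:
  assumes "n \<in> {1, 2, 3}" "f \<in> hom (collage C T n) p q" "g \<in> hom (collage C T n) p q"
  shows "amap (P n) f = amap (P n) g \<longleftrightarrow> f = g"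
  using inverse_functors_hom[OF inv[OF assms(1)] assms(2)]
    inverse_functors_hom[OF inv[OF assms(1)] assms(3)] by metis

text \<open>In the collage on \<open>3\<close> the two faces \<open>D\<^sup>2\<close> and \<open>D\<^sup>0\<close> of the cell compose to
  \<open>a \<cdot> T a\<close>, and the face \<open>D\<^sup>1\<close> is \<open>a \<cdot> \<mu>\<close>; the degenerate cell is \<open>a \<cdot> \<eta>\<close>.
  So the two conditions of descent are the two laws of an algebra.\<close>

lemma cell_descent:
  assumes w: "w \<in> Obj C" and a: "a \<in> hom C (omap T w) w"
  shows "(w, cell w a w) \<in> descent_data (strict_pseudo delta3 \<D> transported) \<longleftrightarrow>
    (w, a) \<in> EM_algebras C T \<eta> \<mu>"
proof -
  note C = C_category and T = T_functor
  have inv3: "inverse_functors (collage C T 3) (\<D> 3) (P 3) (Q 3)" by (rule inv) simp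
  note cell = transported_cell[OF w w a]
  have \<mu>: "\<mu> w \<in> hom C (omap T (omap T w)) (omap T w)" using nat_trans_hom[OF mult w] by simp
  have Ta: "amap T a \<in> hom C (omap T (omap T w)) (omap T w)" using functor_hom[OF T a] .
  have faces: "((w, 0), a, (w, 1)) \<in> hom (collage C T 3) (w, 0) (w, 1)"
    "((w, 1), a, (w, 2)) \<in> hom (collage C T 3) (w, 1) (w, 2)"
    using w a by (simp_all add: hom_collage)
  have "Comp (\<D> 3) (amap (transported (D_map 0)) (cell w a w)) (amap (transported (D_map 2)) (cell w a w)) =
      amap (P 3) (Comp (collage C T 3) ((w, 1), a, (w, 2)) ((w, 0), a, (w, 1)))"
    unfolding cell(1,3) by (rule functor_Comp[OF inverse_functors_to[OF inv3] faces(2,1), symmetric])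
  also have "\<dots> = amap (P 3) ((w, 0), Comp C a (amap T a), (w, 2))"
    by simp
  finally have comp: "Comp (\<D> 3) (amap (transported (D_map 0)) (cell w a w))
      (amap (transported (D_map 2)) (cell w a w)) = amap (P 3) ((w, 0), Comp C a (amap T a), (w, 2))" .
  have "amap (P 3) ((w, 0), Comp C a (amap T a), (w, 2)) = amap (P 3) ((w, 0), Comp C a (\<mu> w), (w, 2)) \<longleftrightarrow>
      Comp C a (amap T a) = Comp C a (\<mu> w)"
    using transported_eq_iff[of 3 "((w, 0), Comp C a (amap T a), (w, 2))" "(w, 0)" "(w, 2)"
        "((w, 0), Comp C a (\<mu> w), (w, 2))"]
      category_Comp[OF C a Ta] category_Comp[OF C a \<mu>] w by (simp add: hom_collage)
  then show ?thesis
    unfolding descent_data_strict[OF transported_diagram] transported_faces hom_cell[OF w] comp cell(2,4)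
    using w a by (auto simp: D1 EM_algebras_def)
qed

lemma descent_data_cells:
  "descent_data (strict_pseudo delta3 \<D> transported) =
    (\<lambda>(c, a). (c, cell c a c)) ` EM_algebras C T \<eta> \<mu>"
proof -
  have "\<exists>a. (w, a) \<in> EM_algebras C T \<eta> \<mu> \<and> \<phi> = cell w a w"
    if data: "(w, \<phi>) \<in> descent_data (strict_pseudo delta3 \<D> transported)" for w \<phi>
  proof -
    have w: "w \<in> Obj C" and "\<phi> \<in> hom (\<D> 2) (omap (P 2) (w, 0)) (omap (P 2) (w, 1))"
      using data unfolding descent_data_strict[OF transported_diagram] transported_faces D1 by auto
    then obtain a where a: "a \<in> hom C (omap T w) w" "\<phi> = cell w a w" using hom_cell by blast
    then show ?thesis using cell_descent[OF w a(1)] data by blast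
  qed
  moreover have "(w, cell w a w) \<in> descent_data (strict_pseudo delta3 \<D> transported)"
    if "(w, a) \<in> EM_algebras C T \<eta> \<mu>" for w a
    using cell_descent that by (auto simp: EM_algebras_def)
  ultimately show ?thesis by fastforce
qed

lemma cell_morphism:
  assumes a: "a \<in> hom C (omap T w) w" and a': "a' \<in> hom C (omap T w') w'" and m: "m \<in> hom C w w'"
  shows "Comp (\<D> 2) (amap (transported (d_map 0)) m) (cell w a w) =
      Comp (\<D> 2) (cell w' a' w') (amap (transported (d_map 1)) m) \<longleftrightarrow>
    Comp C m a = Comp C a' (amap T m)"
proof -
  note C = C_category and T = T_functor
  have inv2: "inverse_functors (collage C T 2) (\<D> 2) (P 2) (Q 2)" by (rule inv) simp
  have w: "w \<in> Obj C" and w': "w' \<in> Obj C" using category_hom_obj[OF C m] by auto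
  have m0: "((w, 0), m, (w', 0)) \<in> hom (collage C T 2) (w, 0) (w', 0)"
    and m1: "((w, 1), m, (w', 1)) \<in> hom (collage C T 2) (w, 1) (w', 1)"
    using w w' m by (simp_all add: hom_collage)
  note Tm = functor_hom[OF T m]
  have "Comp (\<D> 2) (amap (transported (d_map 0)) m) (cell w a w) =
      amap (P 2) ((w, 0), Comp C m a, (w', 1))"
    unfolding transported_faces(4)[OF m] cell_def
    using functor_Comp[OF inverse_functors_to[OF inv2] m1 cell_source[OF w w a]] by simp
  moreover have "Comp (\<D> 2) (cell w' a' w') (amap (transported (d_map 1)) m) =
      amap (P 2) ((w, 0), Comp C a' (amap T m), (w', 1))"
    unfolding transported_faces(3)[OF m] cell_def
    using functor_Comp[OF inverse_functors_to[OF inv2] cell_source[OF w' w' a'] m0] by simp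
  moreover have "amap (P 2) ((w, 0), Comp C m a, (w', 1)) =
      amap (P 2) ((w, 0), Comp C a' (amap T m), (w', 1)) \<longleftrightarrow> Comp C m a = Comp C a' (amap T m)"
    using transported_eq_iff[OF _ cell_source[OF w w' category_Comp[OF C m a]]
        cell_source[OF w w' category_Comp[OF C a' Tm]]] by simp
  ultimately show ?thesis by simp
qed

end

lemma inverse_functors_collage_1:
  assumes T: "is_functor C C T"
  shows "inverse_functors (collage C T 1) C \<lparr>omap = fst, amap = (\<lambda>(p, f, q). f)\<rparr>
    \<lparr>omap = (\<lambda>c. (c, 0)), amap = (\<lambda>f. ((Dom C f, 0), f, (Cod C f, 0)))\<rparr>"
proof -
  have C: "category C" using functor_source[OF T] .
  have "is_functor (collage C T 1) C \<lparr>omap = fst, amap = (\<lambda>(p, f, q). f)\<rparr>"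
    by (rule functorI[OF category_collage[OF T] C]) (auto simp: hom_collage)
  moreover have "is_functor C (collage C T 1)
      \<lparr>omap = (\<lambda>c. (c, 0)), amap = (\<lambda>f. ((Dom C f, 0), f, (Cod C f, 0)))\<rparr>"
  proof (rule functorI[OF C category_collage[OF T]])
    fix x y f assume f: "f \<in> hom C x y"
    then have "Dom C f = x" "Cod C f = y" by (simp_all add: hom_iff)
    then show "amap \<lparr>omap = (\<lambda>c. (c, 0)), amap = (\<lambda>f. ((Dom C f, 0), f, (Cod C f, 0)))\<rparr> f \<in>
        hom (collage C T 1)
          (omap \<lparr>omap = (\<lambda>c. (c, 0)), amap = (\<lambda>f. ((Dom C f, 0), f, (Cod C f, 0)))\<rparr> x)
          (omap \<lparr>omap = (\<lambda>c. (c, 0)), amap = (\<lambda>f. ((Dom C f, 0), f, (Cod C f, 0)))\<rparr> y)"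
      using category_hom_obj[OF C f] f by (simp add: hom_collage)
  next
    fix x y z f g assume "f \<in> hom C x y" "g \<in> hom C y z"
    then show "amap \<lparr>omap = (\<lambda>c. (c, 0)), amap = (\<lambda>f. ((Dom C f, 0), f, (Cod C f, 0)))\<rparr> (Comp C g f) =
        Comp (collage C T 1)
          (amap \<lparr>omap = (\<lambda>c. (c, 0)), amap = (\<lambda>f. ((Dom C f, 0), f, (Cod C f, 0)))\<rparr> g)
          (amap \<lparr>omap = (\<lambda>c. (c, 0)), amap = (\<lambda>f. ((Dom C f, 0), f, (Cod C f, 0)))\<rparr> f)"
      using category_Comp[OF C] by (fastforce simp: hom_iff)
  qed (use category_Idt[OF C] in \<open>auto simp: hom_iff\<close>)
  ultimately show ?thesis
    by (auto simp: inverse_functors_def functor_eq_def collage_def hom_iff)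
qed

lemma small_collage:
  assumes U: "universe U" and C: "in_Cat U C"
  shows "small U (Obj (collage C T 3))" and "small U (Arr (collage C T 3))"
proof -
  have obj: "small U (Obj C \<times> {..<3::nat})" and arr: "small U (Arr C)"
    using C small_Times[OF U small_member small_three[OF U]] small_member by (auto simp: in_Cat_def)
  show "small U (Obj (collage C T 3))" using obj by simp
  have "small U ((Obj C \<times> {..<3::nat}) \<times> Arr C \<times> (Obj C \<times> {..<3::nat}))"
    by (intro small_Times[OF U] obj arr)
  then show "small U (Arr (collage C T 3))"
    by (rule small_subset[OF U]) (auto simp: collage_def hom_iff)
qed

lemma collage_mono:
  assumes "n \<le> 3"
  shows "Obj (collage C T n) \<subseteq> Obj (collage C T 3)" "Arr (collage C T n) \<subseteq> Arr (collage C T 3)"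
  using assms by (auto simp: collage_def)

text \<open>The isomorphism between the two categories lies over \<open>C\<close>. One pair of injections, for the collage
  on \<open>3\<close>, encodes the collage on \<open>2\<close> as well, because that one is contained in it.\<close>

lemma EM_cat_is_lax_descent_category:
  fixes U :: "'u set set" and C :: "('u, 'u) cat"
  assumes U: "universe U" and C: "in_Cat U C"
    and \<eta>: "nat_trans C C id_functor T \<eta>" and \<mu>: "nat_trans C C (T \<circ>\<^sub>F T) T \<mu>"
  obtains A :: "'u descent" and \<theta> where
    "pseudofunctor U delta3 A" "pf_obj A 1 = C"
    "\<And>x. fst (\<theta> x) = fst x" "\<theta> ` EM_algebras C T \<eta> \<mu> = descent_data A"
    "is_functor (EM_cat C T \<eta> \<mu>) (lax_desc A) \<lparr>omap = \<theta>, amap = (\<lambda>(x, m, y). (\<theta> x, m, \<theta> y))\<rparr>"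
    "fully_faithful (EM_cat C T \<eta> \<mu>) (lax_desc A) \<lparr>omap = \<theta>, amap = (\<lambda>(x, m, y). (\<theta> x, m, \<theta> y))\<rparr>"
proof -
  interpret pointed_multiplicative C T \<eta> \<mu> by unfold_locales (fact \<eta> \<mu>)+
  obtain p :: "'u \<times> nat \<Rightarrow> 'u" where p: "inj_on p (Obj (collage C T 3))" "p ` Obj (collage C T 3) \<in> U"
    using small_collage(1)[OF U C] unfolding small_def by blast
  obtain q :: "('u \<times> nat) \<times> 'u \<times> ('u \<times> nat) \<Rightarrow> 'u"
    where q: "inj_on q (Arr (collage C T 3))" "q ` Arr (collage C T 3) \<in> U"
    using small_collage(2)[OF U C] unfolding small_def by blast
  define \<D> where "\<D> n = (if n = 1 then C else relabel p q (collage C T n))" for n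
  define P where "P n = (if n = 1 then \<lparr>omap = fst, amap = (\<lambda>(p, f, q). f)\<rparr> else \<lparr>omap = p, amap = q\<rparr>)"
    for n :: nat
  define Q where "Q n = (if n = 1 then \<lparr>omap = (\<lambda>c. (c, 0)), amap = (\<lambda>f. ((Dom C f, 0), f, (Cod C f, 0)))\<rparr>
    else unlabel p q (collage C T n))" for n
  have inv: "inverse_functors (collage C T n) (\<D> n) (P n) (Q n)" if n: "n \<in> {1, 2, 3}" for n
  proof (cases "n = 1")
    case True
    then show ?thesis using inverse_functors_collage_1[OF T_functor] by (simp add: \<D>_def P_def Q_def)
  next
    case False
    have "n \<le> 3" using n by auto
    then show ?thesis
      using inverse_functors_relabel[OF category_collage[OF T_functor]
          inj_on_subset[OF p(1) collage_mono(1)] inj_on_subset[OF q(1) collage_mono(2)]] False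
      by (simp add: \<D>_def P_def Q_def)
  qed
  have D1: "\<D> 1 = C" and P1: "P 1 = \<lparr>omap = fst, amap = (\<lambda>(p, f, q). f)\<rparr>"
    and Q1: "Q 1 = \<lparr>omap = (\<lambda>c. (c, 0)), amap = (\<lambda>f. ((Dom C f, 0), f, (Cod C f, 0)))\<rparr>"
    by (simp_all add: \<D>_def P_def Q_def)
  have in_Cat: "in_Cat U (\<D> n)" if n: "n \<in> {1, 2, 3}" for n
  proof (cases "n = 1")
    case True
    then show ?thesis using C D1 by simp
  next
    case False
    have "n \<le> 3" using n by auto
    then have "p ` Obj (collage C T n) \<in> U" "q ` Arr (collage C T n) \<in> U"
      using U p(2) q(2) collage_mono[of n C T] unfolding universe_def by (meson image_mono)+
    then show ?thesis
      using False functor_target[OF inverse_functors_to[OF inv[OF n]]]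
      by (simp add: in_Cat_def \<D>_def relabel_def)
  qed
  interpret encoded_collage C T \<eta> \<mu> \<D> P Q by unfold_locales (use inv D1 P1 Q1 in auto)
  define A where "A = strict_pseudo delta3 \<D> transported"
  define \<theta> where "\<theta> = (\<lambda>(c, a). (c, cell c a c))"
  have A: "pseudofunctor U delta3 A"
    unfolding A_def
    by (rule pseudofunctor_strict_pseudo[OF transported_diagram]) (simp_all add: in_Cat)
  interpret A: lax_descent U A by unfold_locales (fact A)
  have fst_\<theta>: "fst (\<theta> x) = fst x" for x by (simp add: \<theta>_def split: prod.splits)
  have image_\<theta>: "\<theta> ` EM_algebras C T \<eta> \<mu> = descent_data A"
    unfolding \<theta>_def A_def using descent_data_cells by simp
  have A1: "pf_obj A 1 = C" by (simp add: A_def D1)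
  note map = structure_cat_map[where \<theta>=\<theta>, OF category_EM_cat[OF T_functor, unfolded EM_cat_structure]
      A.category_lax_desc[unfolded lax_desc_structure A1] fst_\<theta> image_\<theta> _ refl,
      folded EM_cat_structure lax_desc_structure[of A, unfolded A1]]
  have R: "Comp (pf_obj A 2) (amap (pf_arr A (d_map 0)) m) (snd (\<theta> x)) =
      Comp (pf_obj A 2) (snd (\<theta> y)) (amap (pf_arr A (d_map 1)) m) \<longleftrightarrow>
      Comp C m (snd x) = Comp C (snd y) (amap T m)"
    if "x \<in> EM_algebras C T \<eta> \<mu>" "y \<in> EM_algebras C T \<eta> \<mu>" "m \<in> hom C (fst x) (fst y)" for x y m
    using that cell_morphism
    by (auto simp: EM_algebras_def \<theta>_def A_def)
  show thesis
    by (rule that[OF A A1 fst_\<theta> image_\<theta> map(1)[OF R] map(2)[OF R]])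
qed


section \<open>The characterization of monadicity\<close>

theorem theorem2p10:
  fixes U :: "'u set set"
    and B C :: "('u, 'u) cat"
    and G :: "('u, 'u, 'u, 'u) fctr"
  assumes "universe U" and "in_Cat U B" and "in_Cat U C"
    and "is_functor B C G"
    and "has_left_adjoint B C G"
  shows "monadic B C G \<longleftrightarrow>
    (\<exists>A :: 'u descent. pseudofunctor U delta3 A \<and> pf_obj A 1 = C \<and>
       (\<exists>K. is_equivalence B (lax_desc A) K \<and> functor_eq B G (forget_desc \<circ>\<^sub>F K)))"
proof
  assume "monadic B C G"
  then obtain F \<eta> \<epsilon> where adj: "adjunction B C F G \<eta> \<epsilon>"
    and \<Phi>_eq: "is_equivalence B (induced_EM C F G \<eta> \<epsilon>) (comparison B G \<epsilon>)"
    unfolding monadic_def by blast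
  let ?T = "G \<circ>\<^sub>F F" and ?\<mu> = "\<lambda>c. amap G (\<epsilon> (omap F c))" and ?\<Phi> = "comparison B G \<epsilon>"
  note G = adjunction_right[OF adj] and F = adjunction_left[OF adj]
  note T = comp_is_functor[OF F G]
  have B: "category B" and C: "category C" using functor_source[OF G] functor_target[OF G] .
  have \<eta>: "nat_trans C C id_functor ?T \<eta>" using adj by (simp add: adjunction_def)
  have \<mu>: "nat_trans C C (?T \<circ>\<^sub>F ?T) ?T ?\<mu>"
  proof (rule nat_transI[OF comp_is_functor[OF T T] T])
    fix c assume c: "c \<in> Obj C"
    show "?\<mu> c \<in> hom C (omap (?T \<circ>\<^sub>F ?T) c) (omap ?T c)"
      using functor_hom[OF G adjunction_counit_hom[OF adj functor_obj[OF F c]]] by simp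
  next
    fix c c' m assume m: "m \<in> hom C c c'"
    have c: "c \<in> Obj C" and c': "c' \<in> Obj C" using category_hom_obj[OF C m] by auto
    note \<epsilon> = adjunction_counit_hom[OF adj functor_obj[OF F c]]
      adjunction_counit_hom[OF adj functor_obj[OF F c']]
    note Fm = functor_hom[OF F m]
    show "Comp C (?\<mu> c') (amap (?T \<circ>\<^sub>F ?T) m) = Comp C (amap ?T m) (?\<mu> c)"
      using functor_square[OF G functor_hom[OF F functor_hom[OF G Fm]] Fm \<epsilon>
          adjunction_counit_natural[OF adj Fm]] by simp
  qed
  obtain A :: "'u descent" and \<theta> where A: "pseudofunctor U delta3 A" "pf_obj A 1 = C"
    and \<theta>: "\<And>x. fst (\<theta> x) = fst x" "\<theta> ` EM_algebras C ?T \<eta> ?\<mu> = descent_data A"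
    and J: "is_functor (EM_cat C ?T \<eta> ?\<mu>) (lax_desc A) \<lparr>omap = \<theta>, amap = (\<lambda>(x, m, y). (\<theta> x, m, \<theta> y))\<rparr>"
    and J_ff: "fully_faithful (EM_cat C ?T \<eta> ?\<mu>) (lax_desc A)
      \<lparr>omap = \<theta>, amap = (\<lambda>(x, m, y). (\<theta> x, m, \<theta> y))\<rparr>"
    using EM_cat_is_lax_descent_category[OF assms(1,3) \<eta> \<mu>] by blast
  define J where "J = \<lparr>omap = \<theta>, amap = (\<lambda>(x :: 'u \<times> 'u, m :: 'u, y). (\<theta> x, m, \<theta> y))\<rparr>"
  note J = J[folded induced_EM_def J_def] and J_ff = J_ff[folded induced_EM_def J_def]
  have \<Phi>: "is_functor B (induced_EM C F G \<eta> \<epsilon>) ?\<Phi>" using \<Phi>_eq by (simp add: is_equivalence_def)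
  note K = comp_is_functor[OF \<Phi> J]
  have "essentially_surjective B (lax_desc A) (J \<circ>\<^sub>F ?\<Phi>)"
    unfolding essentially_surjective_def
  proof
    fix y assume "y \<in> Obj (lax_desc A)"
    then have "y \<in> \<theta> ` Obj (induced_EM C F G \<eta> \<epsilon>)"
      using \<theta>(2) by (simp add: lax_desc_structure induced_EM_def EM_cat_structure)
    then obtain x where x: "x \<in> Obj (induced_EM C F G \<eta> \<epsilon>)" "y = omap J x" by (auto simp: J_def)
    then obtain b k where b: "b \<in> Obj B" and k: "k \<in> hom (induced_EM C F G \<eta> \<epsilon>) (omap ?\<Phi> b) x"
      "is_iso (induced_EM C F G \<eta> \<epsilon>) k"
      using equivalence_essentially_surjective[OF \<Phi>_eq] unfolding essentially_surjective_def by blast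
    show "\<exists>b \<in> Obj B. \<exists>i \<in> hom (lax_desc A) (omap (J \<circ>\<^sub>F ?\<Phi>) b) y. is_iso (lax_desc A) i"
      using b functor_hom[OF J k(1)] functor_preserves_iso[OF J k] by (auto simp: x(2))
  qed
  then have "is_equivalence B (lax_desc A) (J \<circ>\<^sub>F ?\<Phi>)"
    by (rule fully_faithful_essentially_surjective_equivalence[OF K
          fully_faithful_comp[OF \<Phi> J equivalence_fully_faithful[OF \<Phi>_eq] J_ff]])
  moreover have "functor_eq B G (forget_desc \<circ>\<^sub>F (J \<circ>\<^sub>F ?\<Phi>))"
    by (rule functor_eqI)
      (simp_all add: forget_desc_def J_def omap_comparison amap_comparison case_prod_unfold \<theta>(1))
  ultimately show "\<exists>A :: 'u descent. pseudofunctor U delta3 A \<and> pf_obj A 1 = C \<and>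
      (\<exists>K. is_equivalence B (lax_desc A) K \<and> functor_eq B G (forget_desc \<circ>\<^sub>F K))"
    using A by blast
next
  assume "\<exists>A :: 'u descent. pseudofunctor U delta3 A \<and> pf_obj A 1 = C \<and>
    (\<exists>K. is_equivalence B (lax_desc A) K \<and> functor_eq B G (forget_desc \<circ>\<^sub>F K))"
  then obtain A :: "'u descent" and K where A: "pseudofunctor U delta3 A" and A1: "pf_obj A 1 = C"
    and K: "is_equivalence B (lax_desc A) K" "functor_eq B G (forget_desc \<circ>\<^sub>F K)" by blast
  interpret lax_descent U A by unfold_locales (fact A)
  obtain F \<eta> \<epsilon> where adj: "adjunction B C F G \<eta> \<epsilon>"
    using assms(5) unfolding has_left_adjoint_def by blast
  then show "monadic B C G"
    using comparison_equivalence_if_factors_through_lax_descent[OF _ K] A1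
    unfolding monadic_def by metis
qed

end
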